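(* Let $G$ be a Matsubara graph with $V$ vertices and $I$ lines (with a chosen orientation of each line). Let $\{q_i\}$, $i=1,\dots,I$, be the set of positive real values associated to the lines of $G$, let $\{N_v\}$, $v=1,\dots,V$, be the set of integer values associated to the vertices of $G$, with $\sum_{v=1}^VN_v=0$, and let $L:=I-V+1$ be the number of independent cycles of $G$. Then the relationship between the Matsubara sum $S_G$ and the Matsubara integral $I_G$ can be written as $$S_G(\{N_v\},\{q_i\})=\hat{\mathcal O}'_G(\{q_i\})\,I_G(\{N_v\},\{q_i\}),$$ where $$\hat{\mathcal O}'_G(\{q_i\}):=1+\sum_{i=1}^{I}n_b(q_i)(1-\hat R_i)+\sum_{\langle i_1,i_2\rangle}^{\prime}n_b(q_{i_1})n_b(q_{i_2})(1-\hat R_{i_1})(1-\hat R_{i_2})+\dots+\sum_{\langle i_1,\dots,i_L\rangle}^{\prime}\ \prod_{l=1}^{L}n_b(q_{i_l})(1-\hat R_{i_l}).$$ Here the indices $i_1,i_2,\dots$ run from $1$ to $I$, the symbol $\langle i_1,\dots,i_k\rangle$ stands for an unordered $k$-tuple with no repeated indices, representing a particular set of lines, and the prime on the summation symbols means that the tuples that are cutsets of $G$ are excluded from the sums.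
   Context: **Matsubara graph.** A connected finite multigraph $G$ with $V$ vertices and $I$ lines (edges), such that every line joins two different vertices (no line joins a vertex to itself) and every vertex is an endpoint of at least two different lines; a pair of vertices may be joined by more than one line. **Cutset.** A cutset of the connected graph $G$ is a set of lines whose removal from $G$ results in a disconnected graph. **Data.** Choose an orientation of each line $i$. To line $i$ attach a real $q_i>0$ and an integer summation variable $n_i$; to each vertex $v$ attach an integer $N_v$ and $T_v:=\sum_i s^v_i n_i$, where $s^v_i=+1$ if line $i$ is oriented into $v$, $-1$ if it is oriented away from $v$, and $0$ if it is not incident on $v$. **Matsubara sum.** $$S_G(\{N_v\},\{q_i\}):=\sum_{n_1=-\infty}^{\infty}\cdots\sum_{n_I=-\infty}^{\infty}\frac{\delta_G(n;N)}{\prod_{i=1}^I(n_i^2+q_i^2)},\qquad \delta_G(n;N)=\prod_{v=1}^V\delta_{T_v,N_v}\quad\text{(Kronecker deltas)}.$$ **Matsubara integral.** $I_G(\{N_v\},\{q_i\})$ is obtained from $S_G$ by replacing the integer variables $n_i$ by real variables $x_i$ and the sums by integrals over $(-\infty,\infty)$, the constraints being imposed by Dirac deltas for the $V-1$ independent vertex equations. Explicitly: for any spanning tree $\mathcal T$ of $G$, the equations $\sum_i s^v_ix_i=N_v$ $(v=1,\dots,V)$ determine the $x_j$, $j\in\mathcal T$, as affine functions of the $x_l$, $l\notin\mathcal T$, and $$I_G=\int_{\mathbb R^{L}}\ \prod_{i=1}^I\frac1{x_i^2+q_i^2}\ \prod_{l\notin\mathcal T}dx_l.$$ The operators below act on the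 evaluation of this integral, i.e. on the explicit closed-form expression (rational in the $q_i$) that it equals for positive $q_i$, and not on the integrand. **Kernel and operators.** $n_b(z)=\dfrac1{e^{2\pi z}-1}$. The reflection operator $\hat R_i$ acts on functions of $(q_1,\dots,q_I)$ by $(\hat R_if)(q_1,\dots,q_i,\dots,q_I)=f(q_1,\dots,-q_i,\dots,q_I)$. In $n_b(q_i)(1-\hat R_i)$ the factor $n_b(q_i)$ is a multiplication operator applied after $1-\hat R_i$.
   Formalization: At positive q where a reflected term of the closed form of I_G has a pole (e.g. two lines, N=0, q_1=q_2) the right side is undefined; equality is stated where all reflected terms are defined, and at every positive q the right side tends to S_G along such points. *)

theory Defs
  imports
    "HOL-Analysis.Analysis"
    "HOL-Computational_Algebra.Polynomial"
    "Graph_Theory.Digraph_Component"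
begin

text \<open>
  A multigraph with oriented lines is a \<open>pre_digraph\<close>: lines are arcs, each oriented from its tail
  to its head. Connectedness is that of the underlying undirected graph (it is defined through
  \<open>mk_symmetric\<close>), so it does not depend on the orientation.
\<close>

definition with_lines :: "('v, 'e) pre_digraph \<Rightarrow> 'e set \<Rightarrow> ('v, 'e) pre_digraph" where
  "with_lines G A = G\<lparr>arcs := A\<rparr>"

locale matsubara_graph = fin_digraph G + loopfree_digraph G
  for G :: "('v, 'e) pre_digraph" +
  assumes connected: "Digraph_Component.connected G"
    and two_lines: "v \<in> verts G \<Longrightarrow> card {i \<in> arcs G. tail G i = v \<or> head G i = v} \<ge> 2"

definition cutset :: "('v, 'e) pre_digraph \<Rightarrow> 'e set \<Rightarrow> bool" where
  "cutset G A \<longleftrightarrow> A \<subseteq> arcs G \<and> \<not> Digraph_Component.connected (with_lines G (arcs G - A))"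

text \<open>
  Spanning trees are given by their sets of lines, as the minimal ones that connect all vertices.
  The library's \<open>spanning_tree\<close> is not the right notion here: its \<open>forest\<close> only excludes directed
  cycles.
\<close>

definition spanning_tree_lines :: "('v, 'e) pre_digraph \<Rightarrow> 'e set \<Rightarrow> bool" where
  "spanning_tree_lines G T \<longleftrightarrow> T \<subseteq> arcs G \<and> Digraph_Component.connected (with_lines G T) \<and>
     (\<forall>i\<in>T. \<not> Digraph_Component.connected (with_lines G (T - {i})))"

text \<open>Written with an addition first, since subtraction on \<^typ>\<open>nat\<close> truncates.\<close>

definition num_cycles :: "('v, 'e) pre_digraph \<Rightarrow> nat" where
  "num_cycles G = card (arcs G) + 1 - card (verts G)"

definition incidence :: "('v, 'e) pre_digraph \<Rightarrow> 'v \<Rightarrow> 'e \<Rightarrow> 'c::ring_1" where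
  "incidence G v i = (if head G i = v then 1 else if tail G i = v then -1 else 0)"

definition vertex_total :: "('v, 'e) pre_digraph \<Rightarrow> ('e \<Rightarrow> 'c::ring_1) \<Rightarrow> 'v \<Rightarrow> 'c" where
  "vertex_total G x v = (\<Sum>i\<in>arcs G. incidence G v i * x i)"

text \<open>
  The series converges absolutely for positive \<open>q\<close>, so the iterated sum over the integers attached
  to the lines is the unordered sum over all integer labellings of the lines.
\<close>

definition matsubara_sum :: "('v, 'e) pre_digraph \<Rightarrow> ('v \<Rightarrow> int) \<Rightarrow> ('e \<Rightarrow> real) \<Rightarrow> real" where
  "matsubara_sum G N q =
     (\<Sum>\<^sub>\<infinity>n\<in>arcs G \<rightarrow>\<^sub>E (UNIV :: int set).
        (\<Prod>v\<in>verts G. if vertex_total G n v = N v then 1 else 0) /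
        (\<Prod>i\<in>arcs G. (real_of_int (n i))\<^sup>2 + (q i)\<^sup>2))"

text \<open>
  The labelling of all lines determined by the vertex equations from its values \<open>y\<close> on the lines
  outside the spanning tree \<open>T\<close>; it exists because the \<open>N v\<close> add up to zero.
\<close>

definition line_values ::
    "('v, 'e) pre_digraph \<Rightarrow> 'e set \<Rightarrow> ('v \<Rightarrow> int) \<Rightarrow> ('e \<Rightarrow> real) \<Rightarrow> 'e \<Rightarrow> real" where
  "line_values G T N y =
     (THE x. x \<in> arcs G \<rightarrow>\<^sub>E UNIV \<and> (\<forall>l\<in>arcs G - T. x l = y l) \<and>
             (\<forall>v\<in>verts G. vertex_total G x v = real_of_int (N v)))"

definition matsubara_integral ::
    "('v, 'e) pre_digraph \<Rightarrow> 'e set \<Rightarrow> ('v \<Rightarrow> int) \<Rightarrow> ('e \<Rightarrow> real) \<Rightarrow> real" where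
  "matsubara_integral G T N q =
     (LINT y|(\<Pi>\<^sub>M l\<in>arcs G - T. lborel).
        (\<Prod>i\<in>arcs G. 1 / ((line_values G T N y i)\<^sup>2 + (q i)\<^sup>2)))"

text \<open>
  The integral formula depends on each \<open>q i\<close> only through its square; the reflections act instead
  on the rational function that the integral equals for positive \<open>q\<close>. Polynomials in
  the variables \<open>q i\<close>, \<open>i \<in> E\<close>, are represented as polynomial functions.
\<close>

inductive polynomial_in :: "'e set \<Rightarrow> (('e \<Rightarrow> real) \<Rightarrow> real) \<Rightarrow> bool" for E where
  const: "polynomial_in E (\<lambda>q. c)"
| var: "i \<in> E \<Longrightarrow> polynomial_in E (\<lambda>q. q i)"
| add: "polynomial_in E f \<Longrightarrow> polynomial_in E g \<Longrightarrow> polynomial_in E (\<lambda>q. f q + g q)"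
| mult: "polynomial_in E f \<Longrightarrow> polynomial_in E g \<Longrightarrow> polynomial_in E (\<lambda>q. f q * g q)"

definition positive_on :: "'e set \<Rightarrow> ('e \<Rightarrow> real) \<Rightarrow> bool" where
  "positive_on E q \<longleftrightarrow> (\<forall>i\<in>E. q i > 0)"

definition rational_expression ::
    "'e set \<Rightarrow> (('e \<Rightarrow> real) \<Rightarrow> real) \<Rightarrow> (('e \<Rightarrow> real) \<Rightarrow> real) \<Rightarrow> (('e \<Rightarrow> real) \<Rightarrow> real) \<Rightarrow> bool" where
  "rational_expression E f P Q \<longleftrightarrow> polynomial_in E P \<and> polynomial_in E Q \<and>
     (\<forall>q. positive_on E q \<longrightarrow> Q q \<noteq> 0 \<and> f q = P q / Q q)"

definition regular_at :: "'e set \<Rightarrow> (('e \<Rightarrow> real) \<Rightarrow> real) \<Rightarrow> ('e \<Rightarrow> real) \<Rightarrow> bool" where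
  "regular_at E f q \<longleftrightarrow> (\<exists>P Q. rational_expression E f P Q \<and> Q q \<noteq> 0)"

text \<open>
  The value at \<open>q\<close>, whose entries may have any signs, of the rational function equal to \<open>f\<close>
  at positive arguments; meaningful at points where that rational function is regular.
\<close>

definition closed_form :: "'e set \<Rightarrow> (('e \<Rightarrow> real) \<Rightarrow> real) \<Rightarrow> ('e \<Rightarrow> real) \<Rightarrow> real" where
  "closed_form E f q = (THE c. \<exists>P Q. rational_expression E f P Q \<and> Q q \<noteq> 0 \<and> c = P q / Q q)"

lemma polynomial_in_on_line:
  assumes "polynomial_in E f"
  shows "\<exists>p. \<forall>t. f (\<lambda>i. a i + t * d i) = poly p t"
  using assms
proof induction
  case (const c)
  show ?case by (rule exI[of _ "[:c:]"]) simp
next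
  case (var i)
  show ?case by (rule exI[of _ "[:a i, d i:]"]) simp
next
  case (add f g)
  then obtain p r where "\<forall>t. f (\<lambda>i. a i + t * d i) = poly p t" "\<forall>t. g (\<lambda>i. a i + t * d i) = poly r t"
    by blast
  then show ?case by (intro exI[of _ "p + r"]) simp
next
  case (mult f g)
  then obtain p r where "\<forall>t. f (\<lambda>i. a i + t * d i) = poly p t" "\<forall>t. g (\<lambda>i. a i + t * d i) = poly r t"
    by blast
  then show ?case by (intro exI[of _ "p * r"]) simp
qed

lemma polynomial_in_zero:
  assumes "polynomial_in E f" "finite E" "\<And>q. positive_on E q \<Longrightarrow> f q = 0"
  shows "f q = 0"
proof -
  define d where "d = (\<lambda>i. q i - 1)"
  obtain p where p: "\<And>t. f (\<lambda>i. 1 + t * d i) = poly p t"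
    using polynomial_in_on_line[OF assms(1), of "\<lambda>_. 1" d] by auto
  have "\<forall>\<^sub>F t in at_right (0::real). \<forall>i\<in>E. 1 + t * d i > 0"
  proof (rule eventually_ball_finite[OF assms(2)], rule ballI)
    fix i
    have "((\<lambda>t. 1 + t * d i) \<longlongrightarrow> 1 + 0 * d i) (at_right 0)" by (intro tendsto_intros)
    then show "\<forall>\<^sub>F t in at_right (0::real). 1 + t * d i > 0"
      by (rule order_tendstoD) simp
  qed
  then obtain e where e: "e > 0" "\<And>t. 0 < t \<Longrightarrow> t < e \<Longrightarrow> \<forall>i\<in>E. 1 + t * d i > 0"
    unfolding eventually_at_right_field by auto
  have "{0<..<e} \<subseteq> {t. poly p t = 0}"
  proof
    fix t assume "t \<in> {0<..<e}"
    then have "positive_on E (\<lambda>i. 1 + t * d i)" using e(2) by (simp add: positive_on_def)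
    from assms(3)[OF this] show "t \<in> {t. poly p t = 0}" using p[of t] by simp
  qed
  moreover have "infinite {0<..<e}" using e(1) by simp
  ultimately have "p = 0" using poly_roots_finite finite_subset by blast
  then show ?thesis using p[of 1] by (simp add: d_def)
qed

lemma rational_expression_unique:
  assumes "rational_expression E f P Q" "rational_expression E f P' Q'" "finite E"
    and "Q q \<noteq> 0" "Q' q \<noteq> 0"
  shows "P q / Q q = P' q / Q' q"
proof -
  have "polynomial_in E (\<lambda>q. P q * Q' q + (-1) * (P' q * Q q))"
    using assms(1,2) unfolding rational_expression_def
    by (intro polynomial_in.intros) auto
  moreover have "P q * Q' q + (-1) * (P' q * Q q) = 0" if "positive_on E q" for q
  proof -
    have "Q q \<noteq> 0" "Q' q \<noteq> 0" "P q / Q q = P' q / Q' q"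
      using assms(1,2) that unfolding rational_expression_def by metis+
    then show ?thesis by (simp add: field_simps)
  qed
  ultimately have "P q * Q' q + (-1) * (P' q * Q q) = 0"
    using polynomial_in_zero[OF _ assms(3)] by blast
  then show ?thesis using assms(4,5) by (simp add: field_simps)
qed

lemma closed_form_eq:
  assumes "rational_expression E f P Q" "Q q \<noteq> 0" "finite E"
  shows "closed_form E f q = P q / Q q"
  unfolding closed_form_def
proof (rule the_equality)
  show "\<exists>P' Q'. rational_expression E f P' Q' \<and> Q' q \<noteq> 0 \<and> P q / Q q = P' q / Q' q"
    using assms(1,2) by blast
next
  fix c
  assume "\<exists>P' Q'. rational_expression E f P' Q' \<and> Q' q \<noteq> 0 \<and> c = P' q / Q' q"
  then obtain P' Q' where *: "rational_expression E f P' Q'" "Q' q \<noteq> 0" and c: "c = P' q / Q' q"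
    by blast
  show "c = P q / Q q"
    unfolding c by (rule rational_expression_unique[where E = E and f = f and q = q, OF *(1) assms(1,3) *(2) assms(2)])
qed

definition n_b :: "real \<Rightarrow> real" where
  "n_b z = 1 / (exp (2 * pi * z) - 1)"

definition reflection :: "'e \<Rightarrow> (('e \<Rightarrow> real) \<Rightarrow> real) \<Rightarrow> ('e \<Rightarrow> real) \<Rightarrow> real" where
  "reflection i f = (\<lambda>q. f (q(i := - q i)))"

definition thermal :: "'e \<Rightarrow> (('e \<Rightarrow> real) \<Rightarrow> real) \<Rightarrow> ('e \<Rightarrow> real) \<Rightarrow> real" where
  "thermal i f = (\<lambda>q. n_b (q i) * (f q - reflection i f q))"

text \<open>
  The product (composition) of the operators \<^term>\<open>thermal i\<close> over the lines \<open>i \<in> A\<close>; they commute.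
\<close>

definition thermal_prod :: "'e set \<Rightarrow> (('e \<Rightarrow> real) \<Rightarrow> real) \<Rightarrow> ('e \<Rightarrow> real) \<Rightarrow> real" where
  "thermal_prod A f = Finite_Set.fold thermal f A"

lemma comp_fun_commute_thermal: "comp_fun_commute thermal"
proof
  fix i j :: 'e
  show "thermal j \<circ> thermal i = thermal i \<circ> thermal j"
  proof (cases "i = j")
    case False
    then show ?thesis
      by (auto simp: fun_eq_iff thermal_def reflection_def fun_upd_twist algebra_simps)
  qed simp
qed

lemma thermal_prod_empty: "thermal_prod {} f = f"
  by (simp add: thermal_prod_def)

lemma thermal_prod_insert:
  assumes "finite A" "i \<notin> A"
  shows "thermal_prod (insert i A) f = thermal i (thermal_prod A f)"
proof -
  interpret comp_fun_commute thermal by (rule comp_fun_commute_thermal)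
  show ?thesis unfolding thermal_prod_def by (rule fold_insert[OF assms])
qed

definition matsubara_operator ::
    "('v, 'e) pre_digraph \<Rightarrow> (('e \<Rightarrow> real) \<Rightarrow> real) \<Rightarrow> ('e \<Rightarrow> real) \<Rightarrow> real" where
  "matsubara_operator G f q =
     f q + (\<Sum>i\<in>arcs G. thermal i f q) +
     (\<Sum>k = 2..num_cycles G.
        \<Sum>A | A \<subseteq> arcs G \<and> card A = k \<and> \<not> cutset G A. thermal_prod A f q)"

text \<open>
  For special \<open>q\<close> (for instance \<open>q 1 = q 2\<close> on the graph with two vertices joined by the
  lines 1 and 2, and \<open>N = 0\<close>) single reflected terms have poles, which cancel in the total.
  The following points are those positive ones at which every term of the operator, applied
  to the rational function of \<open>f\<close>, is defined; at the other positive points the value of the whole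
  expression is its limit along them.
\<close>

definition regular_points ::
    "('v, 'e) pre_digraph \<Rightarrow> (('e \<Rightarrow> real) \<Rightarrow> real) \<Rightarrow> ('e \<Rightarrow> real) set" where
  "regular_points G f =
     {q. positive_on (arcs G) q \<and>
         (\<forall>A B. B \<subseteq> A \<and> A \<subseteq> arcs G \<and>
                (card A \<le> 1 \<or> card A \<le> num_cycles G \<and> \<not> cutset G A) \<longrightarrow>
                regular_at (arcs G) f (\<lambda>i. if i \<in> B then - q i else q i))}"

end

theory Submission
  imports Defs "HOL-Probability.Sinc_Integral" "HOL-Real_Asymp.Real_Asymp"
begin

text \<open>
  The sum and the integral integrate the same weight over the lines outside \<open>T\<close>, once against the
  counting measure on the integers and once against Lebesgue measure. For both measures, a product
  of at least two simple poles integrates to \<open>\<pi> i\<close> times the sum of its residues at \<open>a\<close> multiplied by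
  \<open>kap a + c\<close>, where \<open>c\<close> is arbitrary because the residues add up to zero; here \<open>kap\<close> is the sign of
  the imaginary part for Lebesgue measure and a hyperbolic cotangent for the counting measure. As both
  kernels obey the same addition theorem, integrating out one line after the other leads in both cases
  to the same formula of Gaudin type: a sum over all spanning trees \<open>A\<close> in which each line off \<open>A\<close> is
  put on shell with a factor \<open>kap (\<plusminus> i q) \<plusminus> 1\<close>. For the integral only one amplitude per tree
  survives; for the sum, \<open>kap (i q) = 1 + 2 n_b q\<close> turns the factors of the lines off \<open>A\<close> into
  \<open>1 + n_b (1 - R)\<close> acting on that amplitude. The amplitude of \<open>A\<close> is even in \<open>q i\<close> for \<open>i \<in> A\<close>, so it
  is killed by every operator product over a set of lines meeting \<open>A\<close>; hence the operator may be
  written uniformly as the sum over all sets of lines that avoid some spanning tree, which are the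
  sets that are not cutsets.

  The residue calculus needs generic \<open>q\<close>, for which no poles coincide. The remaining points are reached
  by continuity of the sum and of rational functions along lines through \<open>q\<close>.
\<close>

subsection \<open>Integrals of products of poles\<close>

text \<open>The list of integrated lines attaches a sign pattern to every tree. The pattern comes
  from the addition theorem alone, so it is the same for both measures, and the two results can be
  compared tree by tree. The choice c = 1 makes the Lebesgue factor 2 or 0, which amounts to closing
  contours in the upper half-plane; the integral then keeps for each tree just the sign vector that
  agrees with its pattern.

  The amplitude of one tree can have spurious poles at positive arguments, which cancel only in the
  sum over trees. A rational expression of the integral must have a denominator without zeros at
  positive arguments, and the amplitudes do not provide one. Rationality is therefore proved
  separately: 1/(x^2 + q^2) is split into 1/((q + i x)(q - i x)), and the integrals are reduced by
  1/(u v) = (1/u + 1/v)/(u + v), where u + v again has positive real part. Both descriptions are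
  rational and agree at generic positive points, hence also at generic reflected points.\<close>

lemma prod_inverse_partial_fractions:
  fixes a :: "'k \<Rightarrow> 'f::field"
  assumes "finite K" "K \<noteq> {}" "inj_on a K" "\<And>k. k \<in> K \<Longrightarrow> y \<noteq> a k"
  shows "(\<Prod>k\<in>K. 1 / (y - a k)) = (\<Sum>k\<in>K. (\<Prod>j\<in>K-{k}. 1 / (a k - a j)) / (y - a k))"
  using assms
proof (induction K arbitrary: y rule: finite_ne_induct)
  case (singleton x)
  then show ?case by simp
next
  case (insert x F)
  define r where "r k = (\<Prod>j\<in>F-{k}. 1 / (a k - a j))" for k
  have inj: "inj_on a F" and ne: "\<And>k. k \<in> F \<Longrightarrow> a x \<noteq> a k"
    using insert.prems insert.hyps by (auto simp: inj_on_def)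
  have 1: "(\<Prod>k\<in>F. 1 / (y - a k)) = (\<Sum>k\<in>F. r k / (y - a k))"
    unfolding r_def using insert inj by auto
  have 2: "(\<Prod>k\<in>F. 1 / (a x - a k)) = (\<Sum>k\<in>F. r k / (a x - a k))"
    unfolding r_def using insert inj ne by auto
  have yx: "y \<noteq> a x" using insert.prems by auto
  have r: "(\<Prod>j\<in>insert x F-{k}. 1 / (a k - a j)) = r k / (a k - a x)" if "k \<in> F" for k
  proof -
    have "insert x F - {k} = insert x (F - {k})" using that insert.hyps by auto
    then show ?thesis using insert.hyps by (simp add: r_def)
  qed
  have "(\<Prod>k\<in>insert x F. 1 / (y - a k)) = 1 / (y - a x) * (\<Sum>k\<in>F. r k / (y - a k))"
    using insert.hyps 1 by simp
  also have "\<dots> = (\<Sum>k\<in>F. r k / (a k - a x) / (y - a k) + r k / (a x - a k) / (y - a x))"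
    unfolding sum_distrib_left
  proof (rule sum.cong)
    fix k assume "k \<in> F"
    then have "a x \<noteq> a k" "y \<noteq> a k" using ne insert.prems by auto
    then show "1 / (y - a x) * (r k / (y - a k)) = r k / (a k - a x) / (y - a k) + r k / (a x - a k) / (y - a x)"
      using yx by (simp add: divide_simps) (simp add: algebra_simps)
  qed simp
  also have "\<dots> = (\<Sum>k\<in>F. r k / (a k - a x) / (y - a k)) + (\<Prod>k\<in>F. 1 / (a x - a k)) / (y - a x)"
    by (simp add: sum.distrib sum_divide_distrib 2)
  also have "(\<Prod>k\<in>F. 1 / (a x - a k)) = (\<Prod>j\<in>insert x F-{x}. 1 / (a x - a j))"
    using insert.hyps by (intro prod.cong) auto
  also have "(\<Sum>k\<in>F. r k / (a k - a x) / (y - a k))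
    = (\<Sum>k\<in>F. (\<Prod>j\<in>insert x F-{k}. 1 / (a k - a j)) / (y - a k))"
    by (intro sum.cong) (simp_all add: r)
  finally show ?case using insert.hyps by (simp add: add.commute)
qed

text \<open>Take one pole \<open>x\<close> out and evaluate the partial fractions of the remaining
  product at \<open>a x\<close>: this expresses the residue at \<open>x\<close> as minus the sum of
  the others. At least two poles are needed for the remaining product to be nonempty.\<close>

lemma sum_residues_zero:
  fixes a :: "'k \<Rightarrow> 'f::field"
  assumes "finite K" "card K \<ge> 2" "inj_on a K"
  shows "(\<Sum>k\<in>K. \<Prod>j\<in>K-{k}. 1 / (a k - a j)) = 0"
proof -
  obtain x where x: "x \<in> K" using assms by fastforce
  define F where "F = K - {x}"
  have K: "K = insert x F" "x \<notin> F" "finite F" using x assms by (auto simp: F_def)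
  have "card F \<ge> 1" using assms x by (simp add: F_def)
  then have ne: "F \<noteq> {}" by auto
  have inj: "inj_on a F" and d: "\<And>k. k \<in> F \<Longrightarrow> a x \<noteq> a k"
    using assms(3) K by (auto simp: inj_on_def)
  have "(\<Sum>k\<in>K. \<Prod>j\<in>K-{k}. 1 / (a k - a j))
     = (\<Prod>j\<in>F. 1 / (a x - a j)) + (\<Sum>k\<in>F. \<Prod>j\<in>K-{k}. 1 / (a k - a j))"
    using K by simp
  also have "(\<Prod>j\<in>F. 1 / (a x - a j)) = (\<Sum>k\<in>F. (\<Prod>j\<in>F-{k}. 1 / (a k - a j)) / (a x - a k))"
    using prod_inverse_partial_fractions[OF K(3) ne inj, of "a x"] d by auto
  also have "(\<Sum>k\<in>F. \<Prod>j\<in>K-{k}. 1 / (a k - a j)) = (\<Sum>k\<in>F. - ((\<Prod>j\<in>F-{k}. 1 / (a k - a j)) / (a x - a k)))"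
  proof (rule sum.cong)
    fix k assume k: "k \<in> F"
    have "K - {k} = insert x (F - {k})" using k K by auto
    then have "(\<Prod>j\<in>K-{k}. 1 / (a k - a j)) = (\<Prod>j\<in>F-{k}. 1 / (a k - a j)) / (a k - a x)"
      using K by simp
    also have "\<dots> = - ((\<Prod>j\<in>F-{k}. 1 / (a k - a j)) / (a x - a k))"
      using minus_divide_right[of "\<Prod>j\<in>F-{k}. 1 / (a k - a j)" "a x - a k"] by simp
    finally show "(\<Prod>j\<in>K-{k}. 1 / (a k - a j)) = - ((\<Prod>j\<in>F-{k}. 1 / (a k - a j)) / (a x - a k))" .
  qed simp
  finally show ?thesis by (simp add: sum_negf)
qed

text \<open>Follows from x^2 <= 2 (x - p)^2 + 2 p^2. It reduces the integrability of every
  Lorentzian to that of the one with centre 0 and width 1.\<close>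

lemma lorentz_shift_bound:
  fixes x p s :: real
  assumes "s \<noteq> 0"
  shows "1 / ((x - p)\<^sup>2 + s\<^sup>2) \<le> (2 + (2 * p\<^sup>2 + 1) / s\<^sup>2) * (1 / (x\<^sup>2 + 1\<^sup>2))"
proof -
  have s: "s\<^sup>2 > 0" using assms by simp
  have "x\<^sup>2 \<le> 2 * (x - p)\<^sup>2 + 2 * p\<^sup>2"
    using zero_le_power2[of "x - 2 * p"] by (simp add: power2_eq_square algebra_simps)
  then have "x\<^sup>2 + 1 \<le> 2 * (x - p)\<^sup>2 + (2 * p\<^sup>2 + 1)" by simp
  also have "\<dots> \<le> 2 * (x - p)\<^sup>2 + 2 * s\<^sup>2 + (2 * p\<^sup>2 + 1) / s\<^sup>2 * (x-p)\<^sup>2 + (2 * p\<^sup>2 + 1)"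
    using s by (simp add: zero_le_mult_iff zero_le_divide_iff)
  also have "\<dots> = (2 + (2 * p\<^sup>2 + 1) / s\<^sup>2) * ((x - p)\<^sup>2 + s\<^sup>2)"
    using assms by (simp add: field_simps)
  finally have *: "x\<^sup>2 + 1 \<le> (2 + (2 * p\<^sup>2 + 1) / s\<^sup>2) * ((x - p)\<^sup>2 + s\<^sup>2)" .
  have "(x - p)\<^sup>2 + s\<^sup>2 > 0" "x\<^sup>2 + 1 > 0" using s by (simp_all add: add_nonneg_pos)
  then show ?thesis using * by (simp add: field_simps)
qed

lemma norm_complex_of_real_minus_sq:
  "(cmod (complex_of_real x - a))\<^sup>2 = (x - Re a)\<^sup>2 + (Im a)\<^sup>2"
  by (simp add: cmod_power2)

text \<open>What Lebesgue measure and the counting measure on the integers have in common before any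
  integral is evaluated; all later integrability claims rest on the unit Lorentzian.\<close>

locale lorentz_measure =
  fixes nu :: "'a measure" and emb :: "'a \<Rightarrow> real"
  assumes sigma_finite_nu: "sigma_finite_measure nu"
    and emb_measurable [measurable]: "emb \<in> borel_measurable nu"
    and integrable_lorentz_1: "integrable nu (\<lambda>y. 1 / ((emb y)\<^sup>2 + 1\<^sup>2))"
begin

lemma integrable_lorentz:
  assumes "s \<noteq> 0"
  shows "integrable nu (\<lambda>y. 1 / ((emb y - p)\<^sup>2 + s\<^sup>2))"
proof (rule Bochner_Integration.integrable_bound)
  show "integrable nu (\<lambda>y. (2 + (2 * p\<^sup>2 + 1) / s\<^sup>2) * (1 / ((emb y)\<^sup>2 + 1\<^sup>2)))"
    by (intro integrable_mult_right integrable_lorentz_1)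
  show "AE y in nu. norm (1 / ((emb y - p)\<^sup>2 + s\<^sup>2)) \<le> norm ((2 + (2 * p\<^sup>2 + 1) / s\<^sup>2) * (1 / ((emb y)\<^sup>2 + 1\<^sup>2)))"
  proof (rule AE_I2)
    fix y
    have "norm (1 / ((emb y - p)\<^sup>2 + s\<^sup>2)) = 1 / ((emb y - p)\<^sup>2 + s\<^sup>2)" by simp
    also note lorentz_shift_bound[OF assms]
    finally show "norm (1 / ((emb y - p)\<^sup>2 + s\<^sup>2)) \<le> norm ((2 + (2 * p\<^sup>2 + 1) / s\<^sup>2) * (1 / ((emb y)\<^sup>2 + 1\<^sup>2)))"
      by (rule order_trans) simp
  qed
qed simp

text \<open>The product of the moduli is at most the sum of their squares, and the squared modulus
  of a pole is a Lorentzian centred at its real part with width its imaginary part.\<close>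

lemma integrable_two_poles:
  assumes "Im a \<noteq> 0" "Im b \<noteq> 0"
  shows "integrable nu (\<lambda>y. 1 / ((of_real (emb y) - a) * (of_real (emb y) - b)))"
proof (rule Bochner_Integration.integrable_bound)
  show "integrable nu (\<lambda>y. 1 / ((emb y - Re a)\<^sup>2 + (Im a)\<^sup>2) + 1 / ((emb y - Re b)\<^sup>2 + (Im b)\<^sup>2))"
    by (intro Bochner_Integration.integrable_add integrable_lorentz assms)
  show "AE y in nu. norm (1 / ((complex_of_real (emb y) - a) * (of_real (emb y) - b)))
      \<le> norm (1 / ((emb y - Re a)\<^sup>2 + (Im a)\<^sup>2) + 1 / ((emb y - Re b)\<^sup>2 + (Im b)\<^sup>2))"
  proof (rule AE_I2)
    fix y
    define u v where "u = 1 / cmod (of_real (emb y) - a)" and "v = 1 / cmod (of_real (emb y) - b)"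
    have "0 \<le> u * v" by (simp add: u_def v_def)
    then have "u * v \<le> u\<^sup>2 + v\<^sup>2"
      using sum_squares_bound[of u v] by linarith
    moreover have "norm (1 / ((complex_of_real (emb y) - a) * (of_real (emb y) - b))) = u * v"
      by (simp add: u_def v_def norm_mult norm_divide)
    moreover have "u\<^sup>2 + v\<^sup>2 = 1 / ((emb y - Re a)\<^sup>2 + (Im a)\<^sup>2) + 1 / ((emb y - Re b)\<^sup>2 + (Im b)\<^sup>2)"
      by (simp add: u_def v_def power_divide norm_complex_of_real_minus_sq)
    ultimately show "norm (1 / ((complex_of_real (emb y) - a) * (of_real (emb y) - b)))
      \<le> norm (1 / ((emb y - Re a)\<^sup>2 + (Im a)\<^sup>2) + 1 / ((emb y - Re b)\<^sup>2 + (Im b)\<^sup>2))"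
      by simp
  qed
qed simp

lemma of_real_neq_nonreal: "Im a \<noteq> 0 \<Longrightarrow> complex_of_real x - a \<noteq> 0"
  by (auto simp: complex_eq_iff)

text \<open>A single pole decays too slowly to be integrable; the difference of two is a multiple of
  their product.\<close>

lemma integrable_pole_pair:
  assumes "Im a \<noteq> 0" "Im b \<noteq> 0"
  shows "integrable nu (\<lambda>y. 1 / (of_real (emb y) - a) - 1 / (of_real (emb y) - b))"
proof -
  have "(\<lambda>y. 1 / (of_real (emb y) - a) - 1 / (of_real (emb y) - b))
    = (\<lambda>y. (a - b) * (1 / ((of_real (emb y) - a) * (of_real (emb y) - b))))"
    using of_real_neq_nonreal[OF assms(1)] of_real_neq_nonreal[OF assms(2)]
    by (auto simp: fun_eq_iff divide_simps)
  then show ?thesis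
    using integrable_mult_right[OF integrable_two_poles[OF assms], of "a - b"] by (simp only:)
qed

end

text \<open>
  \<open>D\<close> contains the periods of the kernel: all reals for the integral, the integers for the sum.
  The addition theorem is assumed for index sets of naturals only, as a locale assumption cannot be
  polymorphic in the index type.
\<close>

locale summation_kernel = lorentz_measure nu emb
  for nu :: "'a measure" and emb :: "'a \<Rightarrow> real" +
  fixes kap :: "complex \<Rightarrow> complex" and D :: "real set"
  assumes emb_in: "emb y \<in> D"
    and of_int_in: "of_int n \<in> D"
    and add_in: "r \<in> D \<Longrightarrow> r' \<in> D \<Longrightarrow> r + r' \<in> D"
    and minus_in: "r \<in> D \<Longrightarrow> - r \<in> D"
    and integral_pole_pair: "Im a \<noteq> 0 \<Longrightarrow> Im b \<noteq> 0 \<Longrightarrow>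
      (LINT y|nu. 1 / (of_real (emb y) - a) - 1 / (of_real (emb y) - b)) = of_real pi * \<i> * (kap a - kap b)"
    and kap_shift: "r \<in> D \<Longrightarrow> kap (a + of_real r) = kap a"
    and kap_minus: "kap (- a) = - kap a"
    and kap_sum_nat: "finite (C :: nat set) \<Longrightarrow> C \<noteq> {} \<Longrightarrow> (\<And>l. l \<in> C \<Longrightarrow> Im (w l) \<noteq> 0) \<Longrightarrow> Im (\<Sum>l\<in>C. w l) \<noteq> 0 \<Longrightarrow>
      (kap (\<Sum>l\<in>C. w l) + 1) * ((\<Prod>l\<in>C. kap (w l) + 1) - (\<Prod>l\<in>C. kap (w l) - 1)) = 2 * (\<Prod>l\<in>C. kap (w l) + 1)"
begin

lemma kap_sum:
  assumes C: "finite C" "C \<noteq> {}" and w: "\<And>l. l \<in> C \<Longrightarrow> Im (w l) \<noteq> 0" and S: "Im (\<Sum>l\<in>C. w l) \<noteq> 0"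
  shows "(kap (\<Sum>l\<in>C. w l) + 1) * ((\<Prod>l\<in>C. kap (w l) + 1) - (\<Prod>l\<in>C. kap (w l) - 1)) = 2 * (\<Prod>l\<in>C. kap (w l) + 1)"
proof -
  obtain h where h: "bij_betw h {0..<card C} C" using ex_bij_betw_nat_finite[OF C(1)] by blast
  have "{0..<card C} \<noteq> {}" using C by (simp add: card_gt_0_iff)
  moreover have "Im (w (h l)) \<noteq> 0" if "l \<in> {0..<card C}" for l
    using w[of "h l"] bij_betwE[OF h] that by auto
  moreover have "Im (\<Sum>l\<in>{0..<card C}. w (h l)) \<noteq> 0"
    using S sum.reindex_bij_betw[OF h, of w] by simp
  ultimately show ?thesis
    using kap_sum_nat[of "{0..<card C}" "\<lambda>l. w (h l)"] sum.reindex_bij_betw[OF h, of w]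
      prod.reindex_bij_betw[OF h, of "\<lambda>l. kap (w l) + 1"] prod.reindex_bij_betw[OF h, of "\<lambda>l. kap (w l) - 1"]
    by simp
qed

text \<open>As the residues add up to zero, every pole may be paired with one fixed pole
  \<open>b\<close>, which turns the product into a combination of integrable pairs.\<close>

lemma
  fixes a :: "'k \<Rightarrow> complex"
  assumes K: "finite K" "card K \<ge> 2" and inj: "inj_on a K" and Im: "\<And>k. k \<in> K \<Longrightarrow> Im (a k) \<noteq> 0"
  shows integrable_simple_poles: "integrable nu (\<lambda>y. \<Prod>k\<in>K. 1 / (of_real (emb y) - a k))"
    and integral_simple_poles: "(LINT y|nu. (\<Prod>k\<in>K. 1 / (of_real (emb y) - a k)))
      = (\<Sum>k\<in>K. of_real pi * \<i> * (kap (a k) + 1) * (\<Prod>j\<in>K-{k}. 1 / (a k - a j)))"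
proof -
  define r where "r k = (\<Prod>j\<in>K-{k}. 1 / (a k - a j))" for k
  have r0: "(\<Sum>k\<in>K. r k) = 0" unfolding r_def by (rule sum_residues_zero[OF K inj])
  have ne: "K \<noteq> {}" using K by auto
  then obtain b where b: "b \<in> K" by auto
  have eq: "(\<Prod>k\<in>K. 1 / (of_real (emb y) - a k))
     = (\<Sum>k\<in>K. r k * (1 / (of_real (emb y) - a k) - 1 / (of_real (emb y) - a b)))" for y
  proof -
    have "(\<Prod>k\<in>K. 1 / (of_real (emb y) - a k)) = (\<Sum>k\<in>K. r k / (of_real (emb y) - a k))"
      unfolding r_def using of_real_neq_nonreal[OF Im]
      by (intro prod_inverse_partial_fractions[OF K(1) ne inj]) auto
    moreover have "(\<Sum>k\<in>K. r k / (of_real (emb y) - a b)) = 0"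
      using r0 by (simp add: sum_divide_distrib[symmetric])
    ultimately show ?thesis by (simp add: right_diff_distrib sum_subtractf)
  qed
  have int: "integrable nu (\<lambda>y. r k * (1 / (of_real (emb y) - a k) - 1 / (of_real (emb y) - a b)))"
    if "k \<in> K" for k
    using that b Im by (intro integrable_mult_right integrable_pole_pair) auto
  show "integrable nu (\<lambda>y. \<Prod>k\<in>K. 1 / (of_real (emb y) - a k))"
    unfolding eq by (intro Bochner_Integration.integrable_sum int)
  have "(LINT y|nu. (\<Prod>k\<in>K. 1 / (of_real (emb y) - a k)))
    = (\<Sum>k\<in>K. r k * (of_real pi * \<i> * (kap (a k) - kap (a b))))"
    unfolding eq using b Im int
    by (subst Bochner_Integration.integral_sum) (auto intro!: sum.cong simp: integral_pole_pair)
  \<comment> \<open>The constant multiplying the sum of the residues is free: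
    \<open>- kap (a b)\<close> is exchanged for 1.\<close>
  also have "\<dots> = (\<Sum>k\<in>K. of_real pi * \<i> * (kap (a k) + 1) * r k - of_real pi * \<i> * (kap (a b) + 1) * r k)"
    by (intro sum.cong) (auto simp: algebra_simps)
  also have "\<dots> = (\<Sum>k\<in>K. of_real pi * \<i> * (kap (a k) + 1) * r k)"
    using r0 by (simp add: sum_subtractf sum_distrib_left[symmetric])
  finally show "(LINT y|nu. (\<Prod>k\<in>K. 1 / (of_real (emb y) - a k)))
      = (\<Sum>k\<in>K. of_real pi * \<i> * (kap (a k) + 1) * (\<Prod>j\<in>K-{k}. 1 / (a k - a j)))"
    by (simp add: r_def)
qed

text \<open>Each quadratic has slope \<open>eps k\<close> of modulus one in the integration
  variable, so it is monic with the two roots \<open>pole k t\<close>; the claim is the residue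
  formula with the remaining quadratics reassembled.\<close>

lemma
  fixes A :: "'k \<Rightarrow> complex" and eps :: "'k \<Rightarrow> complex" and q :: "'k \<Rightarrow> real"
  defines "pole \<equiv> (\<lambda>k t. eps k * (\<i> * t * of_real (q k) - A k))"
  assumes J: "finite J" "J \<noteq> {}" and eps: "\<And>k. k \<in> J \<Longrightarrow> eps k \<in> {-1, 1}"
    and inj: "inj_on (\<lambda>(k, t). pole k t) (J \<times> {-1, 1})"
    and Im: "\<And>k t. k \<in> J \<Longrightarrow> t \<in> {-1, 1} \<Longrightarrow> Im (pole k t) \<noteq> 0"
  shows integrable_quadratics: "integrable nu (\<lambda>y. \<Prod>k\<in>J. 1 / ((A k + eps k * of_real (emb y))\<^sup>2 + (of_real (q k))\<^sup>2))"
    and integral_quadratics: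
      "(LINT y|nu. (\<Prod>k\<in>J. 1 / ((A k + eps k * of_real (emb y))\<^sup>2 + (of_real (q k))\<^sup>2)))
        = (\<Sum>k\<in>J. \<Sum>t\<in>{-1, 1}. of_real pi * \<i> * (kap (pole k t) + 1) * (eps k / (2 * \<i> * t * of_real (q k))) *
             (\<Prod>j\<in>J-{k}. 1 / ((A j + eps j * pole k t)\<^sup>2 + (of_real (q j))\<^sup>2)))"
proof -
  define K where "K = J \<times> {-1, 1 :: complex}"
  have pole: "pole k t = eps k * (\<i> * t * of_real (q k) - A k)" for k t by (simp add: pole_def)
  have finK: "finite K" using J by (simp add: K_def)
  have "card K = card J * 2" by (simp add: K_def card_cartesian_product)
  moreover have "card J \<ge> 1" using J by (simp add: Suc_le_eq card_gt_0_iff)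
  ultimately have cardK: "card K \<ge> 2" by simp
  have fac: "1 / ((A k + eps k * x)\<^sup>2 + (of_real (q k))\<^sup>2) = (\<Prod>t\<in>{-1, 1}. 1 / (x - pole k t))"
    if "k \<in> J" for k x
  proof -
    have "(A k + eps k * x)\<^sup>2 + (of_real (q k))\<^sup>2 = (x - pole k (-1)) * (x - pole k 1)"
      using eps[OF that] by (auto simp: pole_def power2_eq_square algebra_simps)
    then show ?thesis by simp
  qed
  have cart: "(\<Prod>k\<in>L. 1 / ((A k + eps k * x)\<^sup>2 + (of_real (q k))\<^sup>2)) = (\<Prod>p\<in>L \<times> {-1, 1}. 1 / (x - case_prod pole p))"
    if "L \<subseteq> J" for L x
  proof -
    have "(\<Prod>k\<in>L. 1 / ((A k + eps k * x)\<^sup>2 + (of_real (q k))\<^sup>2)) = (\<Prod>k\<in>L. \<Prod>t\<in>{-1, 1}. 1 / (x - pole k t))"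
      using that by (intro prod.cong refl fac) auto
    then show ?thesis by (simp only: prod.cartesian_product case_prod_unfold)
  qed
  have eq: "(\<Prod>k\<in>J. 1 / ((A k + eps k * x)\<^sup>2 + (of_real (q k))\<^sup>2)) = (\<Prod>p\<in>K. 1 / (x - case_prod pole p))" for x
    unfolding K_def by (rule cart) simp
  have Im': "\<And>p. p \<in> K \<Longrightarrow> Im (case_prod pole p) \<noteq> 0" using Im by (auto simp: K_def)
  have inj': "inj_on (case_prod pole) K" using inj by (simp add: K_def)
  have pol: "integrable nu (\<lambda>y. \<Prod>p\<in>K. 1 / (of_real (emb y) - case_prod pole p))"
    by (rule integrable_simple_poles[OF finK cardK inj' Im'])
  have pol2: "(LINT y|nu. (\<Prod>p\<in>K. 1 / (of_real (emb y) - case_prod pole p)))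
    = (\<Sum>p\<in>K. of_real pi * \<i> * (kap (case_prod pole p) + 1) * (\<Prod>j\<in>K-{p}. 1 / (case_prod pole p - case_prod pole j)))"
    by (rule integral_simple_poles[OF finK cardK inj' Im'])
  show "integrable nu (\<lambda>y. \<Prod>k\<in>J. 1 / ((A k + eps k * of_real (emb y))\<^sup>2 + (of_real (q k))\<^sup>2))"
    unfolding eq by (rule pol)
  \<comment> \<open>Removing the root \<open>(k, t)\<close> leaves its twin \<open>(k, -t)\<close>.
    Their distance gives the factor in front, where \<open>eps k\<close> is its own inverse; the
    other roots pair up into quadratics again.\<close>
  have res: "(\<Prod>p\<in>K-{(k, t)}. 1 / (pole k t - case_prod pole p)) =
     eps k / (2 * \<i> * t * of_real (q k)) * (\<Prod>j\<in>J-{k}. 1 / ((A j + eps j * pole k t)\<^sup>2 + (of_real (q j))\<^sup>2))"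
    if k: "k \<in> J" and t: "t \<in> {-1, 1}" for k t
  proof -
    have K': "K - {(k, t)} = insert (k, -t) ((J - {k}) \<times> {-1, 1})"
      using k t by (auto simp: K_def)
    have "(\<Prod>p\<in>K-{(k, t)}. 1 / (pole k t - case_prod pole p))
      = 1 / (pole k t - pole k (-t)) * (\<Prod>p\<in>(J - {k}) \<times> {-1, 1}. 1 / (pole k t - case_prod pole p))"
      unfolding K' using J by (subst prod.insert) auto
    also have "(\<Prod>p\<in>(J - {k}) \<times> {-1, 1}. 1 / (pole k t - case_prod pole p))
      = (\<Prod>j\<in>J-{k}. 1 / ((A j + eps j * pole k t)\<^sup>2 + (of_real (q j))\<^sup>2))"
      by (rule cart[symmetric]) auto
    also have "pole k t - pole k (-t) = eps k * (2 * \<i> * t * of_real (q k))"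
      by (simp add: pole_def algebra_simps)
    also have "1 / (eps k * (2 * \<i> * t * of_real (q k))) = eps k / (2 * \<i> * t * of_real (q k))"
      using eps[OF k] by auto
    finally show ?thesis .
  qed
  show "(LINT y|nu. (\<Prod>k\<in>J. 1 / ((A k + eps k * of_real (emb y))\<^sup>2 + (of_real (q k))\<^sup>2)))
        = (\<Sum>k\<in>J. \<Sum>t\<in>{-1, 1}. of_real pi * \<i> * (kap (pole k t) + 1) * (eps k / (2 * \<i> * t * of_real (q k))) *
             (\<Prod>j\<in>J-{k}. 1 / ((A j + eps j * pole k t)\<^sup>2 + (of_real (q j))\<^sup>2)))"
  proof -
    have "(\<Sum>p\<in>K. of_real pi * \<i> * (kap (case_prod pole p) + 1) * (\<Prod>j\<in>K-{p}. 1 / (case_prod pole p - case_prod pole j)))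
      = (\<Sum>p\<in>K. of_real pi * \<i> * (kap (pole (fst p) (snd p)) + 1) * (eps (fst p) / (2 * \<i> * snd p * of_real (q (fst p)))) *
             (\<Prod>j\<in>J-{fst p}. 1 / ((A j + eps j * pole (fst p) (snd p))\<^sup>2 + (of_real (q j))\<^sup>2)))"
    proof (rule sum.cong[OF refl])
      fix p assume "p \<in> K"
      then obtain k t where p: "p = (k, t)" "k \<in> J" "t \<in> {-1, 1}" by (auto simp: K_def)
      show "of_real pi * \<i> * (kap (case_prod pole p) + 1) * (\<Prod>j\<in>K-{p}. 1 / (case_prod pole p - case_prod pole j))
        = of_real pi * \<i> * (kap (pole (fst p) (snd p)) + 1) * (eps (fst p) / (2 * \<i> * snd p * of_real (q (fst p)))) *
             (\<Prod>j\<in>J-{fst p}. 1 / ((A j + eps j * pole (fst p) (snd p))\<^sup>2 + (of_real (q j))\<^sup>2))"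
        using res[OF p(2,3)] by (simp add: p(1))
    qed
    then have "(LINT y|nu. (\<Prod>p\<in>K. 1 / (of_real (emb y) - case_prod pole p))) = \<dots>"
      by (rule trans[OF pol2])
    then show ?thesis
      unfolding eq by (simp only: K_def sum.cartesian_product case_prod_unfold)
  qed
qed

end

subsection \<open>Integration over the reals\<close>

lemma lorentz_measure_lborel: "lorentz_measure lborel (\<lambda>x. x)"
proof (rule lorentz_measure.intro)
  have "integrable lborel (\<lambda>x::real. inverse (1 + x\<^sup>2))"
    using integrable_inverse_1_plus_square by (simp add: set_integrable_def)
  then show "integrable lborel (\<lambda>x::real. 1 / (x\<^sup>2 + 1\<^sup>2))"
    by (simp add: inverse_eq_divide add.commute)
qed (auto simp: lborel.sigma_finite_measure_axioms)

text \<open>An antiderivative of \<open>1 / (x - a)\<close> that avoids the branch cut of the complex logarithm.\<close>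

definition log_arctan :: "complex \<Rightarrow> real \<Rightarrow> complex" where
  "log_arctan a x = of_real (ln ((x - Re a)\<^sup>2 + (Im a)\<^sup>2) / 2) + \<i> * of_real (arctan ((x - Re a) / Im a))"

lemma log_arctan_derivative:
  assumes "Im a \<noteq> 0"
  shows "(log_arctan a has_vector_derivative 1 / (of_real x - a)) (at x)"
proof -
  define s where "s = (x - Re a)\<^sup>2 + (Im a)\<^sup>2"
  have s: "s > 0" using assms by (simp add: s_def add_nonneg_pos)
  have 1: "((\<lambda>x. ln ((x - Re a)\<^sup>2 + (Im a)\<^sup>2) / 2) has_real_derivative ((x - Re a) / s)) (at x)"
  proof -
    have "((\<lambda>x. (x - Re a)\<^sup>2 + (Im a)\<^sup>2) has_real_derivative 2 * (x - Re a)) (at x)"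
      by (auto intro!: derivative_eq_intros)
    from DERIV_cdivide[OF DERIV_chain'[OF this DERIV_ln_divide[OF s[unfolded s_def]]], of 2]
    moreover have "1 / ((x - Re a)\<^sup>2 + (Im a)\<^sup>2) * (2 * (x - Re a)) / 2 = (x - Re a) / s"
    proof -
      have "1 / r * (2 * u) / 2 = u / r" for r u :: real by simp
      then show ?thesis unfolding s_def .
    qed
    ultimately show ?thesis by (simp only:)
  qed
  have "1 + ((x - Re a) / Im a)\<^sup>2 = s / (Im a)\<^sup>2"
    using assms by (simp add: s_def field_simps)
  then have 2: "((\<lambda>x. arctan ((x - Re a) / Im a)) has_real_derivative (Im a / s)) (at x)"
    using s assms by (auto intro!: derivative_eq_intros simp: field_simps power2_eq_square)
  have "1 / (of_real x - a) = of_real ((x - Re a) / s) + \<i> * of_real (Im a / s)"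
  proof -
    have "(of_real ((x - Re a) / s) + \<i> * of_real (Im a / s)) * (of_real x - a) = 1"
    proof (rule complex_eqI)
      have "Re ((of_real ((x - Re a) / s) + \<i> * of_real (Im a / s)) * (of_real x - a)) = ((x - Re a)\<^sup>2 + (Im a)\<^sup>2) / s"
        by (simp add: power2_eq_square add_divide_distrib)
      also have "\<dots> = 1" using s by (simp only: s_def[symmetric]) simp
      finally show "Re ((of_real ((x - Re a) / s) + \<i> * of_real (Im a / s)) * (of_real x - a)) = Re 1"
        by simp
    qed simp
    then show ?thesis using lorentz_measure.of_real_neq_nonreal[OF lorentz_measure_lborel assms, of x]
      by (simp add: divide_eq_eq mult.commute)
  qed
  moreover have "((\<lambda>x. of_real (ln ((x - Re a)\<^sup>2 + (Im a)\<^sup>2) / 2) + \<i> * of_real (arctan ((x - Re a) / Im a)))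
      has_vector_derivative (of_real ((x - Re a) / s) + \<i> * of_real (Im a / s))) (at x)"
    using 1 2 by (intro has_vector_derivative_add has_vector_derivative_mult_right has_vector_derivative_of_real)
      (simp_all add: has_real_derivative_iff_has_vector_derivative)
  ultimately show ?thesis by (simp add: log_arctan_def[abs_def])
qed

lemma arctan_line_tendsto:
  assumes "s \<noteq> 0"
  shows "((\<lambda>x. arctan ((x - p) / s)) \<longlongrightarrow> sgn s * (pi / 2)) at_top"
    and "((\<lambda>x. arctan ((x - p) / s)) \<longlongrightarrow> - sgn s * (pi / 2)) at_bot"
proof -
  consider "s > 0" | "s < 0" using assms by linarith
  then have "((\<lambda>x. arctan ((x - p) / s)) \<longlongrightarrow> sgn s * (pi / 2)) at_top \<and>
     ((\<lambda>x. arctan ((x - p) / s)) \<longlongrightarrow> - sgn s * (pi / 2)) at_bot"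
  proof cases
    case 1
    have "filterlim (\<lambda>x. (x - p) / s) at_top at_top" "filterlim (\<lambda>x. (x - p) / s) at_bot at_bot"
      using 1 by real_asymp+
    then show ?thesis
      using 1 filterlim_compose[OF tendsto_arctan_at_top, of "\<lambda>x. (x - p) / s"] filterlim_compose[OF tendsto_arctan_at_bot, of "\<lambda>x. (x - p) / s"]
      by (simp add: sgn_if)
  next
    case 2
    have "filterlim (\<lambda>x. (x - p) / s) at_bot at_top" "filterlim (\<lambda>x. (x - p) / s) at_top at_bot"
      using 2 by real_asymp+
    then show ?thesis
      using 2 filterlim_compose[OF tendsto_arctan_at_top, of "\<lambda>x. (x - p) / s"] filterlim_compose[OF tendsto_arctan_at_bot, of "\<lambda>x. (x - p) / s"]
      by (simp add: sgn_if)
  qed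
  then show "((\<lambda>x. arctan ((x - p) / s)) \<longlongrightarrow> sgn s * (pi / 2)) at_top"
    "((\<lambda>x. arctan ((x - p) / s)) \<longlongrightarrow> - sgn s * (pi / 2)) at_bot" by auto
qed

text \<open>The logarithms in the antiderivative cancel at both ends, so only the jump of each
  arctangent remains: pi times the sign of the imaginary part.\<close>

lemma integral_pole_pair_lborel:
  assumes a: "Im a \<noteq> 0" and b: "Im b \<noteq> 0"
  shows "(LINT x|lborel. 1 / (of_real x - a) - 1 / (of_real x - b))
    = of_real pi * \<i> * (of_real (sgn (Im a)) - of_real (sgn (Im b)))"
proof -
  interpret lorentz_measure lborel "\<lambda>x. x" by (rule lorentz_measure_lborel)
  define F where "F x = log_arctan a x - log_arctan b x" for x
  have ln_lim: "((\<lambda>x::real. ln ((x - p)\<^sup>2 + s\<^sup>2) / 2 - ln ((x - p')\<^sup>2 + s'\<^sup>2) / 2) \<longlongrightarrow> 0) at_top"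
    "((\<lambda>x::real. ln ((x - p)\<^sup>2 + s\<^sup>2) / 2 - ln ((x - p')\<^sup>2 + s'\<^sup>2) / 2) \<longlongrightarrow> 0) at_bot" for p s p' s' :: real
    by real_asymp+
  have F: "F = (\<lambda>x. of_real (ln ((x - Re a)\<^sup>2 + (Im a)\<^sup>2) / 2 - ln ((x - Re b)\<^sup>2 + (Im b)\<^sup>2) / 2)
      + \<i> * of_real (arctan ((x - Re a) / Im a) - arctan ((x - Re b) / Im b)))"
    by (auto simp: F_def log_arctan_def fun_eq_iff algebra_simps)
  have top: "(F \<longlongrightarrow> of_real 0 + \<i> * of_real (sgn (Im a) * (pi / 2) - sgn (Im b) * (pi / 2))) at_top"
    unfolding F by (intro tendsto_intros ln_lim arctan_line_tendsto a b)
  have bot: "(F \<longlongrightarrow> of_real 0 + \<i> * of_real (- sgn (Im a) * (pi / 2) - - sgn (Im b) * (pi / 2))) at_bot"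
    unfolding F by (intro tendsto_intros ln_lim arctan_line_tendsto a b)
  have "(LBINT x=-\<infinity>..\<infinity>. 1 / (of_real x - a) - 1 / (of_real x - b))
     = (of_real 0 + \<i> * of_real (sgn (Im a) * (pi / 2) - sgn (Im b) * (pi / 2)))
       - (of_real 0 + \<i> * of_real (- sgn (Im a) * (pi / 2) - - sgn (Im b) * (pi / 2)))"
  proof (rule interval_integral_FTC_integrable)
    show "(F has_vector_derivative 1 / (of_real x - a) - 1 / (of_real x - b)) (at x)" for x
      unfolding F_def by (intro has_vector_derivative_diff log_arctan_derivative a b)
    show "isCont (\<lambda>x. 1 / (complex_of_real x - a) - 1 / (of_real x - b)) x" for x
      using of_real_neq_nonreal[OF a] of_real_neq_nonreal[OF b] by (intro continuous_intros) auto
    show "set_integrable lborel (einterval (- \<infinity>) \<infinity>) (\<lambda>x. 1 / (complex_of_real x - a) - 1 / (of_real x - b))"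
      using integrable_pole_pair[OF a b] by (simp add: set_integrable_def)
    show "((F \<circ> real_of_ereal) \<longlongrightarrow> of_real 0 + \<i> * of_real (- sgn (Im a) * (pi / 2) - - sgn (Im b) * (pi / 2))) (at_right (- \<infinity>))"
      using bot by (simp add: ereal_tendsto_simps)
    show "((F \<circ> real_of_ereal) \<longlongrightarrow> of_real 0 + \<i> * of_real (sgn (Im a) * (pi / 2) - sgn (Im b) * (pi / 2))) (at_left \<infinity>)"
      using top by (simp add: ereal_tendsto_simps)
  qed simp
  then show ?thesis
    by (simp add: interval_lebesgue_integral_def set_lebesgue_integral_def algebra_simps)
qed

text \<open>For the addition theorem: if all \<open>w l\<close> lie in one half-plane, so does their
  sum, and one of the two products vanishes; if both half-planes occur, both products
  vanish.\<close>

lemma summation_kernel_lborel: "summation_kernel lborel (\<lambda>x. x) (\<lambda>a. of_real (sgn (Im a))) UNIV"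
proof -
  interpret lorentz_measure lborel "\<lambda>x. x" by (rule lorentz_measure_lborel)
  show ?thesis
  proof
    fix C :: "nat set" and w :: "nat \<Rightarrow> complex"
    assume C: "finite C" "C \<noteq> {}" and w: "\<And>l. l \<in> C \<Longrightarrow> Im (w l) \<noteq> 0" and S: "Im (\<Sum>l\<in>C. w l) \<noteq> 0"
    let ?k = "\<lambda>a. complex_of_real (sgn (Im a))"
    consider "\<forall>l\<in>C. Im (w l) > 0" | "\<forall>l\<in>C. Im (w l) < 0"
      | l l' where "l \<in> C" "Im (w l) > 0" "l' \<in> C" "Im (w l') < 0"
      using w by (meson linorder_neqE_linordered_idom)
    then show "(?k (\<Sum>l\<in>C. w l) + 1) * ((\<Prod>l\<in>C. ?k (w l) + 1) - (\<Prod>l\<in>C. ?k (w l) - 1)) = 2 * (\<Prod>l\<in>C. ?k (w l) + 1)"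
    proof cases
      case 1
      then have "Im (\<Sum>l\<in>C. w l) > 0" using C by (simp add: sum_pos)
      moreover have "(\<Prod>l\<in>C. ?k (w l) - 1) = 0" using 1 C by (intro prod_zero) auto
      ultimately show ?thesis by simp
    next
      case 2
      then have "(\<Sum>l\<in>C. - Im (w l)) > 0" using C by (intro sum_pos) auto
      then have "Im (\<Sum>l\<in>C. w l) < 0" by (simp add: sum_negf)
      moreover have "(\<Prod>l\<in>C. ?k (w l) + 1) = 0" using 2 C by (intro prod_zero) auto
      ultimately show ?thesis by simp
    next
      case 3
      have "(\<Prod>l\<in>C. ?k (w l) + 1) = 0" using 3 C by (intro prod_zero bexI[of _ l']) auto
      moreover have "(\<Prod>l\<in>C. ?k (w l) - 1) = 0" using 3 C by (intro prod_zero bexI[of _ l]) auto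
      ultimately show ?thesis by simp
    qed
  qed (auto simp: integral_pole_pair_lborel sgn_minus)
qed

subsection \<open>Summation over the integers\<close>

text \<open>This is i cot(pi a), which becomes coth(pi q) at a = i q. In exponential form its
  addition theorem is just the multiplicativity of \<open>exp\<close>.\<close>

definition coth_kernel :: "complex \<Rightarrow> complex" where
  "coth_kernel a = (1 + exp (2 * pi * \<i> * a)) / (1 - exp (2 * pi * \<i> * a))"

lemma exp_2_pi_i_neq_1:
  assumes "Im a \<noteq> 0"
  shows "exp (2 * complex_of_real pi * \<i> * a) \<noteq> 1"
proof
  assume "exp (2 * complex_of_real pi * \<i> * a) = 1"
  then have "norm (exp (2 * complex_of_real pi * \<i> * a)) = 1" by simp
  then show False using assms by (simp add: norm_exp_eq_Re)
qed

lemma coth_kernel_cot: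
  assumes "Im a \<noteq> 0"
  shows "coth_kernel a = \<i> * cot (of_real pi * a)"
proof -
  define u where "u = exp (\<i> * (of_real pi * a))"
  have u: "exp (2 * complex_of_real pi * \<i> * a) = u\<^sup>2"
    by (simp add: u_def exp_double[symmetric] mult_ac)
  have u1: "u\<^sup>2 \<noteq> 1" "u \<noteq> 0" using exp_2_pi_i_neq_1[OF assms] u by (auto simp: u_def)
  then have ne: "u * u - 1 \<noteq> 0" "1 - u * u \<noteq> 0" by (auto simp: power2_eq_square)
  have "exp (- (\<i> * (of_real pi * a))) = 1 / u" by (simp add: u_def exp_minus inverse_eq_divide)
  then have "sin (of_real pi * a) = (u - 1 / u) / (2 * \<i>)" "cos (of_real pi * a) = (u + 1 / u) / 2"
    by (simp_all only: sin_exp_eq cos_exp_eq u_def)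
  then have "cot (of_real pi * a) = ((u + 1 / u) / 2) / ((u - 1 / u) / (2 * \<i>))" by (simp only: cot_def)
  also have "\<dots> = \<i> * (u * u + 1) / (u * u - 1)"
  proof -
    have "u + 1 / u = (u * u + 1) / u" "u - 1 / u = (u * u - 1) / u" using u1 by (simp_all add: field_simps)
    then show ?thesis using u1 ne by (simp add: field_simps)
  qed
  finally have "\<i> * cot (of_real pi * a) = - (u * u + 1) / (u * u - 1)" by (simp add: field_simps)
  also have "\<dots> = (1 + u * u) / (1 - u * u)" using ne by (simp add: field_simps)
  finally show ?thesis by (simp add: coth_kernel_def u power2_eq_square)
qed

text \<open>Logarithmic derivative of the reflection formula for the reciprocal Gamma
  function.\<close>

lemma Digamma_reflection:
  fixes z :: complex
  assumes "z \<notin> \<int>"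
  shows "Digamma (1 - z) - Digamma z = of_real pi * cot (of_real pi * z)"
proof -
  have z: "z \<notin> \<int>\<^sub>\<le>\<^sub>0" "1 - z \<notin> \<int>\<^sub>\<le>\<^sub>0"
  proof -
    show "z \<notin> \<int>\<^sub>\<le>\<^sub>0" using assms by (auto simp: nonpos_Ints_def)
    have "1 - z \<notin> \<int>"
    proof
      assume "1 - z \<in> \<int>"
      then have "1 - (1 - z) \<in> \<int>" by (intro Ints_diff) auto
      then show False using assms by simp
    qed
    then show "1 - z \<notin> \<int>\<^sub>\<le>\<^sub>0" using nonpos_Ints_Int by blast
  qed
  have "((\<lambda>z. rGamma z * rGamma (1 - z)) has_field_derivative
      (- rGamma z * Digamma z) * rGamma (1 - z) + (- rGamma (1 - z) * Digamma (1 - z) * (0 - 1)) * rGamma z) (at z)"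
    by (intro DERIV_mult has_field_derivative_rGamma_no_nonpos_int z
        DERIV_chain'[where g = rGamma] derivative_intros)
  moreover have "((\<lambda>z. rGamma z * rGamma (1 - z)) has_field_derivative
      cos (of_real pi * z)) (at z)"
    unfolding rGamma_reflection_complex
    by (auto intro!: derivative_eq_intros)
  ultimately have "(- rGamma z * Digamma z) * rGamma (1 - z) + (- rGamma (1 - z) * Digamma (1 - z) * (0 - 1)) * rGamma z
      = cos (of_real pi * z)"
    by (rule DERIV_unique)
  then have "rGamma z * rGamma (1 - z) * (Digamma (1 - z) - Digamma z) = cos (of_real pi * z)"
    by (simp add: algebra_simps)
  moreover have "rGamma z \<noteq> 0" "rGamma (1 - z) \<noteq> 0"
    using z by (simp_all add: rGamma_eq_zero_iff)
  ultimately have "(Digamma (1 - z) - Digamma z) = cos (of_real pi * z) / (rGamma z * rGamma (1 - z))"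
    by (simp add: field_simps)
  then show ?thesis by (simp add: rGamma_reflection_complex cot_def)
qed

lemma lorentz_measure_int: "lorentz_measure (count_space (UNIV :: int set)) of_int"
proof (rule lorentz_measure.intro)
  show "integrable (count_space UNIV) (\<lambda>y::int. 1 / ((real_of_int y)\<^sup>2 + 1\<^sup>2))"
  proof -
    have sm: "summable (\<lambda>n::nat. 1 / ((real n)\<^sup>2 + 1))"
    proof (rule summable_comparison_test')
      show "summable (\<lambda>n::nat. 1 / (real n)\<^sup>2)"
        using inverse_power_summable[of 2] by (simp add: inverse_eq_divide)
      show "norm (1 / ((real n)\<^sup>2 + 1)) \<le> 1 / (real n)\<^sup>2" if "n \<ge> 1" for n
        using that by (simp add: frac_le)
    qed
    then have 1: "Infinite_Set_Sum.abs_summable_on (\<lambda>n::nat. 1 / ((real n)\<^sup>2 + 1)) UNIV"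
      by (simp add: abs_summable_on_nat_iff')
    define f where "f = (\<lambda>y::int. 1 / ((real_of_int y)\<^sup>2 + 1))"
    have p: "Infinite_Set_Sum.abs_summable_on f (int ` UNIV)"
      by (rule iffD1[OF abs_summable_on_reindex_iff]) (use 1 in \<open>simp_all add: f_def\<close>)
    have m: "Infinite_Set_Sum.abs_summable_on f ((\<lambda>n. - int n) ` UNIV)"
      by (rule iffD1[OF abs_summable_on_reindex_iff]) (use 1 in \<open>simp_all add: f_def inj_on_def\<close>)
    have "range int \<union> range (\<lambda>n. - int n) = UNIV"
    proof -
      have "x \<in> range int \<union> range (\<lambda>n. - int n)" for x
        by (cases x rule: int_cases2) (rule UnI1, simp, rule UnI2, simp)
      then show ?thesis by auto
    qed
    then have "Infinite_Set_Sum.abs_summable_on f UNIV" using abs_summable_on_union[OF p m] by simp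
    then show ?thesis by (simp add: abs_summable_on_def f_def)
  qed
  show "sigma_finite_measure (count_space (UNIV :: int set))"
    by (rule sigma_finite_measure_count_space_countable) simp
qed simp

text \<open>The sums over the nonnegative and over the negative integers are differences of Digamma
  series; the reflection formula combines them into cotangents.\<close>

lemma integral_pole_pair_int:
  assumes a: "Im a \<noteq> 0" and b: "Im b \<noteq> 0"
  shows "(LINT y|count_space UNIV. 1 / (of_real (real_of_int y) - a) - 1 / (of_real (real_of_int y) - b))
    = of_real pi * \<i> * (coth_kernel a - coth_kernel b)"
proof -
  interpret lorentz_measure "count_space (UNIV :: int set)" real_of_int by (rule lorentz_measure_int)
  define f where "f y = 1 / (of_int y - a) - 1 / (of_int y - b)" for y :: int
  have f: "Infinite_Set_Sum.abs_summable_on f UNIV"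
    using integrable_pole_pair[OF a b] by (simp add: f_def[abs_def] abs_summable_on_def)
  \<comment> \<open>The shift by one keeps the two halves disjoint, so that 0 is counted
    once.\<close>
  have U: "(UNIV :: int set) = range int \<union> range (\<lambda>n. - int n - 1)"
  proof -
    have "x \<in> range int \<union> range (\<lambda>n. - int n - 1)" for x
    proof (cases "x \<ge> 0")
      case True
      then show ?thesis by (auto intro: image_eqI[of _ _ "nat x"])
    next
      case False
      then show ?thesis by (auto intro: image_eqI[of _ _ "nat (- x - 1)"])
    qed
    then show ?thesis by auto
  qed
  have i: "inj int" "inj (\<lambda>n. - int n - 1)" by (auto simp: inj_on_def)
  have fs: "Infinite_Set_Sum.abs_summable_on f A" for A by (rule abs_summable_on_subset[OF f]) auto
  have nonint: "z \<notin> \<int>" if "Im z \<noteq> 0" for z using that by (auto elim!: Ints_cases)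
  have "infsetsum f UNIV = infsetsum f (range int) + infsetsum f (range (\<lambda>n. - int n - 1))"
    by (subst U, rule infsetsum_Un_disjoint[OF fs fs]) auto
  also have "infsetsum f (range int) = (\<Sum>n. f (int n))"
    using fs[of "range int"] i
    by (subst infsetsum_reindex) (auto intro!: infsetsum_nat' simp: abs_summable_on_reindex_iff[symmetric] o_def)
  also have "infsetsum f (range (\<lambda>n. - int n - 1)) = (\<Sum>n. f (- int n - 1))"
    using fs[of "range (\<lambda>n. - int n - 1)"] i
    by (subst infsetsum_reindex) (auto intro!: infsetsum_nat' simp: abs_summable_on_reindex_iff[symmetric] o_def)
  also have "(\<Sum>n. f (int n)) = Digamma (- b) - Digamma (- a)"
  proof -
    have "a \<noteq> 0" "b \<noteq> 0" using a b by auto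
    then have "(\<Sum>n. (inverse (of_nat (Suc n)) - inverse (- b + of_nat n)) - (inverse (of_nat (Suc n)) - inverse (- a + of_nat n)))
      = Digamma (- b) - Digamma (- a)"
      by (subst suminf_diff[symmetric]) (use summable_Digamma[of "- a"] summable_Digamma[of "- b"] in \<open>auto simp: Digamma_def\<close>)
    then show ?thesis by (simp add: f_def inverse_eq_divide)
  qed
  also have "(\<Sum>n. f (- int n - 1)) = Digamma (1 + a) - Digamma (1 + b)"
  proof -
    have ne: "1 + a \<noteq> 0" "1 + b \<noteq> 0" using a b by (auto simp: complex_eq_iff)
    have "(\<Sum>n. (inverse (of_nat (Suc n)) - inverse (1 + a + of_nat n)) - (inverse (of_nat (Suc n)) - inverse (1 + b + of_nat n)))
      = Digamma (1 + a) - Digamma (1 + b)"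
      using ne by (subst suminf_diff[symmetric]) (use summable_Digamma[of "1 + a"] summable_Digamma[of "1 + b"] in \<open>auto simp: Digamma_def\<close>)
    moreover have "f (- int n - 1) = (inverse (of_nat (Suc n)) - inverse (1 + a + of_nat n)) - (inverse (of_nat (Suc n)) - inverse (1 + b + of_nat n))" for n
    proof -
      have *: "of_int (- int n - 1) - z = - (1 + z + of_nat n)" for z :: complex by simp
      show ?thesis unfolding f_def * by (simp only: inverse_eq_divide minus_divide_right[symmetric]) simp
    qed
    ultimately show ?thesis by simp
  qed
  also have "Digamma (- b) - Digamma (- a) + (Digamma (1 + a) - Digamma (1 + b))
    = (Digamma (1 - (- a)) - Digamma (- a)) - (Digamma (1 - (- b)) - Digamma (- b))" by simp
  also have "\<dots> = of_real pi * cot (of_real pi * (- a)) - of_real pi * cot (of_real pi * (- b))"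
    using a b by (subst (1 2) Digamma_reflection) (auto intro!: nonint)
  also have "\<dots> = of_real pi * \<i> * (coth_kernel a - coth_kernel b)"
    using a b by (simp add: coth_kernel_cot algebra_simps cot_minus)
  finally show ?thesis by (simp add: infsetsum_def f_def[abs_def])
qed

text \<open>The quotient of the two expressions is an exponential, hence multiplicative in
  \<open>a\<close>; this is the source of the addition theorem.\<close>

lemma coth_kernel_plus_minus_1:
  assumes "Im a \<noteq> 0"
  shows "coth_kernel a + 1 = 2 / (1 - exp (2 * pi * \<i> * a))"
    and "coth_kernel a - 1 = 2 / (1 - exp (2 * pi * \<i> * a)) * exp (2 * pi * \<i> * a)"
  using exp_2_pi_i_neq_1[OF assms] by (simp_all add: coth_kernel_def field_simps)

lemma summation_kernel_int: "summation_kernel (count_space (UNIV :: int set)) of_int coth_kernel \<int>"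
proof -
  interpret lorentz_measure "count_space (UNIV :: int set)" real_of_int by (rule lorentz_measure_int)
  show ?thesis
  proof
    fix r :: real and a :: complex
    assume "r \<in> \<int>"
    then obtain n where "r = of_int n" by (auto elim: Ints_cases)
    then have "exp (2 * pi * \<i> * (a + of_real r)) = exp (2 * pi * \<i> * a) * exp ((2 * complex_of_int n * complex_of_real pi) * \<i>)"
      by (simp add: exp_add[symmetric] algebra_simps)
    moreover have "exp ((2 * complex_of_int n * complex_of_real pi) * \<i>) = 1"
      using exp_integer_2pi[of "real_of_int n"] by simp
    ultimately show "coth_kernel (a + of_real r) = coth_kernel a" by (simp add: coth_kernel_def)
  next
    fix a :: complex
    define E where "E = exp (2 * pi * \<i> * a)"
    have "E \<noteq> 0" by (simp add: E_def)
    then have "(1 + 1 / E) / (1 - 1 / E) = - ((1 + E) / (1 - E))"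
      by (cases "E = 1") (simp_all add: divide_simps, simp add: algebra_simps)
    moreover have "exp (2 * pi * \<i> * (- a)) = 1 / E" by (simp add: E_def exp_minus inverse_eq_divide)
    ultimately show "coth_kernel (- a) = - coth_kernel a"
      by (simp only: coth_kernel_def E_def[symmetric])
  next
    fix C :: "nat set" and w :: "nat \<Rightarrow> complex"
    assume C: "finite C" "C \<noteq> {}" and w: "\<And>l. l \<in> C \<Longrightarrow> Im (w l) \<noteq> 0" and S: "Im (\<Sum>l\<in>C. w l) \<noteq> 0"
    define E where "E l = exp (2 * pi * \<i> * w l)" for l
    have 1: "(\<Prod>l\<in>C. coth_kernel (w l) + 1) = (\<Prod>l\<in>C. 2 / (1 - E l))"
      by (intro prod.cong refl) (simp add: coth_kernel_plus_minus_1 w E_def)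
    have 2: "(\<Prod>l\<in>C. coth_kernel (w l) - 1) = (\<Prod>l\<in>C. 2 / (1 - E l)) * (\<Prod>l\<in>C. E l)"
      unfolding prod.distrib[symmetric]
      by (intro prod.cong refl) (simp add: coth_kernel_plus_minus_1 w E_def)
    have 3: "(\<Prod>l\<in>C. E l) = exp (2 * pi * \<i> * (\<Sum>l\<in>C. w l))"
      using C by (simp add: E_def exp_sum sum_distrib_left)
    define X P where "X = exp (2 * pi * \<i> * (\<Sum>l\<in>C. w l))" and "P = (\<Prod>l\<in>C. 2 / (1 - E l))"
    have "1 - X \<noteq> 0" using exp_2_pi_i_neq_1[OF S] by (simp add: X_def)
    then have "2 / (1 - X) * (P - P * X) = 2 * P" by (simp add: divide_simps) (simp add: algebra_simps)
    then show "(coth_kernel (\<Sum>l\<in>C. w l) + 1) * ((\<Prod>l\<in>C. coth_kernel (w l) + 1) - (\<Prod>l\<in>C. coth_kernel (w l) - 1))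
       = 2 * (\<Prod>l\<in>C. coth_kernel (w l) + 1)"
      by (simp only: 1 2 3 coth_kernel_plus_minus_1(1)[OF S] X_def P_def)
  qed (auto simp: integral_pole_pair_int[simplified])
qed

lemma coth_kernel_n_b:
  assumes "q \<noteq> 0"
  shows "coth_kernel (\<i> * of_real q) = of_real (1 + 2 * n_b q)"
proof -
  have E: "exp (2 * pi * \<i> * (\<i> * of_real q)) = of_real (exp (- (2 * pi * q)))"
  proof -
    have "2 * pi * \<i> * (\<i> * of_real q) = complex_of_real (- (2 * pi * q))" by (simp add: complex_eq_iff)
    then show ?thesis by (simp only: exp_of_real)
  qed
  have "exp (2 * pi * q) \<noteq> 1" using assms by simp
  then have "(1 + exp (- (2 * pi * q))) / (1 - exp (- (2 * pi * q))) = 1 + 2 * n_b q"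
    by (simp add: n_b_def exp_minus divide_simps)
  then have "complex_of_real ((1 + exp (- (2 * pi * q))) / (1 - exp (- (2 * pi * q)))) = of_real (1 + 2 * n_b q)"
    by (simp only:)
  then show ?thesis unfolding coth_kernel_def E
    by (simp only: of_real_1 of_real_add of_real_diff of_real_divide)
qed

subsection \<open>Spanning trees and their cycles\<close>

context matsubara_graph
begin

definition conn :: "'e set \<Rightarrow> bool" where
  "conn A \<longleftrightarrow> Digraph_Component.connected (with_lines G A)"

lemma verts_nonempty: "verts G \<noteq> {}"
  using connected by (simp add: Digraph_Component.connected_def strongly_connected_def)

lemma head_neq_tail: "i \<in> arcs G \<Longrightarrow> head G i \<noteq> tail G i"
  using no_loops by metis

text \<open>A path out of \<open>S\<close> must cross its border; conversely the set of vertices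
  reachable from \<open>u\<close> has no crossing line. Later arguments work with cuts and not with
  paths.\<close>

lemma conn_iff_cut:
  assumes "A \<subseteq> arcs G"
  shows "conn A \<longleftrightarrow> (\<forall>S. S \<subseteq> verts G \<and> S \<noteq> {} \<and> S \<noteq> verts G \<longrightarrow>
    (\<exists>i\<in>A. (head G i \<in> S) \<noteq> (tail G i \<in> S)))"
proof -
  define R where "R = (arcs_ends (with_lines G A))\<^sup>s"
  interpret H: wf_digraph "with_lines G A"
    using assms by unfold_locales (auto simp: with_lines_def)
  have R: "(u, v) \<in> R \<longleftrightarrow> (\<exists>i\<in>A. (u = tail G i \<and> v = head G i) \<or> (u = head G i \<and> v = tail G i))" for u v
    by (auto simp: R_def symcl_def arcs_ends_def arc_to_ends_def with_lines_def)
  have conn: "conn A \<longleftrightarrow> (\<forall>u\<in>verts G. \<forall>v\<in>verts G. (u, v) \<in> rtrancl_on (verts G) R)"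
    using verts_nonempty by (simp add: conn_def connected_conv R_def with_lines_def)
  show ?thesis
  proof (intro iffI allI impI)
    fix S assume c: "conn A" and S: "S \<subseteq> verts G \<and> S \<noteq> {} \<and> S \<noteq> verts G"
    obtain u v where uv: "u \<in> S" "v \<in> verts G" "v \<notin> S" using S by auto
    have "(u, v) \<in> rtrancl_on (verts G) R" using c uv S by (auto simp: conn)
    then have "v \<in> S \<or> (\<exists>i\<in>A. (head G i \<in> S) \<noteq> (tail G i \<in> S))"
    proof (induction rule: rtrancl_on_induct)
      case (step y z)
      then show ?case by (auto simp: R)
    qed (use uv in auto)
    then show "\<exists>i\<in>A. (head G i \<in> S) \<noteq> (tail G i \<in> S)" using uv by blast
  next
    assume cut: "\<forall>S. S \<subseteq> verts G \<and> S \<noteq> {} \<and> S \<noteq> verts G \<longrightarrow> (\<exists>i\<in>A. (head G i \<in> S) \<noteq> (tail G i \<in> S))"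
    show "conn A" unfolding conn
    proof (intro ballI)
      fix u v assume u: "u \<in> verts G" and v: "v \<in> verts G"
      define S where "S = {w \<in> verts G. (u, w) \<in> rtrancl_on (verts G) R}"
      have "u \<in> S" using u by (auto simp: S_def intro: rtrancl_on.intros)
      have closed: "z \<in> S" if "y \<in> S" "(y, z) \<in> R" "z \<in> verts G" for y z
        using that by (auto simp: S_def intro: rtrancl_on_into_rtrancl_on)
      have "S = verts G"
      proof (rule ccontr)
        assume "S \<noteq> verts G"
        moreover have "S \<subseteq> verts G" by (auto simp: S_def)
        ultimately obtain i where i: "i \<in> A" "(head G i \<in> S) \<noteq> (tail G i \<in> S)" using cut \<open>u \<in> S\<close> by blast
        have "head G i \<in> verts G" "tail G i \<in> verts G" using i assms by auto
        then show False using i closed[of "head G i" "tail G i"] closed[of "tail G i" "head G i"]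
          by (auto simp: R)
      qed
      then show "(u, v) \<in> rtrancl_on (verts G) R" using v by (auto simp: S_def)
    qed
  qed
qed

lemma conn_mono:
  assumes "A \<subseteq> B" "B \<subseteq> arcs G" "conn A"
  shows "conn B"
  unfolding conn_iff_cut[OF assms(2)]
proof (intro allI impI)
  fix S assume "S \<subseteq> verts G \<and> S \<noteq> {} \<and> S \<noteq> verts G"
  moreover have "A \<subseteq> arcs G" using assms by auto
  ultimately have "\<exists>i\<in>A. (head G i \<in> S) \<noteq> (tail G i \<in> S)"
    using assms(3) conn_iff_cut[of A] by blast
  then show "\<exists>i\<in>B. (head G i \<in> S) \<noteq> (tail G i \<in> S)" using assms(1) by blast
qed

lemma conn_arcs: "conn (arcs G)"
  using connected by (simp add: conn_def with_lines_def)

text \<open>The weight that a line receives when the vertex equations are added over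
  \<open>S\<close>: lines inside \<open>S\<close> cancel, so only the lines crossing the cut
  survive, with a sign for their direction.\<close>

definition boundary :: "'v set \<Rightarrow> 'e \<Rightarrow> 'c::ring_1" where
  "boundary S i = (\<Sum>v\<in>S. incidence G v i)"

lemma boundary_eq:
  assumes "S \<subseteq> verts G" "i \<in> arcs G"
  shows "boundary S i = (if head G i \<in> S then 1 else 0) - (if tail G i \<in> S then 1 else (0 :: 'c::ring_1))"
proof -
  have fin: "finite S" by (rule finite_subset[OF assms(1) finite_verts])
  have "incidence G v i = (if head G i = v then 1 else 0) - (if tail G i = v then 1 else (0 :: 'c))" for v
    using head_neq_tail[OF assms(2)] by (auto simp: incidence_def)
  then have "boundary S i = (\<Sum>v\<in>S. (if head G i = v then 1 else 0) - (if tail G i = v then 1 else (0 :: 'c)))"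
    by (simp add: boundary_def)
  then show ?thesis using fin by (simp add: sum_subtractf sum.delta')
qed

lemma of_int_incidence: "of_int (incidence G v i) = incidence G v i"
  by (simp add: incidence_def)

lemma of_int_boundary: "of_int (boundary S i) = boundary S i"
  by (simp add: boundary_def of_int_incidence)

lemma sum_vertex_total: "(\<Sum>v\<in>S. vertex_total G x v) = (\<Sum>i\<in>arcs G. boundary S i * x i)"
  unfolding vertex_total_def boundary_def sum_distrib_right by (rule sum.swap)

lemma vertex_total_add: "vertex_total G (\<lambda>i. x i + y i) v = vertex_total G x v + vertex_total G y v"
  by (simp add: vertex_total_def distrib_left sum.distrib)

lemma vertex_total_sum: "vertex_total G (\<lambda>i. \<Sum>k\<in>K. x k i) v = (\<Sum>k\<in>K. vertex_total G (x k) v)"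
  unfolding vertex_total_def sum_distrib_left by (rule sum.swap)

lemma vertex_total_scale:
  fixes c :: "'c::comm_ring_1"
  shows "vertex_total G (\<lambda>i. c * x i) v = c * vertex_total G x v"
  unfolding vertex_total_def sum_distrib_left by (simp add: mult_ac)

lemma vertex_total_of_int: "vertex_total G (\<lambda>i. of_int (x i)) v = of_int (vertex_total G x v)"
  by (simp add: vertex_total_def of_int_incidence)

lemma vertex_total_cong: "(\<And>i. i \<in> arcs G \<Longrightarrow> x i = y i) \<Longrightarrow> vertex_total G x v = vertex_total G y v"
  by (simp add: vertex_total_def)

lemma vertex_total_single:
  "i \<in> arcs G \<Longrightarrow> vertex_total G (\<lambda>k. if k = i then c else 0) v = incidence G v i * c"
  by (simp add: vertex_total_def if_distrib[of "\<lambda>t. _ * t"] cong: if_cong)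

lemma incidence_eq:
  "i \<in> arcs G \<Longrightarrow> incidence G v i = (if v = head G i then 1 else 0) - (if v = tail G i then 1 else (0 :: 'c::ring_1))"
  using head_neq_tail[of i] by (auto simp: incidence_def)

text \<open>The set of vertices that a unit flow from \<open>u\<close> can reach inside
  \<open>A\<close> is everything, because a line crossing out of it would extend one of the flows by
  one more vertex.\<close>

lemma path_flow:
  assumes A: "A \<subseteq> arcs G" and c: "conn A" and u: "u \<in> verts G" and v: "v \<in> verts G"
  shows "\<exists>x::'e \<Rightarrow> int. (\<forall>i. i \<notin> A \<longrightarrow> x i = 0) \<and>
    (\<forall>w\<in>verts G. vertex_total G x w = (if w = v then 1 else 0) - (if w = u then 1 else 0))"
proof -
  define P where "P v x \<longleftrightarrow> (\<forall>i. i \<notin> A \<longrightarrow> x i = 0) \<and>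
    (\<forall>w\<in>verts G. vertex_total G x w = (if w = v then 1 else 0) - (if w = u then 1 else 0))" for v and x :: "'e \<Rightarrow> int"
  define S where "S = {v \<in> verts G. \<exists>x. P v x}"
  have "P u (\<lambda>_. 0)" by (auto simp: P_def vertex_total_def)
  then have uS: "u \<in> S" using u by (auto simp: S_def)
  have "S = verts G"
  proof (rule ccontr)
    assume "S \<noteq> verts G"
    moreover have "S \<subseteq> verts G" by (auto simp: S_def)
    ultimately obtain i where i: "i \<in> A" "(head G i \<in> S) \<noteq> (tail G i \<in> S)"
      using c uS unfolding conn_iff_cut[OF A] by blast
    have iG: "i \<in> arcs G" "head G i \<in> verts G" "tail G i \<in> verts G" using i A by auto
    define s :: int where "s = (if tail G i \<in> S then 1 else -1)"
    define a b where "a = (if tail G i \<in> S then tail G i else head G i)"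
      and "b = (if tail G i \<in> S then head G i else tail G i)"
    have ab: "a \<in> S" "b \<notin> S" "b \<in> verts G" using i iG by (auto simp: a_def b_def)
    then obtain x where x: "P a x" by (auto simp: S_def)
    have "vertex_total G (\<lambda>k. x k + (if k = i then s else 0)) w = vertex_total G x w + incidence G w i * s" for w
      using iG by (simp add: vertex_total_add vertex_total_single)
    moreover have "incidence G w i * s = (if w = b then 1 else 0) - (if w = a then 1 else 0)" for w
      using iG by (simp add: incidence_eq s_def a_def b_def)
    ultimately have "P b (\<lambda>k. x k + (if k = i then s else 0))"
      using x i by (auto simp: P_def)
    then show False using ab by (auto simp: S_def)
  qed
  then obtain x where "P v x" using v by (auto simp: S_def)
  then show ?thesis unfolding P_def by blast
qed

text \<open>A unit flow from the head of \<open>i\<close> back to its tail; together with the value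
  1 on \<open>i\<close> it becomes a circulation.\<close>

lemma arc_flow:
  assumes A: "A \<subseteq> arcs G" and c: "conn A" and i: "i \<in> arcs G"
  shows "\<exists>x::'e \<Rightarrow> int. (\<forall>k. k \<notin> A \<longrightarrow> x k = 0) \<and>
    (\<forall>w\<in>verts G. vertex_total G x w = - incidence G w i)"
proof -
  have "head G i \<in> verts G" "tail G i \<in> verts G" using i by auto
  from path_flow[OF A c this] show ?thesis by (simp add: incidence_eq[OF i])
qed

text \<open>Superpose unit flows from a fixed root to every vertex \<open>v\<close>, weighted by
  \<open>N v\<close>. The surplus left at the root is minus the sum of all
  \<open>N v\<close>.\<close>

lemma flow_exists:
  fixes N :: "'v \<Rightarrow> int"
  assumes A: "A \<subseteq> arcs G" and c: "conn A" and N: "(\<Sum>v\<in>verts G. N v) = 0"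
  shows "\<exists>x::'e \<Rightarrow> int. (\<forall>i. i \<notin> A \<longrightarrow> x i = 0) \<and> (\<forall>w\<in>verts G. vertex_total G x w = N w)"
proof -
  obtain r where r: "r \<in> verts G" using verts_nonempty by auto
  have "\<exists>x. \<forall>v\<in>verts G. (\<forall>i. i \<notin> A \<longrightarrow> x v i = 0) \<and>
    (\<forall>w\<in>verts G. vertex_total G (x v) w = (if w = v then 1 else 0) - (if w = r then 1 else (0::int)))"
    by (rule bchoice) (use path_flow[OF A c r] in blast)
  then obtain x where x: "\<And>v i. v \<in> verts G \<Longrightarrow> i \<notin> A \<Longrightarrow> x v i = 0"
    "\<And>v w. v \<in> verts G \<Longrightarrow> w \<in> verts G \<Longrightarrow> vertex_total G (x v) w = (if w = v then 1 else 0) - (if w = r then 1 else (0::int))"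
    by metis
  define y where "y i = (\<Sum>v\<in>verts G. N v * x v i)" for i
  have "vertex_total G y w = N w" if w: "w \<in> verts G" for w
  proof -
    have "vertex_total G y w = (\<Sum>v\<in>verts G. N v * vertex_total G (x v) w)"
      unfolding y_def[abs_def] vertex_total_sum vertex_total_scale ..
    also have "\<dots> = (\<Sum>v\<in>verts G. (if w = v then N v else 0) - N v * (if w = r then 1 else 0))"
      using w by (intro sum.cong) (auto simp: x)
    also have "\<dots> = N w - (\<Sum>v\<in>verts G. N v) * (if w = r then 1 else 0)"
      using w by (simp add: sum_subtractf sum_distrib_right[symmetric])
    finally show ?thesis using N by simp
  qed
  moreover have "y i = 0" if "i \<notin> A" for i using that by (simp add: y_def x)
  ultimately show ?thesis by blast
qed

section \<open>Spanning trees, cutsets and their sizes\<close>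

abbreviation tree :: "'e set \<Rightarrow> bool" where
  "tree A \<equiv> spanning_tree_lines G A"

lemma tree_iff: "tree A \<longleftrightarrow> A \<subseteq> arcs G \<and> conn A \<and> (\<forall>i\<in>A. \<not> conn (A - {i}))"
  by (simp only: spanning_tree_lines_def conn_def)

lemma treeD: "tree A \<Longrightarrow> A \<subseteq> arcs G" "tree A \<Longrightarrow> conn A"
  by (auto simp: tree_iff)

lemma tree_subset_eq: "tree A \<Longrightarrow> tree B \<Longrightarrow> A \<subseteq> B \<Longrightarrow> A = B"
proof (rule ccontr)
  assume t: "tree A" "tree B" and s: "A \<subseteq> B" and "A \<noteq> B"
  then obtain j where j: "j \<in> B" "j \<notin> A" by auto
  have "A \<subseteq> B - {j}" using s j by blast
  moreover have "B - {j} \<subseteq> arcs G" using treeD(1)[OF t(2)] by blast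
  ultimately have "conn (B - {j})" using treeD(2)[OF t(1)] by (rule conn_mono)
  then show False using t(2) j(1) unfolding tree_iff by blast
qed

lemma tree_exists:
  assumes "A \<subseteq> arcs G" "conn A"
  shows "\<exists>B\<subseteq>A. tree B"
proof -
  have "finite A" by (rule finite_subset[OF assms(1) finite_arcs])
  then show ?thesis using assms
  proof (induction A rule: finite_psubset_induct)
    case (psubset A)
    show ?case
    proof (cases "\<exists>i\<in>A. conn (A - {i})")
      case True
      then obtain i where i: "i \<in> A" "conn (A - {i})" by blast
      have "A - {i} \<subset> A" "A - {i} \<subseteq> arcs G" using i(1) psubset.prems(1) by blast+
      from psubset.IH[OF this i(2)] obtain B where "B \<subseteq> A - {i}" "tree B" by blast
      then show ?thesis by (intro exI[of _ B] conjI) blast+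
    next
      case False
      then have "tree A" using psubset.prems by (simp add: tree_iff)
      then show ?thesis by (intro exI[of _ A] conjI) simp_all
    qed
  qed
qed

lemma not_cutset_iff:
  assumes "A \<subseteq> arcs G"
  shows "\<not> cutset G A \<longleftrightarrow> (\<exists>B. tree B \<and> A \<subseteq> arcs G - B)"
proof
  assume "\<not> cutset G A"
  then have "conn (arcs G - A)" using assms unfolding cutset_def conn_def by blast
  then obtain B where "B \<subseteq> arcs G - A" "tree B" using tree_exists[of "arcs G - A"] by blast
  then show "\<exists>B. tree B \<and> A \<subseteq> arcs G - B" using assms by blast
next
  assume "\<exists>B. tree B \<and> A \<subseteq> arcs G - B"
  then obtain B where "tree B" "A \<subseteq> arcs G - B" by blast
  then have "B \<subseteq> arcs G - A" "conn B" using treeD by blast+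
  then have "conn (arcs G - A)" using conn_mono by blast
  then show "\<not> cutset G A" unfolding cutset_def conn_def by blast
qed

text \<open>A vertex set grown one vertex at a time gains, with each new vertex, the crossing line
  that leads to it. The bound makes trees large enough for sets that are not cutsets to have at most
  \<open>num_cycles G\<close> lines.\<close>

lemma conn_card:
  assumes A: "A \<subseteq> arcs G" and c: "conn A"
  shows "card (verts G) \<le> card A + 1"
proof -
  have fA: "finite A" by (rule finite_subset[OF A finite_arcs])
  have "\<exists>S\<subseteq>verts G. card S = Suc k \<and> k \<le> card {i\<in>A. head G i \<in> S \<and> tail G i \<in> S}"
    if "Suc k \<le> card (verts G)" for k
    using that
  proof (induction k)
    case 0
    obtain r where "r \<in> verts G" using verts_nonempty by auto
    then show ?case by (intro exI[of _ "{r}"]) auto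
  next
    case (Suc k)
    then obtain S where S: "S \<subseteq> verts G" "card S = Suc k" "k \<le> card {i\<in>A. head G i \<in> S \<and> tail G i \<in> S}"
      by auto
    have "S \<noteq> {}" "S \<noteq> verts G" using S Suc.prems by auto
    then obtain i where i: "i \<in> A" "(head G i \<in> S) \<noteq> (tail G i \<in> S)"
      using c S unfolding conn_iff_cut[OF A] by blast
    define b where "b = (if tail G i \<in> S then head G i else tail G i)"
    have b: "b \<notin> S" "b \<in> verts G" using i A by (auto simp: b_def)
    have fS: "finite S" by (rule finite_subset[OF S(1) finite_verts])
    have "insert i {i\<in>A. head G i \<in> S \<and> tail G i \<in> S} \<subseteq> {i\<in>A. head G i \<in> insert b S \<and> tail G i \<in> insert b S}"
      using i by (auto simp: b_def)
    then have "card (insert i {i\<in>A. head G i \<in> S \<and> tail G i \<in> S}) \<le> card {i\<in>A. head G i \<in> insert b S \<and> tail G i \<in> insert b S}"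
      using fA by (intro card_mono) auto
    moreover have "card (insert i {i\<in>A. head G i \<in> S \<and> tail G i \<in> S}) = Suc (card {i\<in>A. head G i \<in> S \<and> tail G i \<in> S})"
      using i fA by (intro card_insert_disjoint) auto
    ultimately show ?case using S b fS by (intro exI[of _ "insert b S"]) auto
  qed
  moreover have "card (verts G) > 0" using verts_nonempty by (simp add: card_gt_0_iff)
  then have "Suc (card (verts G) - 1) \<le> card (verts G)" by simp
  ultimately obtain S where "card (verts G) - 1 \<le> card {i\<in>A. head G i \<in> S \<and> tail G i \<in> S}"
    by blast
  also have "\<dots> \<le> card A" using fA by (intro card_mono) auto
  finally show ?thesis by simp
qed

section \<open>Fundamental cuts and fundamental cycles of a tree\<close>

definition side :: "'e set \<Rightarrow> 'e \<Rightarrow> 'v set" where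
  "side A j = (SOME S. S \<subseteq> verts G \<and> head G j \<in> S \<and> tail G j \<notin> S \<and>
     (\<forall>i\<in>A - {j}. (head G i \<in> S) = (tail G i \<in> S)))"

text \<open>Minimality of the tree gives a cut that no line of \<open>A - {j}\<close> crosses, and
  connectedness forces \<open>j\<close> to cross it. If the head of \<open>j\<close> is on the wrong
  side, the complement is taken.\<close>

lemma side:
  assumes t: "tree A" and j: "j \<in> A"
  shows "side A j \<subseteq> verts G" "head G j \<in> side A j" "tail G j \<notin> side A j"
    "\<And>i. i \<in> A \<Longrightarrow> i \<noteq> j \<Longrightarrow> (head G i \<in> side A j) = (tail G i \<in> side A j)"
proof -
  have A: "A \<subseteq> arcs G" "A - {j} \<subseteq> arcs G" and c: "conn A" "\<not> conn (A - {j})"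
    using t j by (auto simp: tree_iff)
  obtain S where S: "S \<subseteq> verts G" "S \<noteq> {}" "S \<noteq> verts G" "\<forall>i\<in>A - {j}. (head G i \<in> S) = (tail G i \<in> S)"
    using c(2) unfolding conn_iff_cut[OF A(2)] by blast
  then obtain i where "i \<in> A" "(head G i \<in> S) \<noteq> (tail G i \<in> S)"
    using c(1) unfolding conn_iff_cut[OF A(1)] by blast
  then have cross: "(head G j \<in> S) \<noteq> (tail G j \<in> S)" using S(4) by (cases "i = j") auto
  have G: "\<And>i. i \<in> A \<Longrightarrow> head G i \<in> verts G \<and> tail G i \<in> verts G" using A by auto
  have "\<exists>S. S \<subseteq> verts G \<and> head G j \<in> S \<and> tail G j \<notin> S \<and> (\<forall>i\<in>A - {j}. (head G i \<in> S) = (tail G i \<in> S))"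
  proof (cases "head G j \<in> S")
    case True
    then show ?thesis using S cross by blast
  next
    case False
    then show ?thesis using S cross G j by (intro exI[of _ "verts G - S"]) auto
  qed
  from someI_ex[OF this, folded side_def]
  show "side A j \<subseteq> verts G" "head G j \<in> side A j" "tail G j \<notin> side A j"
    "\<And>i. i \<in> A \<Longrightarrow> i \<noteq> j \<Longrightarrow> (head G i \<in> side A j) = (tail G i \<in> side A j)" by auto
qed

text \<open>Entry of the fundamental cut matrix. The minus sign comes from moving the lines off the
  tree to the other side when the cut equation is solved for \<open>j\<close>.\<close>

definition tree_coeff :: "'e set \<Rightarrow> 'e \<Rightarrow> 'e \<Rightarrow> int" where
  "tree_coeff A j l = - boundary (side A j) l"

lemma tree_coeff_cases:
  assumes "tree A" "j \<in> A" "l \<in> arcs G"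
  shows "tree_coeff A j l \<in> {-1, 0, 1}"
  using side[OF assms(1,2)] assms(3) by (simp add: tree_coeff_def boundary_eq)

text \<open>Add the vertex equations over one side of the fundamental cut of \<open>j\<close>: of
  the tree lines only \<open>j\<close> crosses it, with weight 1.\<close>

lemma solution_imp_tree_formula:
  fixes x :: "'e \<Rightarrow> 'c::comm_ring_1"
  assumes t: "tree A" and j: "j \<in> A" and x: "\<And>v. v \<in> verts G \<Longrightarrow> vertex_total G x v = N v"
  shows "x j = (\<Sum>v\<in>side A j. N v) + (\<Sum>l\<in>arcs G - A. of_int (tree_coeff A j l) * x l)"
proof -
  note s = side[OF t j]
  have A: "A \<subseteq> arcs G" using t by (rule treeD)
  have "(\<Sum>v\<in>side A j. N v) = (\<Sum>v\<in>side A j. vertex_total G x v)"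
    using s(1) x by (intro sum.cong) auto
  also have "\<dots> = (\<Sum>i\<in>arcs G. boundary (side A j) i * x i)" by (rule sum_vertex_total)
  also have "\<dots> = (\<Sum>i\<in>A. boundary (side A j) i * x i) + (\<Sum>i\<in>arcs G - A. boundary (side A j) i * x i)"
    using A by (subst sum.subset_diff[of A]) (auto simp: add.commute)
  also have "(\<Sum>i\<in>A. boundary (side A j) i * x i) = (\<Sum>i\<in>A. if i = j then x i else 0)"
    using s A j by (intro sum.cong refl) (auto simp: boundary_eq subset_iff)
  also have "\<dots> = x j" using j finite_subset[OF A finite_arcs] by simp
  finally show ?thesis
    by (simp add: tree_coeff_def sum_negf of_int_boundary)
qed

definition circulation :: "('e \<Rightarrow> int) \<Rightarrow> bool" where
  "circulation u \<longleftrightarrow> (\<forall>v\<in>verts G. vertex_total G u v = 0)"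

lemma circulation_tree_formula:
  assumes "tree A" "j \<in> A" "circulation u"
  shows "u j = (\<Sum>l\<in>arcs G - A. tree_coeff A j l * u l)"
  using solution_imp_tree_formula[OF assms(1,2), of u "\<lambda>_. 0"] assms(3) by (simp add: circulation_def)

text \<open>For \<open>l\<close> off the tree, this is the signed incidence vector of the
  fundamental cycle that \<open>l\<close> closes, directed along \<open>l\<close>.\<close>

definition tree_cycle :: "'e set \<Rightarrow> 'e \<Rightarrow> 'e \<Rightarrow> int" where
  "tree_cycle A l i = (if i \<in> A then tree_coeff A i l else if i = l then 1 else 0)"

lemma tree_cycle_cases: "tree A \<Longrightarrow> l \<in> arcs G \<Longrightarrow> tree_cycle A l i \<in> {-1, 0, 1}"
  using tree_coeff_cases[of A i l] by (simp add: tree_cycle_def)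

text \<open>A flow in the tree closes \<open>l\<close> to a circulation that vanishes on all other
  lines off \<open>A\<close>. The tree formula then forces its entries on \<open>A\<close> to be the
  tree coefficients.\<close>

lemma circulation_tree_cycle:
  assumes t: "tree A" and l: "l \<in> arcs G - A"
  shows "circulation (tree_cycle A l)"
proof -
  have lG: "l \<in> arcs G" using l by simp
  from arc_flow[OF treeD(1)[OF t] treeD(2)[OF t] lG]
  obtain x :: "'e \<Rightarrow> int" where x': "\<forall>k. k \<notin> A \<longrightarrow> x k = 0"
    "\<forall>w\<in>verts G. vertex_total G x w = - incidence G w l"
    by (elim exE conjE)
  note x = x'[rule_format]
  define u where "u k = x k + (if k = l then 1 else 0)" for k
  have "vertex_total G u v = vertex_total G x v + incidence G v l" for v
    unfolding u_def[abs_def] vertex_total_add using l by (simp add: vertex_total_single)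
  then have u: "circulation u" using x(2) by (simp add: circulation_def)
  have eq: "u i = tree_cycle A l i" if "i \<in> arcs G" for i
  proof (cases "i \<in> A")
    case True
    have "u i = (\<Sum>k\<in>arcs G - A. tree_coeff A i k * u k)" by (rule circulation_tree_formula[OF t True u])
    also have "\<dots> = (\<Sum>k\<in>arcs G - A. if k = l then tree_coeff A i k else 0)"
      by (intro sum.cong) (auto simp: u_def x)
    finally show ?thesis using l True by (simp add: tree_cycle_def)
  qed (simp add: u_def x tree_cycle_def)
  have "vertex_total G u v = vertex_total G (tree_cycle A l) v" for v
    by (rule vertex_total_cong) (rule eq)
  then show ?thesis using u by (simp add: circulation_def)
qed

text \<open>The fundamental cycles span the circulations, with the values off the tree as
  coordinates.\<close>

lemma circulation_expand:
  assumes "tree A" "circulation u" "i \<in> arcs G"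
  shows "u i = (\<Sum>l\<in>arcs G - A. u l * tree_cycle A l i)"
proof (cases "i \<in> A")
  case True
  then show ?thesis using circulation_tree_formula[OF assms(1) True assms(2)]
    by (simp add: tree_cycle_def mult.commute)
next
  case False
  then have "(\<Sum>l\<in>arcs G - A. u l * tree_cycle A l i) = (\<Sum>l\<in>arcs G - A. if l = i then u l else 0)"
    by (intro sum.cong) (auto simp: tree_cycle_def)
  then show ?thesis using False assms(3) by simp
qed

lemma tree_cycle_unique:
  assumes t: "tree A" and u: "circulation u" and l: "l \<in> arcs G - A"
    and eq: "\<And>k. k \<in> arcs G - A \<Longrightarrow> u k = (if k = l then 1 else 0)" and i: "i \<in> arcs G"
  shows "u i = tree_cycle A l i"
proof -
  have "u i = (\<Sum>k\<in>arcs G - A. u k * tree_cycle A k i)" by (rule circulation_expand[OF t u i])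
  also have "\<dots> = (\<Sum>k\<in>arcs G - A. if k = l then tree_cycle A k i else 0)"
    by (intro sum.cong) (auto simp: eq)
  finally show ?thesis using l by simp
qed

definition tree_const :: "('v \<Rightarrow> int) \<Rightarrow> 'e set \<Rightarrow> 'e \<Rightarrow> int" where
  "tree_const N A j = (\<Sum>v\<in>side A j. N v)"

text \<open>For the converse, the labelling is a particular integer solution supported on the tree
  plus the combination of fundamental cycles with coefficients \<open>x l\<close>. Integrality of
  the data makes one statement serve integers, reals and complex numbers.\<close>

lemma solution_iff:
  fixes x :: "'e \<Rightarrow> 'c::comm_ring_1" and N :: "'v \<Rightarrow> int"
  assumes t: "tree A" and N: "(\<Sum>v\<in>verts G. N v) = 0"
  shows "(\<forall>v\<in>verts G. vertex_total G x v = of_int (N v)) \<longleftrightarrow>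
    (\<forall>j\<in>A. x j = of_int (tree_const N A j) + (\<Sum>l\<in>arcs G - A. of_int (tree_coeff A j l) * x l))"
proof (intro iffI)
  assume *: "\<forall>v\<in>verts G. vertex_total G x v = of_int (N v)"
  show "\<forall>j\<in>A. x j = of_int (tree_const N A j) + (\<Sum>l\<in>arcs G - A. of_int (tree_coeff A j l) * x l)"
    using solution_imp_tree_formula[OF t, of _ x "\<lambda>v. of_int (N v)"] * by (simp add: tree_const_def)
next
  assume *: "\<forall>j\<in>A. x j = of_int (tree_const N A j) + (\<Sum>l\<in>arcs G - A. of_int (tree_coeff A j l) * x l)"
  \<comment> \<open>As \<open>y\<close> vanishes off the tree, its values on the tree are exactly
    the constants of the tree formula.\<close>
  obtain y where y: "\<And>i. i \<notin> A \<Longrightarrow> y i = 0" "\<And>w. w \<in> verts G \<Longrightarrow> vertex_total G y w = N w"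
    using flow_exists[OF treeD[OF t] N] by blast
  have yA: "y j = tree_const N A j" if "j \<in> A" for j
    using solution_imp_tree_formula[OF t that, of y N] y by (simp add: tree_const_def)
  have "x i = of_int (y i) + (\<Sum>l\<in>arcs G - A. x l * of_int (tree_cycle A l i))" if i: "i \<in> arcs G" for i
  proof (cases "i \<in> A")
    case True
    then show ?thesis using * by (simp add: yA tree_cycle_def mult.commute)
  next
    case False
    then have "(\<Sum>l\<in>arcs G - A. x l * of_int (tree_cycle A l i)) = (\<Sum>l\<in>arcs G - A. if l = i then x l else 0)"
      by (intro sum.cong) (auto simp: tree_cycle_def)
    then show ?thesis using False i by (simp add: y)
  qed
  then have "vertex_total G x v = vertex_total G (\<lambda>i. of_int (y i) + (\<Sum>l\<in>arcs G - A. x l * of_int (tree_cycle A l i))) v" for v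
    by (rule vertex_total_cong)
  then show "\<forall>v\<in>verts G. vertex_total G x v = of_int (N v)"
    using circulation_tree_cycle[OF t] y
    by (simp add: vertex_total_add vertex_total_sum vertex_total_scale vertex_total_of_int circulation_def)
qed

text \<open>Connectedness: a cut missed by the new set would be crossed by \<open>j\<close>, the
  only line of the cycle of \<open>l\<close> to cross it, although a circulation has no net flow
  through a cut. Minimality: if \<open>k\<close> could be dropped, there would be a circulation
  inside the new set with value 1 on \<open>k\<close>; it is a multiple of the cycle of
  \<open>l\<close>, and it vanishes at \<open>j\<close>, where that cycle does not.\<close>

lemma tree_exchange:
  assumes t: "tree A" and j: "j \<in> A" and l: "l \<in> arcs G - A" and m: "tree_coeff A j l \<noteq> 0"
  shows "tree (insert l (A - {j}))"
proof -
  define A' where "A' = insert l (A - {j})"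
  have A: "A \<subseteq> arcs G" using t by (rule treeD)
  then have A': "A' \<subseteq> arcs G" using l by (auto simp: A'_def)
  note circ = circulation_tree_cycle[OF t l]
  have cyc: "tree_cycle A l j = tree_coeff A j l" using j by (simp add: tree_cycle_def)
  have c: "conn A'" unfolding conn_iff_cut[OF A']
  proof (intro allI impI)
    fix S assume S: "S \<subseteq> verts G \<and> S \<noteq> {} \<and> S \<noteq> verts G"
    show "\<exists>i\<in>A'. (head G i \<in> S) \<noteq> (tail G i \<in> S)"
    proof (rule ccontr)
      assume "\<not> (\<exists>i\<in>A'. (head G i \<in> S) \<noteq> (tail G i \<in> S))"
      then have n: "\<And>i. i \<in> A' \<Longrightarrow> boundary S i = (0::int)" using S A' by (auto simp: boundary_eq subset_iff)
      obtain i where i: "i \<in> A" "(head G i \<in> S) \<noteq> (tail G i \<in> S)"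
        using treeD(2)[OF t] S unfolding conn_iff_cut[OF A] by blast
      then have "boundary S i \<noteq> (0::int)" using S A by (auto simp: boundary_eq subset_iff)
      then have "i = j" using n i by (auto simp: A'_def)
      then have bj: "boundary S j \<noteq> (0::int)" using \<open>boundary S i \<noteq> 0\<close> by simp
      have "0 = (\<Sum>v\<in>S. vertex_total G (tree_cycle A l) v)"
      proof (rule sum.neutral[symmetric], rule ballI)
        fix v assume "v \<in> S"
        then have "v \<in> verts G" using S by blast
        then show "vertex_total G (tree_cycle A l) v = 0" using circ by (simp add: circulation_def)
      qed
      also have "\<dots> = (\<Sum>i\<in>arcs G. boundary S i * tree_cycle A l i)" by (rule sum_vertex_total)
      also have "\<dots> = (\<Sum>i\<in>arcs G. if i = j then boundary S i * tree_cycle A l i else 0)"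
      proof (intro sum.cong refl)
        fix i assume "i \<in> arcs G"
        show "boundary S i * tree_cycle A l i = (if i = j then boundary S i * tree_cycle A l i else 0)"
          using n[of i] by (cases "i = j"; cases "i \<in> A'") (auto simp: A'_def tree_cycle_def)
      qed
      also have "\<dots> = boundary S j * tree_cycle A l j" using j A by (simp add: subset_iff)
      finally show False using bj m cyc by simp
    qed
  qed
  have "\<not> conn (A' - {k})" if k: "k \<in> A'" for k
  proof
    assume ck: "conn (A' - {k})"
    have sub: "A' - {k} \<subseteq> arcs G" using A' by auto
    have kG: "k \<in> arcs G" using k A' by auto
    from arc_flow[OF sub ck kG]
  obtain x :: "'e \<Rightarrow> int" where x': "\<forall>i. i \<notin> A' - {k} \<longrightarrow> x i = 0"
    "\<forall>w\<in>verts G. vertex_total G x w = - incidence G w k"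
    by (elim exE conjE)
  note x = x'[rule_format]
    define u where "u i = x i + (if i = k then 1 else 0)" for i
    have "vertex_total G u v = vertex_total G x v + incidence G v k" for v
      unfolding u_def[abs_def] vertex_total_add using kG by (simp add: vertex_total_single)
    then have u: "circulation u" using x(2) by (simp add: circulation_def)
    have u0: "u i = 0" if "i \<notin> A'" for i using that x(1)[of i] k by (auto simp: u_def)
    have exp: "u i = u l * tree_cycle A l i" if i: "i \<in> arcs G" for i
    proof -
      have "u i = (\<Sum>h\<in>arcs G - A. u h * tree_cycle A h i)" by (rule circulation_expand[OF t u i])
      also have "\<dots> = (\<Sum>h\<in>arcs G - A. if h = l then u h * tree_cycle A h i else 0)"
        by (intro sum.cong) (auto simp: u0 A'_def)
      finally show ?thesis using l by simp
    qed
    have "u j = 0" using u0[of j] j l by (auto simp: A'_def)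
    then have "u l = 0" using exp[of j] m cyc j A by auto
    then have "u k = 0" using exp[OF kG] by simp
    moreover have "u k = 1" using x(1)[of k] by (simp add: u_def)
    ultimately show False by simp
  qed
  with c A' have "tree A'" unfolding tree_iff by blast
  then show ?thesis by (simp only: A'_def)
qed

text \<open>Elimination of \<open>j\<close>: subtract the multiple of the cycle of \<open>l\<close>
  that cancels the value at \<open>j\<close>. The coefficient \<open>tree_coeff A j l\<close> is 1
  or -1, hence its own inverse.\<close>

lemma tree_cycle_exchange:
  assumes t: "tree A" and j: "j \<in> A" and l: "l \<in> arcs G - A" and m: "tree_coeff A j l \<noteq> 0"
    and h: "h \<in> arcs G - A" "h \<noteq> l" and i: "i \<in> arcs G"
  shows "tree_cycle (insert l (A - {j})) h i
    = tree_cycle A h i - tree_coeff A j h * tree_coeff A j l * tree_cycle A l i"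
proof -
  have A: "A \<subseteq> arcs G" using t by (rule treeD)
  define u where "u i = tree_cycle A h i - tree_coeff A j h * tree_coeff A j l * tree_cycle A l i" for i
  have "vertex_total G u v = vertex_total G (tree_cycle A h) v + - (tree_coeff A j h * tree_coeff A j l) * vertex_total G (tree_cycle A l) v" for v
    unfolding vertex_total_scale[symmetric] vertex_total_add[symmetric] by (simp add: u_def[abs_def])
  then have u: "circulation u"
    using circulation_tree_cycle[OF t h(1)] circulation_tree_cycle[OF t l] by (simp add: circulation_def)
  have mm: "tree_coeff A j l * tree_coeff A j l = 1"
    using tree_coeff_cases[OF t j, of l] l m by auto
  have "u i = tree_cycle (insert l (A - {j})) h i"
  proof (rule tree_cycle_unique[OF tree_exchange[OF t j l m] u _ _ i])
    show "h \<in> arcs G - insert l (A - {j})" using h by auto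
    fix k assume k: "k \<in> arcs G - insert l (A - {j})"
    show "u k = (if k = h then 1 else 0)"
    proof (cases "k = j")
      case True
      then show ?thesis using j h mm by (auto simp: u_def tree_cycle_def mult.assoc)
    next
      case False
      then show ?thesis using k h by (auto simp: u_def tree_cycle_def)
    qed
  qed
  then show ?thesis by (simp add: u_def)
qed

text \<open>The cycle through \<open>j\<close> and \<open>l\<close> stays the same and is only
  normalised to be 1 on \<open>j\<close> instead of \<open>l\<close>.\<close>

lemma tree_coeff_exchange:
  assumes t: "tree A" and j: "j \<in> A" and l: "l \<in> arcs G - A" and m: "tree_coeff A j l \<noteq> 0"
  shows "tree_coeff (insert l (A - {j})) l j = tree_coeff A j l"
proof -
  have A: "A \<subseteq> arcs G" using t by (rule treeD)
  define u where "u i = tree_coeff A j l * tree_cycle A l i" for i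
  have "vertex_total G u v = tree_coeff A j l * vertex_total G (tree_cycle A l) v" for v
    unfolding u_def[abs_def] by (rule vertex_total_scale)
  then have u: "circulation u"
    using circulation_tree_cycle[OF t l] by (simp add: circulation_def)
  have mm: "tree_coeff A j l * tree_coeff A j l = 1"
    using tree_coeff_cases[OF t j, of l] l m by auto
  have "u l = tree_cycle (insert l (A - {j})) j l"
  proof (rule tree_cycle_unique[OF tree_exchange[OF t j l m] u])
    show "j \<in> arcs G - insert l (A - {j})" "l \<in> arcs G" using j l A by auto
    fix k assume k: "k \<in> arcs G - insert l (A - {j})"
    then consider "k = j" | "k \<noteq> j" "k \<notin> A" "k \<noteq> l" by blast
    then show "u k = (if k = j then 1 else 0)"
    proof cases
      case 1
      then show ?thesis using j mm by (simp add: u_def tree_cycle_def)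
    next
      case 2
      then show ?thesis by (simp add: u_def tree_cycle_def)
    qed
  qed
  then show ?thesis using l by (simp add: u_def tree_cycle_def)
qed

text \<open>Expand the cycle that \<open>e\<close> closes through \<open>B\<close> with respect to
  \<open>A\<close>: its value 1 at \<open>e\<close> needs a nonzero term, and the cycle is supported
  on \<open>B\<close> and \<open>e\<close>.\<close>

lemma tree_coeff_nonzero:
  assumes B: "tree B" and e: "e \<in> arcs G - B" and A: "tree A" and eA: "e \<in> A"
  shows "\<exists>l\<in>B - A. tree_coeff A e l \<noteq> 0"
proof -
  have "1 = tree_cycle B e e" using e by (simp add: tree_cycle_def)
  also have "\<dots> = (\<Sum>l\<in>arcs G - A. tree_coeff A e l * tree_cycle B e l)"
    by (rule circulation_tree_formula[OF A eA circulation_tree_cycle[OF B e]])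
  finally have "(\<Sum>l\<in>arcs G - A. tree_coeff A e l * tree_cycle B e l) \<noteq> 0" by simp
  then obtain l where l: "l \<in> arcs G - A" "tree_coeff A e l * tree_cycle B e l \<noteq> 0"
    by (rule sum.not_neutral_contains_not_neutral)
  then have "l \<in> B" using eA by (auto simp: tree_cycle_def split: if_splits)
  then show ?thesis using l by auto
qed

end

subsection \<open>The sum over spanning trees\<close>

lemma sum_PiE_insert:
  assumes "k \<notin> S"
  shows "(\<Sum>s\<in>PiE S (\<lambda>_. X). \<Sum>t\<in>X. f (s(k := t))) = (\<Sum>s\<in>PiE (insert k S) (\<lambda>_. X). f s)"
proof -
  have "(\<Sum>s\<in>PiE (insert k S) (\<lambda>_. X). f s) = (\<Sum>p\<in>X \<times> PiE S (\<lambda>_. X). f ((snd p)(k := fst p)))"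
    unfolding PiE_insert_eq using inj_combinator[OF assms, of "\<lambda>_. X"]
    by (subst sum.reindex) (simp_all add: case_prod_unfold)
  also have "\<dots> = (\<Sum>t\<in>X. \<Sum>s\<in>PiE S (\<lambda>_. X). f (s(k := t)))"
    by (subst sum.cartesian_product) (simp add: case_prod_unfold)
  finally show ?thesis by (subst sum.swap) simp
qed

text \<open>When \<open>C\<close> is ordered by \<open>phi\<close>, the term of \<open>j\<close> has
  factors w - 1 below \<open>j\<close> and w + 1 above. Writing 2 as (w j + 1) - (w j - 1) makes the
  sum telescope; the proof peels off the largest element.\<close>

lemma sum_prod_sgn_telescope:
  fixes w :: "'k \<Rightarrow> complex" and phi :: "'k \<Rightarrow> int"
  assumes "finite C" "inj_on phi C"
  shows "2 * (\<Sum>j\<in>C. \<Prod>l\<in>C-{j}. w l + of_int (sgn (phi l - phi j))) = (\<Prod>l\<in>C. w l + 1) - (\<Prod>l\<in>C. w l - 1)"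
  using assms
proof (induction "card C" arbitrary: C)
  case 0
  then show ?case by simp
next
  case (Suc n)
  then have ne: "C \<noteq> {}" by auto
  have "Max (phi ` C) \<in> phi ` C" using ne Suc.prems(1) by (intro Max_in) auto
  then obtain m where m: "m \<in> C" and Mx: "Max (phi ` C) = phi m" by auto
  have mx: "phi l \<le> phi m" if "l \<in> C" for l
    unfolding Mx[symmetric] using that Suc.prems(1) by (intro Max_ge) auto
  define B where "B = C - {m}"
  have C: "C = insert m B" "m \<notin> B" "finite B" using m Suc.prems by (auto simp: B_def)
  have lt: "phi l < phi m" if "l \<in> B" for l
    using mx[of l] that C Suc.prems(2) by (auto simp: inj_on_def order.order_iff_strict)
  have IH: "2 * (\<Sum>j\<in>B. \<Prod>l\<in>B-{j}. w l + of_int (sgn (phi l - phi j))) = (\<Prod>l\<in>B. w l + 1) - (\<Prod>l\<in>B. w l - 1)"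
    using Suc C by (intro Suc.hyps) (auto simp: inj_on_def)
  have 1: "(\<Prod>l\<in>C-{j}. w l + of_int (sgn (phi l - phi j))) = (w m + 1) * (\<Prod>l\<in>B-{j}. w l + of_int (sgn (phi l - phi j)))"
    if "j \<in> B" for j
  proof -
    have "C - {j} = insert m (B - {j})" using C that by auto
    then show ?thesis using C lt[OF that] by simp
  qed
  have 2: "(\<Prod>l\<in>C-{m}. w l + of_int (sgn (phi l - phi m))) = (\<Prod>l\<in>B. w l - 1)"
    unfolding B_def[symmetric] by (intro prod.cong) (use lt in auto)
  have "2 * (\<Sum>j\<in>C. \<Prod>l\<in>C-{j}. w l + of_int (sgn (phi l - phi j)))
    = 2 * ((\<Prod>l\<in>B. w l - 1) + (\<Sum>j\<in>B. (w m + 1) * (\<Prod>l\<in>B-{j}. w l + of_int (sgn (phi l - phi j)))))"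
    using C(2,3) by (subst C(1), subst sum.insert) (simp_all add: 1 2)
  also have "\<dots> = 2 * (\<Prod>l\<in>B. w l - 1) + (w m + 1) * (2 * (\<Sum>j\<in>B. \<Prod>l\<in>B-{j}. w l + of_int (sgn (phi l - phi j))))"
    by (simp add: sum_distrib_left algebra_simps)
  also have "\<dots> = (w m + 1) * (\<Prod>l\<in>B. w l + 1) - (w m - 1) * (\<Prod>l\<in>B. w l - 1)"
    unfolding IH by (simp add: algebra_simps)
  finally show ?case using C by simp
qed

text \<open>
  On vectors with entries in \<open>{-1, 0, 1}\<close> the powers of 3 make the sign of the value that of the first
  nonzero entry along \<open>bs\<close>. Thus the first line in \<open>bs\<close> on the cycle that \<open>l\<close> closes through a tree
  decides the sign \<open>\<plusminus> 1\<close> accompanying the kernel of \<open>l\<close>.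
\<close>

fun ternary_value :: "'e list \<Rightarrow> ('e \<Rightarrow> int) \<Rightarrow> int" where
  "ternary_value [] v = 0"
| "ternary_value (b # bs) v = 3 ^ length bs * v b + ternary_value bs v"

text \<open>Geometric sum: 1 + 3 + ... + 3^(n-1) is (3^n - 1)/2, so a nonzero leading entry
  outweighs all later ones.\<close>

lemma ternary_value_bound:
  assumes "\<And>i. v i \<in> {-1, 0, 1}"
  shows "2 * \<bar>ternary_value bs v\<bar> < 3 ^ length bs"
proof (induction bs)
  case (Cons b bs)
  have "\<bar>3 ^ length bs * v b\<bar> \<le> 3 ^ length bs" using assms[of b] by auto
  then show ?case
    using Cons abs_triangle_ineq[of "3 ^ length bs * v b" "ternary_value bs v"] by simp
qed simp

lemma sgn_ternary_value_Cons:
  assumes "\<And>i. v i \<in> {-1, 0, 1}" "v b \<noteq> 0"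
  shows "sgn (ternary_value (b # bs) v) = v b"
proof -
  have "2 * \<bar>ternary_value bs v\<bar> < 3 ^ length bs" by (rule ternary_value_bound[OF assms(1)])
  moreover have "v b = 1 \<or> v b = -1" using assms(1)[of b] assms(2) by auto
  ultimately show ?thesis by (auto simp: sgn_if abs_if split: if_splits)
qed

lemma ternary_value_nonzero:
  assumes "\<And>i. v i \<in> {-1, 0, 1}" "\<exists>b\<in>set bs. v b \<noteq> 0"
  shows "ternary_value bs v \<noteq> 0"
  using assms(2)
proof (induction bs)
  case (Cons b bs)
  show ?case
  proof (cases "v b = 0")
    case False
    then have "sgn (ternary_value (b # bs) v) \<noteq> 0" using sgn_ternary_value_Cons[of v b bs, OF assms(1) False] by simp
    then show ?thesis by auto
  qed (use Cons in auto)
qed simp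

lemma ternary_value_cong:
  "(\<And>b. b \<in> set bs \<Longrightarrow> u b = v b) \<Longrightarrow> ternary_value bs u = ternary_value bs v"
  by (induction bs) auto

text \<open>Linearity is the reason for encoding the lexicographic order by a number: the effect of
  a tree exchange on cycles becomes a subtraction of values.\<close>

lemma ternary_value_diff_scale:
  "ternary_value bs (\<lambda>i. u i - c * v i) = ternary_value bs u - c * ternary_value bs v"
  by (induction bs) (simp_all add: algebra_simps)

text \<open>The bound 2 suffices because the poles in each integration are given by differences of two
  vectors with entries in \<open>{-1, 0, 1}\<close>.\<close>

definition generic :: "'e set \<Rightarrow> ('e \<Rightarrow> real) \<Rightarrow> bool" where
  "generic E q \<longleftrightarrow> (\<forall>c::'e \<Rightarrow> int. (\<forall>i\<in>E. c i \<in> {-2..2}) \<and> (\<exists>i\<in>E. c i \<noteq> 0) \<longrightarrow> (\<Sum>i\<in>E. of_int (c i) * q i) \<noteq> 0)"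

lemma genericD:
  assumes "generic E q" "\<And>i. i \<in> E \<Longrightarrow> c i \<in> {-2..2}" "j \<in> E" "c j \<noteq> 0"
  shows "(\<Sum>i\<in>E. of_int (c i) * q i) \<noteq> 0"
  using assms unfolding generic_def by blast

lemma generic_nonzero:
  assumes "generic E q" "finite E" "i \<in> E"
  shows "q i \<noteq> 0"
  using genericD[OF assms(1) _ assms(3), of "\<lambda>k. if k = i then 1 else 0"] assms(2,3)
  by (simp add: if_distrib[of "\<lambda>t. of_int t * _"] cong: if_cong)

section \<open>Solutions parametrised by a tree, and exchange of lines in sums over trees\<close>

context matsubara_graph
begin

text \<open>Used over the integers for the sum, over the reals for the integrand and over the
  complex numbers for lines that are put on shell.\<close>

definition extend :: "('v \<Rightarrow> int) \<Rightarrow> 'e set \<Rightarrow> ('e \<Rightarrow> 'c::comm_ring_1) \<Rightarrow> 'e \<Rightarrow> 'c" where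
  "extend N A y i = (if i \<in> A then of_int (tree_const N A i) + (\<Sum>l\<in>arcs G - A. of_int (tree_coeff A i l) * y l) else y i)"

lemma extend_cotree: "i \<notin> A \<Longrightarrow> extend N A y i = y i"
  by (simp add: extend_def)

lemma extend_cong:
  "(\<And>l. l \<in> arcs G - A \<Longrightarrow> y l = y' l) \<Longrightarrow> i \<in> arcs G \<Longrightarrow> extend N A y i = extend N A y' i"
  by (auto simp: extend_def intro!: sum.cong arg_cong2[where f = "(*)"])

lemma extend_update:
  assumes "e \<in> arcs G - A"
  shows "extend N A (y(e := c)) i = extend N A (y(e := 0)) i + of_int (tree_cycle A e i) * c"
proof (cases "i \<in> A")
  case True
  have "(\<Sum>l\<in>arcs G - A. of_int (tree_coeff A i l) * (y(e := c)) l)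
    = of_int (tree_coeff A i e) * c + (\<Sum>l\<in>arcs G - A. of_int (tree_coeff A i l) * (y(e := 0)) l)"
    using assms by (simp add: sum.remove[of _ e] algebra_simps)
  then show ?thesis using True by (simp add: extend_def tree_cycle_def)
qed (simp add: extend_def tree_cycle_def)

text \<open>Both trees parametrise the same affine space of solutions, so solving again from the
  other tree changes nothing.\<close>

lemma extend_extend:
  assumes "tree A" "tree B" "(\<Sum>v\<in>verts G. N v) = 0" "i \<in> arcs G"
  shows "extend N B (extend N A y) i = extend N A y i"
proof (cases "i \<in> B")
  case True
  have "\<forall>j\<in>A. extend N A y j = of_int (tree_const N A j) + (\<Sum>l\<in>arcs G - A. of_int (tree_coeff A j l) * extend N A y l)"
    by (auto simp: extend_def intro!: sum.cong)
  then show ?thesis using True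
    unfolding solution_iff[OF assms(1,3), symmetric] solution_iff[OF assms(2,3)]
    by (simp add: extend_def[of N B])
qed (simp add: extend_def)

definition trees_in :: "'e set \<Rightarrow> 'e set set" where
  "trees_in E = {A. tree A \<and> A \<subseteq> E}"

lemma trees_inD: "A \<in> trees_in E \<Longrightarrow> tree A" "A \<in> trees_in E \<Longrightarrow> A \<subseteq> E"
  by (simp_all add: trees_in_def)

lemma finite_trees_in: "finite (trees_in E)"
proof (rule finite_subset[of _ "Pow (arcs G)"])
  show "trees_in E \<subseteq> Pow (arcs G)" using treeD(1) by (auto simp: trees_in_def)
qed simp

text \<open>Includes the degenerate exchange \<open>k = e\<close>, in which the tree stays as it is;
  it arises from the pole of the propagator of \<open>e\<close> itself.\<close>

lemma tree_cycle_exchange_nonzero: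
  assumes t: "tree A" and e: "e \<in> arcs G - A" and k: "k \<in> insert e A" and nz: "tree_cycle A e k \<noteq> 0"
  shows "tree (insert e A - {k})" and "tree_cycle (insert e A - {k}) k e = tree_cycle A e k"
proof -
  show "tree (insert e A - {k})"
  proof (cases "k = e")
    case False
    then have "insert e A - {k} = insert e (A - {k})" by auto
    then show ?thesis using tree_exchange[OF t _ e, of k] False k nz by (simp add: tree_cycle_def)
  next
    case True
    then have "insert e A - {k} = A" using e by auto
    then show ?thesis using t by simp
  qed
  show "tree_cycle (insert e A - {k}) k e = tree_cycle A e k"
  proof (cases "k = e")
    case False
    then have *: "insert e A - {k} = insert e (A - {k})" by auto
    show ?thesis using tree_coeff_exchange[OF t _ e, of k] False k nz unfolding * by (simp add: tree_cycle_def)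
  next
    case True
    then have "insert e A - {k} = A" using e by auto
    then show ?thesis using True by simp
  qed
qed

definition cone_sign :: "'e list \<Rightarrow> 'e set \<Rightarrow> 'e \<Rightarrow> int" where
  "cone_sign bs A l = sgn (ternary_value bs (tree_cycle A l))"

text \<open>Adding \<open>e\<close> to a tree and removing \<open>k\<close> from the resulting cycle
  is a bijection of pairs, undone by adding \<open>k\<close> and removing \<open>e\<close>. In the
  sum on the right the final tree comes first, so the contributions of all trees leading to it are
  grouped together.\<close>

lemma sum_trees_in_exchange:
  assumes E: "E \<subseteq> arcs G" "e \<in> arcs G" "e \<notin> E"
  shows "(\<Sum>A\<in>trees_in E. \<Sum>k | k \<in> insert e A \<and> tree_cycle A e k \<noteq> 0. f A k)
    = (\<Sum>A\<in>trees_in (insert e E). \<Sum>k | k \<in> insert e E - A \<and> tree_cycle A k e \<noteq> 0. f (insert k A - {e}) k)"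
proof -
  have fin: "finite {k. k \<in> insert e A \<and> tree_cycle A e k \<noteq> 0}" if "A \<in> trees_in E" for A
    using finite_subset[OF treeD(1)[OF trees_inD(1)[OF that]] finite_arcs] by simp
  have fin': "finite {k. k \<in> insert e E - A \<and> tree_cycle A k e \<noteq> 0}" for A
    using finite_subset[OF E(1) finite_arcs] by simp
  have L: "(\<Sum>A\<in>trees_in E. \<Sum>k | k \<in> insert e A \<and> tree_cycle A e k \<noteq> 0. f A k)
    = (\<Sum>(A, k)\<in>(SIGMA A:trees_in E. {k. k \<in> insert e A \<and> tree_cycle A e k \<noteq> 0}). f A k)"
    by (rule sum.Sigma[OF finite_trees_in]) (use fin in blast)
  have R: "(\<Sum>A\<in>trees_in (insert e E). \<Sum>k | k \<in> insert e E - A \<and> tree_cycle A k e \<noteq> 0. f (insert k A - {e}) k)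
    = (\<Sum>(A, k)\<in>(SIGMA A:trees_in (insert e E). {k. k \<in> insert e E - A \<and> tree_cycle A k e \<noteq> 0}). f (insert k A - {e}) k)"
    by (rule sum.Sigma[OF finite_trees_in]) (use fin' in blast)
  show ?thesis unfolding L R
  proof (rule sum.reindex_bij_witness[where i = "\<lambda>(A, k). (insert k A - {e}, k)" and j = "\<lambda>(A, k). (insert e A - {k}, k)"], goal_cases)
    case (1 a)
    then show ?case using E by (auto simp: trees_in_def)
  next
    case (2 a)
    then obtain A k where a: "a = (A, k)" and A: "tree A" "A \<subseteq> E" and k: "k \<in> insert e A" "tree_cycle A e k \<noteq> 0"
      by (auto simp: trees_in_def)
    have e: "e \<in> arcs G - A" using A E by auto
    show ?case using tree_cycle_exchange_nonzero[OF A(1) e k] A k(2) k(1) by (auto simp: a trees_in_def)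
  next
    case (3 b)
    then obtain A k where b: "b = (A, k)" and k: "k \<in> insert e E" "k \<notin> A" "tree_cycle A k e \<noteq> 0"
      by auto
    have "e \<in> insert k A" using k by (auto simp: tree_cycle_def split: if_splits)
    then show ?case using k by (auto simp: b)
  next
    case (4 b)
    then obtain A k where b: "b = (A, k)" and A: "tree A" "A \<subseteq> insert e E" and k: "k \<in> insert e E" "k \<notin> A" "tree_cycle A k e \<noteq> 0"
      by (auto simp: trees_in_def)
    have kG: "k \<in> arcs G - A" using k E by auto
    have eA: "e \<in> insert k A" using k by (auto simp: tree_cycle_def split: if_splits)
    show ?case using tree_cycle_exchange_nonzero[OF A(1) kG eA k(3)] A k by (auto simp: b trees_in_def)
  next
    case (5 a)
    then show ?case using E by (auto simp: trees_in_def intro!: arg_cong[of _ _ "\<lambda>A. f A _"])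
  qed
qed

end

locale matsubara_kernel = matsubara_graph G + summation_kernel nu emb kap D
  for G :: "('v, 'e) pre_digraph" and nu :: "'a measure" and emb kap D +
  fixes N :: "'v \<Rightarrow> int" and T :: "'e set" and q :: "'e \<Rightarrow> real"
  assumes N: "(\<Sum>v\<in>verts G. N v) = 0" and T: "tree T"
begin

text \<open>The head of the list is the outermost integral, so prefixing a line means integrating
  one more variable. The function \<open>z\<close> supplies the values of the lines that are held
  fixed.\<close>

fun iterated :: "'e list \<Rightarrow> ('e \<Rightarrow> real) \<Rightarrow> complex" where
  "iterated [] z = (\<Prod>j\<in>T. 1 / ((extend N T (\<lambda>i. of_real (z i)) j)\<^sup>2 + (of_real (q j))\<^sup>2))"
| "iterated (b # bs) z = (LINT y|nu. 1 / ((of_real (emb y))\<^sup>2 + (of_real (q b))\<^sup>2) * iterated bs (z(b := emb y)))"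

text \<open>The lines that are tree lines or already integrated out; all others are still
  parameters.\<close>

definition lines :: "'e list \<Rightarrow> 'e set" where
  "lines bs = T \<union> set bs"

definition point :: "'e set \<Rightarrow> ('e \<Rightarrow> int) \<Rightarrow> ('e \<Rightarrow> real) \<Rightarrow> 'e \<Rightarrow> complex" where
  "point E s z l = (if l \<in> E then \<i> * of_int (s l) * of_real (q l) else of_real (z l))"

abbreviation signs :: "'e set \<Rightarrow> ('e \<Rightarrow> int) set" where
  "signs S \<equiv> PiE S (\<lambda>_. {-1, 1})"

text \<open>Each line on shell contributes pi i from the kernel integral and the residue 1/(2 i s q)
  of its propagator at the pole i s q.\<close>

definition prefactor :: "'e set \<Rightarrow> ('e \<Rightarrow> int) \<Rightarrow> complex" where
  "prefactor S s = (\<Prod>l\<in>S. of_real pi * \<i> / (2 * \<i> * of_int (s l) * of_real (q l)))"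

definition propagators :: "'e set \<Rightarrow> ('e \<Rightarrow> complex) \<Rightarrow> complex" where
  "propagators A x = (\<Prod>j\<in>A. 1 / ((x j)\<^sup>2 + (of_real (q j))\<^sup>2))"

definition gaudin :: "'e list \<Rightarrow> ('e \<Rightarrow> real) \<Rightarrow> complex" where
  "gaudin bs z = (\<Sum>A\<in>trees_in (lines bs). \<Sum>s\<in>signs (lines bs - A).
     prefactor (lines bs - A) s * (\<Prod>l\<in>lines bs - A. kap (\<i> * of_int (s l) * of_real (q l)) + of_int (cone_sign bs A l)) *
     propagators A (extend N A (point (lines bs) s z)))"

text \<open>A circulation that vanishes on all lines off \<open>T\<close> is zero, so the cycle of
  \<open>l\<close> must meet \<open>bs\<close>. Hence the cone signs are 1 or -1 and never
  0.\<close>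

lemma ternary_value_tree_cycle_nonzero:
  assumes bs: "set bs \<subseteq> arcs G - T" and A: "A \<in> trees_in (lines bs)" and l: "l \<in> lines bs - A"
  shows "ternary_value bs (tree_cycle A l) \<noteq> 0"
proof (rule ternary_value_nonzero)
  have lG: "l \<in> arcs G" using l bs treeD(1)[OF T] by (auto simp: lines_def)
  have tA: "tree A" "A \<subseteq> lines bs" using A by (simp_all add: trees_in_def)
  show "tree_cycle A l i \<in> {-1, 0, 1}" for i by (rule tree_cycle_cases[OF tA(1) lG])
  show "\<exists>b\<in>set bs. tree_cycle A l b \<noteq> 0"
  proof (rule ccontr)
    assume "\<not> (\<exists>b\<in>set bs. tree_cycle A l b \<noteq> 0)"
    then have 0: "tree_cycle A l b = 0" if "b \<in> arcs G - T" for b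
      using that tA(2) l by (cases "b \<in> set bs") (auto simp: tree_cycle_def lines_def)
    have "tree_cycle A l l = (\<Sum>k\<in>arcs G - T. tree_cycle A l k * tree_cycle T k l)"
      using lG l by (intro circulation_expand[OF T circulation_tree_cycle[OF tA(1)]]) auto
    also have "\<dots> = 0" by (simp add: 0)
    finally show False using l by (simp add: tree_cycle_def)
  qed
qed

text \<open>The sum runs over all earlier trees that lead to \<open>A\<close> when \<open>e\<close>
  is integrated out. If \<open>e\<close> is off \<open>A\<close>, only \<open>k = e\<close>
  contributes, and it creates the factor with sign 1. If \<open>e\<close> is on \<open>A\<close>,
  the exchanged cone signs compare values \<open>phi\<close>, so the sum telescopes to a difference
  of two products, and the addition theorem of \<open>kap\<close> turns this difference into a
  single product with the new signs.\<close>

lemma bracket_identity: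
  assumes gen: "generic (arcs G) q" and bs: "set bs \<subseteq> arcs G - T" and e: "e \<in> arcs G - T" "e \<notin> set bs"
    and z: "\<And>l. z l \<in> D" and A: "A \<in> trees_in (insert e (lines bs))" and s: "s \<in> signs (insert e (lines bs) - A)"
  defines "E' \<equiv> insert e (lines bs)"
  defines "kp \<equiv> (\<lambda>l. kap (\<i> * of_int (s l) * of_real (q l)))"
  shows "(kap (extend N A (point E' s z) e) + 1) *
     (\<Sum>k | k \<in> E' - A \<and> tree_cycle A k e \<noteq> 0. of_int (tree_cycle A k e) *
        (\<Prod>l\<in>E' - A - {k}. kp l + of_int (cone_sign bs (insert k A - {e}) l)))
    = (\<Prod>l\<in>E' - A. kp l + of_int (cone_sign (e # bs) A l))"
proof -
  have E'G: "E' \<subseteq> arcs G" using bs e treeD(1)[OF T] by (auto simp: E'_def lines_def)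
  have tA: "tree A" "A \<subseteq> E'" using A by (simp_all add: trees_in_def E'_def)
  have finE: "finite (E' - A)" using finite_subset[OF E'G finite_arcs] by simp
  have eE: "e \<notin> lines bs" using e by (simp add: lines_def)
  define C where "C = {k. k \<in> E' - A \<and> tree_cycle A k e \<noteq> 0}"
  have finC: "finite C" by (rule finite_subset[OF _ finE]) (auto simp: C_def)
  define eps where "eps k = tree_cycle A k e" for k
  have eps_cases: "eps k = 1 \<or> eps k = -1" if "k \<in> C" for k
    using tree_cycle_cases[OF tA(1), of k e] that E'G by (auto simp: C_def eps_def)
  have cases3: "tree_cycle A l i \<in> {-1, 0, 1}" if "l \<in> E'" for l i
    using that E'G tree_cycle_cases[OF tA(1)] by blast
  \<comment> \<open>As \<open>e\<close> heads the new list, it decides the sign of every cycle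
    passing through it; other cycles keep their old sign.\<close>
  have sgn_C: "cone_sign (e # bs) A l = eps l" if "l \<in> C" for l
    unfolding cone_sign_def eps_def using that by (intro sgn_ternary_value_Cons cases3) (auto simp: C_def)
  have sgn_nC: "cone_sign (e # bs) A l = cone_sign bs A l" if "l \<in> E' - A" "l \<notin> C" for l
    using that by (simp add: cone_sign_def C_def)
  have s1: "s l = 1 \<or> s l = -1" if "l \<in> E' - A" for l using s that by (auto simp: E'_def)
  show ?thesis
  proof (cases "e \<in> A")
    case False
    have C: "C = {e}" using False by (auto simp: C_def E'_def tree_cycle_def)
    have ins: "insert e A - {e} = A" using False by auto
    have "kap (extend N A (point E' s z) e) = kp e"
      using False by (simp add: extend_cotree point_def kp_def E'_def)
    moreover have "(\<Prod>l\<in>E' - A. kp l + of_int (cone_sign (e # bs) A l)) = (kp e + 1) * (\<Prod>l\<in>E' - A - {e}. kp l + of_int (cone_sign bs A l))"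
    proof -
      have "e \<in> E' - A" using False by (simp add: E'_def)
      moreover have "cone_sign (e # bs) A e = 1" using sgn_C[of e] False by (simp add: C eps_def tree_cycle_def)
      moreover have "(\<Prod>l\<in>E' - A - {e}. kp l + of_int (cone_sign (e # bs) A l)) = (\<Prod>l\<in>E' - A - {e}. kp l + of_int (cone_sign bs A l))"
        by (intro prod.cong refl) (auto simp: sgn_nC C)
      ultimately show ?thesis using finE by (subst prod.remove[of _ e]) auto
    qed
    ultimately show ?thesis
      unfolding C_def[symmetric] unfolding C using False ins by (simp add: tree_cycle_def)
  next
    case True
    obtain l0 where "l0 \<in> T - A" "tree_coeff A e l0 \<noteq> 0"
      using tree_coeff_nonzero[OF T e(1) tA(1) True] by blast
    then have Cne: "C \<noteq> {}" using True by (auto simp: C_def E'_def lines_def tree_cycle_def)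
    define w where "w l = of_int (eps l) * (\<i> * of_int (s l) * of_real (q l))" for l
    have Imw: "Im (w l) = of_int (eps l * s l) * q l" for l by (simp add: w_def)
    have Imw0: "Im (w l) \<noteq> 0" if "l \<in> C" for l
      using that eps_cases[OF that] s1[of l] generic_nonzero[OF gen finite_arcs, of l] E'G by (auto simp: Imw C_def)
    \<comment> \<open>The imaginary part is a combination of the \<open>q i\<close> with
      coefficients 1 and -1 on the nonempty set \<open>C\<close>, so genericity excludes 0.\<close>
    have ImS: "Im (\<Sum>l\<in>C. w l) \<noteq> 0"
    proof -
      obtain c where c: "c \<in> C" using Cne by auto
      have "(\<Sum>i\<in>arcs G. of_int (if i \<in> C then eps i * s i else 0) * q i) \<noteq> 0"
      proof (rule genericD[OF gen])
        show "(if i \<in> C then eps i * s i else 0) \<in> {-2..2}" for i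
          using eps_cases[of i] s1[of i] by (auto simp: C_def)
        show "c \<in> arcs G" using c E'G by (auto simp: C_def)
        show "(if c \<in> C then eps c * s c else 0) \<noteq> 0" using c eps_cases[of c] s1[of c] by (auto simp: C_def)
      qed
      also have "(\<Sum>i\<in>arcs G. of_int (if i \<in> C then eps i * s i else 0) * q i) = (\<Sum>i\<in>C. Im (w i))"
        using E'G by (intro sum.mono_neutral_cong_right) (auto simp: C_def Imw)
      finally show ?thesis by simp
    qed
    have kapw: "kap (w l) = of_int (eps l) * kp l" if "l \<in> C" for l
      using eps_cases[OF that] by (auto simp: w_def kp_def kap_minus)
    have kpw: "kp l = of_int (eps l) * kap (w l)" if "l \<in> C" for l
      using eps_cases[OF that] kapw[OF that] by auto
    \<comment> \<open>The value on \<open>e\<close> is the sum of the on-shell values plus a real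
      \<open>r\<close> formed from the constant and the fixed lines; \<open>r\<close> lies in
      \<open>D\<close> and is a period of the kernel.\<close>
    have kapX: "kap (extend N A (point E' s z) e) = kap (\<Sum>l\<in>C. w l)"
    proof -
      define r where "r = of_int (tree_const N A e) + (\<Sum>l\<in>arcs G - E'. of_int (tree_coeff A e l) * z l)"
      have mult_in: "of_int (tree_coeff A e l) * z l \<in> D" if "l \<in> arcs G" for l
        using tree_coeff_cases[OF tA(1) True that] z[of l] minus_in[OF z, of l] of_int_in[of 0] by auto
      have "(\<Sum>l\<in>L. of_int (tree_coeff A e l) * z l) \<in> D" if "finite L" "L \<subseteq> arcs G" for L
        using that
      proof (induction L rule: finite_induct)
        case empty
        then show ?case using of_int_in[of 0] by simp
      next
        case (insert x F)
        then show ?case using add_in[OF mult_in[of x]] by simp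
      qed
      then have r: "r \<in> D" unfolding r_def by (intro add_in of_int_in) auto
      have split: "arcs G - A = (E' - A) \<union> (arcs G - E')" using tA E'G by auto
      have "extend N A (point E' s z) e = of_int (tree_const N A e)
         + ((\<Sum>l\<in>E' - A. of_int (tree_coeff A e l) * point E' s z l) + (\<Sum>l\<in>arcs G - E'. of_int (tree_coeff A e l) * point E' s z l))"
        using True finE unfolding extend_def split by (subst sum.union_disjoint) auto
      also have "(\<Sum>l\<in>arcs G - E'. of_int (tree_coeff A e l) * point E' s z l) = (\<Sum>l\<in>arcs G - E'. of_int (tree_coeff A e l) * of_real (z l))"
        by (intro sum.cong) (auto simp: point_def)
      also have "(\<Sum>l\<in>E' - A. of_int (tree_coeff A e l) * point E' s z l) = (\<Sum>l\<in>C. w l)"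
        using True finE by (intro sum.mono_neutral_cong_right) (auto simp: C_def w_def eps_def tree_cycle_def point_def)
      finally have "extend N A (point E' s z) e = (\<Sum>l\<in>C. w l) + of_real r"
        by (simp add: r_def)
      then show ?thesis using kap_shift[OF r] by simp
    qed
    \<comment> \<open>Exchanging \<open>e\<close> for \<open>k\<close> subtracts a multiple of the
      cycle of \<open>k\<close>; after the orientation \<open>eps\<close> is factored out, the new
      cone sign of \<open>l\<close> compares \<open>phi l\<close> with \<open>phi k\<close>.\<close>
    define phi where "phi l = eps l * ternary_value bs (tree_cycle A l)" for l
    have exch: "ternary_value bs (tree_cycle (insert k A - {e}) l) = ternary_value bs (tree_cycle A l) - eps l * eps k * ternary_value bs (tree_cycle A k)"
      if k: "k \<in> C" and l: "l \<in> E' - A" "l \<noteq> k" for k l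
    proof -
      have "tree_cycle (insert k (A - {e})) l i = tree_cycle A l i - eps l * eps k * tree_cycle A k i" if "i \<in> arcs G" for i
      proof -
        have kG: "k \<in> arcs G - A" and lG: "l \<in> arcs G - A" using k l E'G by (auto simp: C_def)
        have "tree_coeff A e k \<noteq> 0" using k True by (auto simp: C_def tree_cycle_def)
        note ex = tree_cycle_exchange[OF tA(1) True kG this lG l(2) that]
        have "eps l = tree_coeff A e l" "eps k = tree_coeff A e k"
          using True by (simp_all add: eps_def tree_cycle_def)
        then show ?thesis by (simp only: ex)
      qed
      moreover have "insert k A - {e} = insert k (A - {e})" using k True by (auto simp: C_def)
      ultimately have "ternary_value bs (tree_cycle (insert k A - {e}) l) = ternary_value bs (\<lambda>i. tree_cycle A l i - eps l * eps k * tree_cycle A k i)"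
        using bs by (intro ternary_value_cong) auto
      then show ?thesis by (simp only: ternary_value_diff_scale)
    qed
    have sign_C: "cone_sign bs (insert k A - {e}) l = eps l * sgn (phi l - phi k)"
      and phi_neq: "phi l \<noteq> phi k" if k: "k \<in> C" and l: "l \<in> C" "l \<noteq> k" for k l
    proof -
      have eq: "ternary_value bs (tree_cycle (insert k A - {e}) l) = eps l * (phi l - phi k)"
        using exch[OF k _ l(2)] l eps_cases[OF l(1)] by (auto simp: phi_def C_def)
      show "cone_sign bs (insert k A - {e}) l = eps l * sgn (phi l - phi k)"
        using eps_cases[OF l(1)] by (auto simp: cone_sign_def eq sgn_mult)
      have "insert k A - {e} \<in> trees_in (lines bs)"
      proof -
        have kG: "k \<in> arcs G - A" using k E'G by (auto simp: C_def)
        have "tree (insert k A - {e})"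
          using True k by (intro tree_cycle_exchange_nonzero[OF tA(1) kG]) (auto simp: C_def)
        moreover have "k \<noteq> e" using True k by (auto simp: C_def)
        ultimately show ?thesis using k tA(2) by (auto simp: trees_in_def E'_def C_def)
      qed
      then have "ternary_value bs (tree_cycle (insert k A - {e}) l) \<noteq> 0"
        using l True by (intro ternary_value_tree_cycle_nonzero[OF bs]) (auto simp: C_def E'_def)
      then show "phi l \<noteq> phi k" using eq by auto
    qed
    have sign_nC: "cone_sign bs (insert k A - {e}) l = cone_sign bs A l" if "k \<in> C" "l \<in> E' - A" "l \<notin> C" for k l
    proof -
      have "l \<noteq> k" "eps l = 0" using that by (auto simp: C_def eps_def)
      then show ?thesis using exch[of k l] that by (simp add: cone_sign_def)
    qed
    have inj: "inj_on phi C" using phi_neq by (auto simp: inj_on_def)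
    \<comment> \<open>Cycles that avoid \<open>e\<close> are untouched by all the exchanges, so
      their factors split off as \<open>R\<close>.\<close>
    define R where "R = (\<Prod>l\<in>E' - A - C. kp l + of_int (cone_sign bs A l))"
    define Pe where "Pe = (\<Prod>l\<in>C. of_int (eps l) :: complex)"
    have CE: "C \<subseteq> E' - A" by (auto simp: C_def)
    have "(\<Prod>l\<in>E' - A - {k}. kp l + of_int (cone_sign bs (insert k A - {e}) l))
       = R * (\<Prod>l\<in>C-{k}. of_int (eps l) * (kap (w l) + of_int (sgn (phi l - phi k))))" if k: "k \<in> C" for k
    proof -
      have "E' - A - {k} = (E' - A - C) \<union> (C - {k})" using k CE by auto
      then have "(\<Prod>l\<in>E' - A - {k}. kp l + of_int (cone_sign bs (insert k A - {e}) l))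
        = (\<Prod>l\<in>E' - A - C. kp l + of_int (cone_sign bs (insert k A - {e}) l)) * (\<Prod>l\<in>C - {k}. kp l + of_int (cone_sign bs (insert k A - {e}) l))"
        using finE finC by (simp only:) (subst prod.union_disjoint, auto)
      also have "(\<Prod>l\<in>E' - A - C. kp l + of_int (cone_sign bs (insert k A - {e}) l)) = R"
        unfolding R_def using k by (intro prod.cong refl) (auto simp: sign_nC)
      also have "(\<Prod>l\<in>C - {k}. kp l + of_int (cone_sign bs (insert k A - {e}) l)) = (\<Prod>l\<in>C-{k}. of_int (eps l) * (kap (w l) + of_int (sgn (phi l - phi k))))"
        using k by (intro prod.cong refl) (auto simp: sign_C kpw algebra_simps)
      finally show ?thesis .
    qed
    then have "(\<Sum>k\<in>C. of_int (tree_cycle A k e) * (\<Prod>l\<in>E' - A - {k}. kp l + of_int (cone_sign bs (insert k A - {e}) l)))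
      = (\<Sum>k\<in>C. of_int (eps k) * (R * (\<Prod>l\<in>C-{k}. of_int (eps l) * (kap (w l) + of_int (sgn (phi l - phi k))))))"
      by (intro sum.cong refl) (simp add: eps_def)
    also have "\<dots> = (\<Sum>k\<in>C. R * Pe * (\<Prod>l\<in>C-{k}. kap (w l) + of_int (sgn (phi l - phi k))))"
    proof (intro sum.cong refl)
      fix k assume k: "k \<in> C"
      have "Pe = of_int (eps k) * (\<Prod>l\<in>C-{k}. of_int (eps l))" unfolding Pe_def using finC k by (rule prod.remove)
      then show "of_int (eps k) * (R * (\<Prod>l\<in>C-{k}. of_int (eps l) * (kap (w l) + of_int (sgn (phi l - phi k)))))
        = R * Pe * (\<Prod>l\<in>C-{k}. kap (w l) + of_int (sgn (phi l - phi k)))"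
        by (simp add: prod.distrib mult_ac)
    qed
    also have "\<dots> = R * Pe * (((\<Prod>l\<in>C. kap (w l) + 1) - (\<Prod>l\<in>C. kap (w l) - 1)) / 2)"
      using sum_prod_sgn_telescope[OF finC inj, of "\<lambda>l. kap (w l)"] by (simp add: sum_distrib_left[symmetric] mult.commute)
    finally have S: "(\<Sum>k\<in>C. of_int (tree_cycle A k e) * (\<Prod>l\<in>E' - A - {k}. kp l + of_int (cone_sign bs (insert k A - {e}) l)))
      = R * Pe * (((\<Prod>l\<in>C. kap (w l) + 1) - (\<Prod>l\<in>C. kap (w l) - 1)) / 2)" .
    have "(kap (\<Sum>l\<in>C. w l) + 1) * (R * Pe * (((\<Prod>l\<in>C. kap (w l) + 1) - (\<Prod>l\<in>C. kap (w l) - 1)) / 2))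
      = R * Pe * ((kap (\<Sum>l\<in>C. w l) + 1) * ((\<Prod>l\<in>C. kap (w l) + 1) - (\<Prod>l\<in>C. kap (w l) - 1)) / 2)"
      by simp
    also have "\<dots> = R * Pe * (\<Prod>l\<in>C. kap (w l) + 1)"
      using kap_sum[OF finC Cne Imw0 ImS] by simp
    also have "\<dots> = R * (\<Prod>l\<in>C. kp l + of_int (cone_sign (e # bs) A l))"
      by (simp add: Pe_def prod.distrib[symmetric] mult.assoc)
        (intro disjI2 prod.cong refl, auto simp: sgn_C kpw algebra_simps)
    also have "\<dots> = (\<Prod>l\<in>E' - A. kp l + of_int (cone_sign (e # bs) A l))"
    proof -
      have "R = (\<Prod>l\<in>E' - A - C. kp l + of_int (cone_sign (e # bs) A l))"
        unfolding R_def by (intro prod.cong refl) (auto simp: sgn_nC)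
      then show ?thesis by (simp only: prod.subset_diff[OF CE finE])
    qed
    finally show ?thesis unfolding kapX C_def[symmetric] S .
  qed
qed

text \<open>When only the value on \<open>e\<close> varies, the tree lines on its cycle move with
  slope 1 or -1 and the others stay fixed. The residue at a pole of line \<open>k\<close> belongs to
  the tree in which \<open>e\<close> has replaced \<open>k\<close>, with \<open>k\<close> put on
  shell.\<close>

lemma
  fixes z :: "'e \<Rightarrow> real"
  assumes gen: "generic (arcs G) q" and bs: "set bs \<subseteq> arcs G - T" and e: "e \<in> arcs G - T" "e \<notin> set bs"
    and A: "A \<in> trees_in (lines bs)" and s: "s \<in> signs (lines bs - A)"
  defines "E' \<equiv> insert e (lines bs)"
  defines "f \<equiv> (\<lambda>y. 1 / ((of_real (emb y))\<^sup>2 + (of_real (q e))\<^sup>2) *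
    propagators A (extend N A (point (lines bs) s (z(e := emb y)))))"
  shows integrable_line: "integrable nu f"
    and integral_line: "(LINT y|nu. f y) = (\<Sum>k | k \<in> insert e A \<and> tree_cycle A e k \<noteq> 0. \<Sum>t\<in>{-1, 1}.
      of_real pi * \<i> * (kap (extend N (insert e A - {k}) (point E' (s(k := t)) z) e) + 1) *
      (of_int (tree_cycle A e k) / (2 * \<i> * of_int t * of_real (q k))) *
      propagators (insert e A - {k}) (extend N (insert e A - {k}) (point E' (s(k := t)) z)))"
proof -
  define E where "E = lines bs"
  have EG: "E \<subseteq> arcs G" using bs treeD(1)[OF T] by (auto simp: E_def lines_def)
  have eE: "e \<notin> E" using e by (simp add: E_def lines_def)
  have tA: "tree A" "A \<subseteq> E" using A by (simp_all add: trees_in_def E_def)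
  have AG: "A \<subseteq> arcs G" using tA EG by auto
  have finA: "finite A" by (rule finite_subset[OF AG finite_arcs])
  have eA: "e \<in> arcs G - A" using e eE tA by auto
  define pt where "pt = point E s z"
  define a where "a i = extend N A (pt(e := 0)) i" for i
  define eps where "eps i = tree_cycle A e i" for i
  have pt: "point E s (z(e := c)) = pt(e := of_real c)" for c
    using eE by (auto simp: pt_def point_def fun_eq_iff)
  have ext: "extend N A (pt(e := c)) i = a i + of_int (eps i) * c" for c i
    unfolding a_def eps_def by (rule extend_update[OF eA])
  have ae: "a e = 0" using eA by (simp add: a_def extend_cotree)
  have epse: "eps e = 1" using eA by (simp add: eps_def tree_cycle_def)
  define J where "J = {k. k \<in> insert e A \<and> eps k \<noteq> 0}"
  have J: "finite J" "J \<noteq> {}" "J \<subseteq> insert e A" using finA epse by (auto simp: J_def)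
  have eps_cases: "eps k = 1 \<or> eps k = -1" if "k \<in> J" for k
    using tree_cycle_cases[OF tA(1), of e k] eA that by (auto simp: J_def eps_def)
  define Q where "Q L x = (\<Prod>i\<in>L. 1 / ((x i)\<^sup>2 + (of_real (q i))\<^sup>2))" for L and x :: "'e \<Rightarrow> complex"
  \<comment> \<open>The propagators off the cycle do not depend on the integration variable.\<close>
  define c0 where "c0 = Q (insert e A - J) a"
  have f: "f y = c0 * (\<Prod>k\<in>J. 1 / ((a k + of_int (eps k) * of_real (emb y))\<^sup>2 + (of_real (q k))\<^sup>2))" for y
  proof -
    have "f y = Q (insert e A) (\<lambda>i. a i + of_int (eps i) * of_real (emb y))"
      using eA finA unfolding f_def E_def[symmetric] pt ext propagators_def Q_def by (simp add: ae epse)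
    also have "\<dots> = Q (insert e A - J) (\<lambda>i. a i + of_int (eps i) * of_real (emb y)) * Q J (\<lambda>i. a i + of_int (eps i) * of_real (emb y))"
      unfolding Q_def using finA by (intro prod.subset_diff[OF J(3)]) simp
    also have "Q (insert e A - J) (\<lambda>i. a i + of_int (eps i) * of_real (emb y)) = c0"
      unfolding Q_def c0_def by (intro prod.cong refl) (auto simp: J_def)
    finally show ?thesis by (simp add: Q_def)
  qed
  define p where "p k t = of_int (eps k) * (\<i> * t * of_real (q k) - a k)" for k and t :: complex
  have s1: "s l = 1 \<or> s l = -1" if "l \<in> E - A" for l using s that by (auto simp: E_def)
  \<comment> \<open>Coefficients of the \<open>q i\<close> in the imaginary part of a pole of line
    \<open>k\<close>. They lie between -1 and 1, so differences of two poles stay within the bound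
    of \<open>generic\<close>.\<close>
  define co where "co k t i = eps k * (if i = k then t else if i \<in> E - A then - tree_cycle A i k * s i else 0)" for k i :: 'e and t :: int
  have co_cases: "co k t i \<in> {-1, 0, 1}" if "k \<in> J" "t \<in> {-1, 1}" "i \<in> arcs G" for k t i
    using eps_cases[OF that(1)] that(2) s1[of i] tree_cycle_cases[OF tA(1) that(3), of k] by (auto simp: co_def)
  have Imp: "Im (p k (of_int t)) = (\<Sum>i\<in>arcs G. of_int (co k t i) * q i)" if k: "k \<in> J" for k t
  proof -
    have kG: "k \<in> arcs G" using k J(3) AG eA by auto
    have kEA: "k \<notin> E - A" using k J(3) eE by auto
    have Ima: "Im (a k) = (\<Sum>i\<in>E - A. of_int (tree_cycle A i k * s i) * q i)"
    proof (cases "k \<in> A")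
      case True
      have "a k = of_int (tree_const N A k) + (\<Sum>l\<in>arcs G - A. of_int (tree_coeff A k l) * (pt(e := 0)) l)"
        using True by (simp add: a_def extend_def)
      then have "Im (a k) = (\<Sum>l\<in>arcs G - A. of_int (tree_coeff A k l) * Im ((pt(e := 0)) l))"
        by (simp add: Im_sum)
      also have "\<dots> = (\<Sum>i\<in>E - A. of_int (tree_cycle A i k * s i) * q i)"
        using EG eE True by (intro sum.mono_neutral_cong_right) (auto simp: pt_def point_def tree_cycle_def)
      finally show ?thesis .
    next
      case False
      then have "k = e" using k J(3) by auto
      then show ?thesis using kEA False ae by (auto simp: tree_cycle_def intro!: sum.neutral)
    qed
    have "(\<Sum>i\<in>arcs G. of_int (co k t i) * q i) = (\<Sum>i\<in>arcs G. (if i = k then of_int (eps k * t) * q i else 0) +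
        (if i \<in> E - A then of_int (eps k * (- tree_cycle A i k * s i)) * q i else 0))"
      using kEA by (intro sum.cong refl) (auto simp: co_def)
    also have "\<dots> = of_int (eps k * t) * q k + (\<Sum>i\<in>arcs G. if i \<in> E - A then of_int (eps k * (- tree_cycle A i k * s i)) * q i else 0)"
      using kG by (simp add: sum.distrib)
    also have "(\<Sum>i\<in>arcs G. if i \<in> E - A then of_int (eps k * (- tree_cycle A i k * s i)) * q i else 0)
      = (\<Sum>i\<in>E - A. of_int (eps k * (- tree_cycle A i k * s i)) * q i)"
      using EG by (intro sum.mono_neutral_cong_right) auto
    also have "\<dots> = - of_int (eps k) * Im (a k)"
      unfolding Ima sum_distrib_left by (intro sum.cong refl) simp
    finally show ?thesis by (simp add: p_def algebra_simps)
  qed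
  have co_k: "co k t k = eps k * t" for k t by (simp add: co_def)
  \<comment> \<open>Only the poles of \<open>k\<close> itself involve \<open>q k\<close>, which
    separates the poles of different lines.\<close>
  have co_other: "co k' t k = 0" if "k \<in> J" "k' \<noteq> k" for k k' t
    using that J(3) eE by (auto simp: co_def)
  have kG: "k \<in> arcs G" if "k \<in> J" for k using that J(3) AG eA by auto
  have Im0: "Im (p k t) \<noteq> 0" if k: "k \<in> J" and t: "t \<in> {-1, 1}" for k t
  proof -
    obtain t' :: int where t': "t = of_int t'" "t' \<in> {-1, 1}"
      using t by (metis insert_iff of_int_1 of_int_minus singletonD)
    have "(\<Sum>i\<in>arcs G. of_int (co k t' i) * q i) \<noteq> 0"
      using co_cases[OF k t'(2)] kG[OF k] co_k[of k t'] eps_cases[OF k] t'(2)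
      by (intro genericD[OF gen, of _ k]) force+
    then show ?thesis using Imp[OF k] t'(1) by simp
  qed
  have inj: "inj_on (\<lambda>(k, t). p k t) (J \<times> {-1, 1})"
  proof (rule inj_onI, clarify)
    fix k t k' t'
    assume k: "k \<in> J" "k' \<in> J" and t: "t \<in> {-1, 1 :: complex}" "t' \<in> {-1, 1}" and eq: "p k t = p k' t'"
    obtain u u' :: int where u: "t = of_int u" "u \<in> {-1, 1}" and u': "t' = of_int u'" "u' \<in> {-1, 1}"
      using t by (metis insert_iff of_int_1 of_int_minus singletonD)
    have 0: "(\<Sum>i\<in>arcs G. of_int (co k u i - co k' u' i) * q i) = 0"
      using eq Imp[OF k(1), of u] Imp[OF k(2), of u'] by (simp add: u u' left_diff_distrib sum_subtractf)
    have bnd: "co k u i - co k' u' i \<in> {-2..2}" if "i \<in> arcs G" for i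
      using co_cases[OF k(1) u(2) that] co_cases[OF k(2) u'(2) that] by auto
    have "co k u k - co k' u' k = 0"
      using genericD[OF gen, of "\<lambda>i. co k u i - co k' u' i" k] bnd kG[OF k(1)] 0 by blast
    moreover have "co k u k \<noteq> 0" using eps_cases[OF k(1)] u(2) by (auto simp: co_k)
    ultimately have "k = k'" using co_other[OF k(1), of k' u'] by auto
    moreover have "u = u'" using \<open>co k u k - co k' u' k = 0\<close> eps_cases[OF k(1)] by (auto simp: \<open>k = k'\<close>[symmetric] co_k)
    ultimately show "k = k' \<and> t = t'" by (simp add: u u')
  qed
  have epsJ: "of_int (eps k) \<in> {-1, 1 :: complex}" if "k \<in> J" for k using eps_cases[OF that] by auto
  have int: "integrable nu (\<lambda>y. \<Prod>k\<in>J. 1 / ((a k + of_int (eps k) * of_real (emb y))\<^sup>2 + (of_real (q k))\<^sup>2))"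
    using inj Im0 unfolding p_def by (intro integrable_quadratics J(1,2) epsJ) auto
  then show "integrable nu f" unfolding f by (rule integrable_mult_right)
  have val: "(LINT y|nu. (\<Prod>k\<in>J. 1 / ((a k + of_int (eps k) * of_real (emb y))\<^sup>2 + (of_real (q k))\<^sup>2)))
    = (\<Sum>k\<in>J. \<Sum>t\<in>{-1, 1}. of_real pi * \<i> * (kap (p k t) + 1) * (of_int (eps k) / (2 * \<i> * t * of_real (q k))) *
             (\<Prod>j\<in>J-{k}. 1 / ((a j + of_int (eps j) * p k t)\<^sup>2 + (of_real (q j))\<^sup>2)))"
    using inj Im0 unfolding p_def by (intro integral_quadratics J(1,2) epsJ) auto
  \<comment> \<open>At the pole the values form a solution in which \<open>k\<close> is on shell, so
    the exchanged tree reproduces them.\<close>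
  have key: "extend N (insert e A - {k}) (point E' (s(k := t)) z) i = a i + of_int (eps i) * p k (of_int t)"
    if k: "k \<in> J" and i: "i \<in> arcs G" for k i and t :: int
  proof -
    define x where "x = extend N A (pt(e := p k (of_int t)))"
    have tA': "tree (insert e A - {k})"
      using k by (intro tree_cycle_exchange_nonzero[OF tA(1) eA]) (auto simp: J_def eps_def)
    have "extend N (insert e A - {k}) (point E' (s(k := t)) z) i = extend N (insert e A - {k}) x i"
    proof (rule extend_cong[OF _ i])
      fix l assume l: "l \<in> arcs G - (insert e A - {k})"
      show "point E' (s(k := t)) z l = x l"
      proof (cases "l = k")
        case True
        have "k \<in> E'" using k J(3) tA by (auto simp: E'_def E_def)
        moreover have "of_int (eps k) * of_int (eps k) = (1 :: complex)" using eps_cases[OF k] by auto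
        then have "x k = \<i> * of_int t * of_real (q k)"
          unfolding x_def ext p_def by (simp add: mult.assoc[symmetric])
        ultimately show ?thesis using True by (simp add: point_def)
      next
        case False
        then have "l \<noteq> e" "l \<notin> A" using l by auto
        then show ?thesis using False by (simp add: x_def extend_cotree pt_def point_def E'_def E_def)
      qed
    qed
    also have "\<dots> = x i" unfolding x_def by (rule extend_extend[OF tA(1) tA' N i])
    also have "\<dots> = a i + of_int (eps i) * p k (of_int t)" unfolding x_def by (rule ext)
    finally show ?thesis .
  qed
  have kape: "extend N (insert e A - {k}) (point E' (s(k := t)) z) e = p k (of_int t)" if "k \<in> J" for k t
    using key[OF that, of e t] eA by (simp add: ae epse)
  have props: "propagators (insert e A - {k}) (extend N (insert e A - {k}) (point E' (s(k := t)) z))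
     = c0 * (\<Prod>j\<in>J-{k}. 1 / ((a j + of_int (eps j) * p k (of_int t))\<^sup>2 + (of_real (q j))\<^sup>2))"
    if k: "k \<in> J" for k t
  proof -
    have "propagators (insert e A - {k}) (extend N (insert e A - {k}) (point E' (s(k := t)) z))
      = Q (insert e A - {k}) (\<lambda>i. a i + of_int (eps i) * p k (of_int t))"
      unfolding propagators_def Q_def using AG eA by (intro prod.cong refl) (auto simp: key[OF k] subset_iff)
    also have "\<dots> = Q (insert e A - {k} - (J - {k})) (\<lambda>i. a i + of_int (eps i) * p k (of_int t)) * Q (J - {k}) (\<lambda>i. a i + of_int (eps i) * p k (of_int t))"
      unfolding Q_def using finA J(3) by (intro prod.subset_diff) auto
    also have "insert e A - {k} - (J - {k}) = insert e A - J" using k by auto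
    also have "Q (insert e A - J) (\<lambda>i. a i + of_int (eps i) * p k (of_int t)) = c0"
      unfolding Q_def c0_def by (intro prod.cong refl) (auto simp: J_def)
    finally show ?thesis unfolding Q_def .
  qed
  have "(LINT y|nu. f y) = c0 * (\<Sum>k\<in>J. \<Sum>t\<in>{-1, 1}. of_real pi * \<i> * (kap (p k t) + 1) * (of_int (eps k) / (2 * \<i> * t * of_real (q k))) *
             (\<Prod>j\<in>J-{k}. 1 / ((a j + of_int (eps j) * p k t)\<^sup>2 + (of_real (q j))\<^sup>2)))"
    unfolding f val[symmetric] by simp
  also have "\<dots> = (\<Sum>k\<in>J. \<Sum>t\<in>{-1, 1}. of_real pi * \<i> * (kap (p k (of_int t)) + 1) * (of_int (eps k) / (2 * \<i> * of_int t * of_real (q k))) *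
             (c0 * (\<Prod>j\<in>J-{k}. 1 / ((a j + of_int (eps j) * p k (of_int t))\<^sup>2 + (of_real (q j))\<^sup>2))))"
    unfolding sum_distrib_left by (intro sum.cong refl) (simp add: algebra_simps)
  also have "\<dots> = (\<Sum>k\<in>J. \<Sum>t\<in>{-1, 1}.
      of_real pi * \<i> * (kap (extend N (insert e A - {k}) (point E' (s(k := t)) z) e) + 1) *
      (of_int (eps k) / (2 * \<i> * of_int t * of_real (q k))) *
      propagators (insert e A - {k}) (extend N (insert e A - {k}) (point E' (s(k := t)) z)))"
    by (intro sum.cong refl) (simp only: kape props)
  finally show "(LINT y|nu. f y) = (\<Sum>k | k \<in> insert e A \<and> tree_cycle A e k \<noteq> 0. \<Sum>t\<in>{-1, 1}.
      of_real pi * \<i> * (kap (extend N (insert e A - {k}) (point E' (s(k := t)) z) e) + 1) *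
      (of_int (tree_cycle A e k) / (2 * \<i> * of_int t * of_real (q k))) *
      propagators (insert e A - {k}) (extend N (insert e A - {k}) (point E' (s(k := t)) z)))"
    by (simp only: J_def eps_def)
qed

text \<open>Each induction step applies the residue formula to every tree, regroups by the exchanged
  tree and contracts the group by \<open>bracket_identity\<close>. The parameters stay in
  \<open>D\<close>, so that they remain periods of the kernel.\<close>

lemma iterated_eq_gaudin:
  assumes gen: "generic (arcs G) q" and "distinct bs" "set bs \<subseteq> arcs G - T" "\<And>l. z l \<in> D"
  shows "iterated bs z = gaudin bs z"
  using assms(2-)
proof (induction bs arbitrary: z)
  case Nil
  \<comment> \<open>By minimality \<open>T\<close> is the only spanning tree inside itself, and no
    line is on shell yet.\<close>
  have tr: "trees_in (lines []) = {T}"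
    using T tree_subset_eq[OF _ T] by (auto simp: trees_in_def lines_def)
  have "extend N T (\<lambda>i. of_real (z i)) j = extend N T (point T s z) j" if "j \<in> T" for j s
    using that treeD(1)[OF T] by (intro extend_cong) (auto simp: point_def)
  then show ?case
    unfolding gaudin_def tr by (simp add: lines_def prefactor_def propagators_def)
next
  case (Cons e bs)
  define E where "E = lines bs"
  define E' where "E' = insert e E"
  have bs: "set bs \<subseteq> arcs G - T" "distinct bs" and e: "e \<in> arcs G - T" "e \<notin> set bs"
    using Cons.prems by auto
  have EG: "E \<subseteq> arcs G" and eE: "e \<notin> E" and eG: "e \<in> arcs G" using bs e treeD(1)[OF T] by (auto simp: E_def lines_def)
  have E'G: "E' \<subseteq> arcs G" using EG eG by (auto simp: E'_def)
  have finE: "finite E" by (rule finite_subset[OF EG finite_arcs])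
  have E'l: "E' = lines (e # bs)" by (simp add: E'_def E_def lines_def)
  define kp where "kp s l = kap (\<i> * of_int (s l) * of_real (q l))" for s :: "'e \<Rightarrow> int" and l
  define W where "W A s = prefactor (E - A) s * (\<Prod>l\<in>E - A. kp s l + of_int (cone_sign bs A l))" for A s
  define x where "x A s = extend N A (point E' s z)" for A s
  define h where "h A k s = W A s * (of_real pi * \<i> * (kap (x (insert e A - {k}) s e) + 1) *
      (of_int (tree_cycle A e k) / (2 * \<i> * of_int (s k) * of_real (q k))) *
      propagators (insert e A - {k}) (x (insert e A - {k}) s))" for A k s
  have "iterated (e # bs) z = (LINT y|nu. 1 / ((of_real (emb y))\<^sup>2 + (of_real (q e))\<^sup>2) * gaudin bs (z(e := emb y)))"
  proof -
    have "(z(e := emb y)) l \<in> D" for y l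
      using Cons.prems(3)[of l] emb_in[of y] by (cases "l = e") simp_all
    then have eq: "iterated bs (z(e := emb y)) = gaudin bs (z(e := emb y))" for y
      by (rule Cons.IH[OF bs(2,1)])
    show ?thesis unfolding iterated.simps(2) eq ..
  qed
  also have "\<dots> = (LINT y|nu. (\<Sum>A\<in>trees_in E. \<Sum>s\<in>signs (E - A). W A s *
      (1 / ((of_real (emb y))\<^sup>2 + (of_real (q e))\<^sup>2) * propagators A (extend N A (point E s (z(e := emb y)))))))"
    unfolding gaudin_def sum_distrib_left W_def E_def kp_def
    by (intro Bochner_Integration.integral_cong refl sum.cong) simp
  also have "\<dots> = (\<Sum>A\<in>trees_in E. \<Sum>s\<in>signs (E - A). W A s * (LINT y|nu.
      1 / ((of_real (emb y))\<^sup>2 + (of_real (q e))\<^sup>2) * propagators A (extend N A (point E s (z(e := emb y))))))"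
  proof -
    have int: "integrable nu (\<lambda>y. W A s *
      (1 / ((of_real (emb y))\<^sup>2 + (of_real (q e))\<^sup>2) * propagators A (extend N A (point E s (z(e := emb y))))))"
      if "A \<in> trees_in E" "s \<in> signs (E - A)" for A s
      using that unfolding E_def by (intro integrable_mult_right integrable_line[OF gen bs(1) e])
    show ?thesis
      by (subst Bochner_Integration.integral_sum, intro Bochner_Integration.integrable_sum int, assumption+,
          intro sum.cong refl, subst Bochner_Integration.integral_sum, rule int, assumption+,
          intro sum.cong refl integral_mult_right_zero)
  qed
  also have "\<dots> = (\<Sum>A\<in>trees_in E. \<Sum>s\<in>signs (E - A). \<Sum>k | k \<in> insert e A \<and> tree_cycle A e k \<noteq> 0. \<Sum>t\<in>{-1, 1}. h A k (s(k := t)))"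
  proof (intro sum.cong refl)
    fix A s assume A: "A \<in> trees_in E" and s: "s \<in> signs (E - A)"
    \<comment> \<open>The earlier factors concern only lines of \<open>E - A\<close>; hence the sign
      of the new pole can be stored in the sign vector at \<open>k\<close>.\<close>
    have Wk: "W A (s(k := t)) = W A s" if "k \<in> insert e A" for k t
    proof -
      have "k \<notin> E - A" using that eE by auto
      then show ?thesis unfolding W_def prefactor_def kp_def
        by (intro arg_cong2[where f = "(*)"] prod.cong refl) auto
    qed
    show "W A s * (LINT y|nu.
      1 / ((of_real (emb y))\<^sup>2 + (of_real (q e))\<^sup>2) * propagators A (extend N A (point E s (z(e := emb y)))))
      = (\<Sum>k | k \<in> insert e A \<and> tree_cycle A e k \<noteq> 0. \<Sum>t\<in>{-1, 1}. h A k (s(k := t)))"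
      unfolding E_def integral_line[OF gen bs(1) e A[unfolded E_def] s[unfolded E_def]]
      unfolding sum_distrib_left
    proof (rule sum.cong[OF refl], rule sum.cong[OF refl])
      fix k t assume "k \<in> {k. k \<in> insert e A \<and> tree_cycle A e k \<noteq> 0}"
      then have "W A (s(k := t)) = W A s" by (intro Wk) simp
      then show "W A s * (of_real pi * \<i> * (kap (extend N (insert e A - {k}) (point (insert e (lines bs)) (s(k := t)) z) e) + 1) *
        (of_int (tree_cycle A e k) / (2 * \<i> * of_int t * of_real (q k))) *
        propagators (insert e A - {k}) (extend N (insert e A - {k}) (point (insert e (lines bs)) (s(k := t)) z))) = h A k (s(k := t))"
        by (simp only: h_def x_def E'_def E_def fun_upd_same)
    qed
  qed
  also have "\<dots> = (\<Sum>A\<in>trees_in E. \<Sum>k | k \<in> insert e A \<and> tree_cycle A e k \<noteq> 0. \<Sum>s\<in>signs (insert k (E - A)). h A k s)"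
  proof (rule sum.cong[OF refl])
    fix A
    show "(\<Sum>s\<in>signs (E - A). \<Sum>k | k \<in> insert e A \<and> tree_cycle A e k \<noteq> 0. \<Sum>t\<in>{-1, 1}. h A k (s(k := t)))
      = (\<Sum>k | k \<in> insert e A \<and> tree_cycle A e k \<noteq> 0. \<Sum>s\<in>signs (insert k (E - A)). h A k s)"
    proof (subst sum.swap, rule sum.cong[OF refl])
      fix k assume "k \<in> {k. k \<in> insert e A \<and> tree_cycle A e k \<noteq> 0}"
      then have "k \<notin> E - A" using eE by auto
      then show "(\<Sum>s\<in>signs (E - A). \<Sum>t\<in>{-1, 1}. h A k (s(k := t))) = (\<Sum>s\<in>signs (insert k (E - A)). h A k s)"
        by (rule sum_PiE_insert)
    qed
  qed
  \<comment> \<open>From here on the tree obtained after the exchange indexes the outer sum.\<close>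
  also have "\<dots> = (\<Sum>A\<in>trees_in E'. \<Sum>k | k \<in> E' - A \<and> tree_cycle A k e \<noteq> 0.
      \<Sum>s\<in>signs (insert k (E - (insert k A - {e}))). h (insert k A - {e}) k s)"
    unfolding E'_def by (rule sum_trees_in_exchange[OF EG eG eE])
  also have "\<dots> = (\<Sum>A\<in>trees_in E'. \<Sum>s\<in>signs (E' - A). prefactor (E' - A) s *
      ((kap (x A s e) + 1) * (\<Sum>k | k \<in> E' - A \<and> tree_cycle A k e \<noteq> 0. of_int (tree_cycle A k e) *
        (\<Prod>l\<in>E' - A - {k}. kp s l + of_int (cone_sign bs (insert k A - {e}) l)))) * propagators A (x A s))"
  proof (rule sum.cong[OF refl])
    fix A assume A: "A \<in> trees_in E'"
    have tA: "tree A" "A \<subseteq> E'" using A by (simp_all add: trees_in_def)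
    have "(\<Sum>k | k \<in> E' - A \<and> tree_cycle A k e \<noteq> 0. \<Sum>s\<in>signs (insert k (E - (insert k A - {e}))). h (insert k A - {e}) k s)
      = (\<Sum>k | k \<in> E' - A \<and> tree_cycle A k e \<noteq> 0. \<Sum>s\<in>signs (E' - A). prefactor (E' - A) s *
      ((kap (x A s e) + 1) * (of_int (tree_cycle A k e) *
        (\<Prod>l\<in>E' - A - {k}. kp s l + of_int (cone_sign bs (insert k A - {e}) l)))) * propagators A (x A s))"
    proof (rule sum.cong[OF refl])
      fix k assume "k \<in> {k. k \<in> E' - A \<and> tree_cycle A k e \<noteq> 0}"
      then have k: "k \<in> E'" "k \<notin> A" "tree_cycle A k e \<noteq> 0" by auto
      have kG: "k \<in> arcs G - A" using k E'G by auto
      have eA: "e \<in> insert k A" using k(3) by (auto simp: tree_cycle_def split: if_splits)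
      have S: "insert k (E - (insert k A - {e})) = E' - A" "E - (insert k A - {e}) = E' - A - {k}"
        and A': "insert e (insert k A - {e}) - {k} = A"
        using k eA eE by (auto simp: E'_def)
      have cyc: "tree_cycle (insert k A - {e}) e k = tree_cycle A k e"
        by (rule tree_cycle_exchange_nonzero(2)[OF tA(1) kG eA k(3)])
      \<comment> \<open>The residue of the new pole is just the factor of \<open>k\<close> that
        completes the prefactor of the new tree.\<close>
      have "prefactor (E' - A) s = of_real pi * \<i> / (2 * \<i> * of_int (s k) * of_real (q k)) * prefactor (E' - A - {k}) s" for s
        unfolding prefactor_def using k finE by (intro prod.remove) (auto simp: E'_def)
      then show "(\<Sum>s\<in>signs (insert k (E - (insert k A - {e}))). h (insert k A - {e}) k s)
        = (\<Sum>s\<in>signs (E' - A). prefactor (E' - A) s *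
      ((kap (x A s e) + 1) * (of_int (tree_cycle A k e) *
        (\<Prod>l\<in>E' - A - {k}. kp s l + of_int (cone_sign bs (insert k A - {e}) l)))) * propagators A (x A s))"
      proof (intro sum.cong)
        show "signs (insert k (E - (insert k A - {e}))) = signs (E' - A)" by (simp only: S(1))
        fix s
        assume pre: "\<And>s. prefactor (E' - A) s = of_real pi * \<i> / (2 * \<i> * of_int (s k) * of_real (q k)) * prefactor (E' - A - {k}) s"
        show "h (insert k A - {e}) k s = prefactor (E' - A) s *
      ((kap (x A s e) + 1) * (of_int (tree_cycle A k e) *
        (\<Prod>l\<in>E' - A - {k}. kp s l + of_int (cone_sign bs (insert k A - {e}) l)))) * propagators A (x A s)"
          unfolding h_def W_def S(2) A' cyc pre by (simp add: mult_ac)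
      qed
    qed
    also have "\<dots> = (\<Sum>s\<in>signs (E' - A). prefactor (E' - A) s *
      ((kap (x A s e) + 1) * (\<Sum>k | k \<in> E' - A \<and> tree_cycle A k e \<noteq> 0. of_int (tree_cycle A k e) *
        (\<Prod>l\<in>E' - A - {k}. kp s l + of_int (cone_sign bs (insert k A - {e}) l)))) * propagators A (x A s))"
      by (subst sum.swap) (simp only: sum_distrib_left sum_distrib_right)
    finally show "(\<Sum>k | k \<in> E' - A \<and> tree_cycle A k e \<noteq> 0. \<Sum>s\<in>signs (insert k (E - (insert k A - {e}))). h (insert k A - {e}) k s)
      = (\<Sum>s\<in>signs (E' - A). prefactor (E' - A) s *
      ((kap (x A s e) + 1) * (\<Sum>k | k \<in> E' - A \<and> tree_cycle A k e \<noteq> 0. of_int (tree_cycle A k e) *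
        (\<Prod>l\<in>E' - A - {k}. kp s l + of_int (cone_sign bs (insert k A - {e}) l)))) * propagators A (x A s))" .
  qed
  also have "\<dots> = (\<Sum>A\<in>trees_in E'. \<Sum>s\<in>signs (E' - A). prefactor (E' - A) s *
      (\<Prod>l\<in>E' - A. kp s l + of_int (cone_sign (e # bs) A l)) * propagators A (x A s))"
  proof (intro sum.cong refl)
    fix A s assume "A \<in> trees_in E'" "s \<in> signs (E' - A)"
    then have "(kap (x A s e) + 1) * (\<Sum>k | k \<in> E' - A \<and> tree_cycle A k e \<noteq> 0. of_int (tree_cycle A k e) *
        (\<Prod>l\<in>E' - A - {k}. kp s l + of_int (cone_sign bs (insert k A - {e}) l)))
        = (\<Prod>l\<in>E' - A. kp s l + of_int (cone_sign (e # bs) A l))"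
      unfolding x_def kp_def E'_def E_def using Cons.prems(3)
      by (intro bracket_identity[OF gen bs(1) e])
    then show "prefactor (E' - A) s *
      ((kap (x A s e) + 1) * (\<Sum>k | k \<in> E' - A \<and> tree_cycle A k e \<noteq> 0. of_int (tree_cycle A k e) *
        (\<Prod>l\<in>E' - A - {k}. kp s l + of_int (cone_sign bs (insert k A - {e}) l)))) * propagators A (x A s)
      = prefactor (E' - A) s * (\<Prod>l\<in>E' - A. kp s l + of_int (cone_sign (e # bs) A l)) * propagators A (x A s)"
      by (simp only:)
  qed
  also have "\<dots> = gaudin (e # bs) z"
    unfolding gaudin_def E'l[symmetric] kp_def x_def ..
  finally show ?case .
qed

end

subsection \<open>Iterated integrals and amplitudes\<close>

text \<open>Fubini with the inserted coordinate outermost, which is the order used by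
  \<open>iterated\<close>.\<close>

lemma (in product_sigma_finite) product_integral_insert_rev:
  fixes f :: "_ \<Rightarrow> _::{banach, second_countable_topology}"
  assumes I: "finite I" "i \<notin> I" and f: "integrable (Pi\<^sub>M (insert i I) M) f"
  shows "integral\<^sup>L (Pi\<^sub>M (insert i I) M) f = (\<integral>c. (\<integral>x. f (x(i := c)) \<partial>Pi\<^sub>M I M) \<partial>M i)"
proof -
  interpret I: finite_product_sigma_finite M I by standard fact
  have [measurable]: "f \<in> borel_measurable (Pi\<^sub>M (insert i I) M)" using f by auto
  have [measurable]: "(\<lambda>p. (snd p)(i := fst p)) \<in> M i \<Otimes>\<^sub>M Pi\<^sub>M I M \<rightarrow>\<^sub>M Pi\<^sub>M (insert i I) M"
    by (rule measurable_fun_upd[where J = I]) auto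
  have g: "(\<lambda>c. \<integral>x. f (x(i := c)) \<partial>Pi\<^sub>M I M) \<in> borel_measurable (M i)"
  proof (rule I.borel_measurable_lebesgue_integral)
    have "(\<lambda>p. f ((snd p)(i := fst p))) \<in> borel_measurable (M i \<Otimes>\<^sub>M Pi\<^sub>M I M)" by measurable
    then show "(\<lambda>(c, x). f (x(i := c))) \<in> borel_measurable (M i \<Otimes>\<^sub>M Pi\<^sub>M I M)" by (simp add: case_prod_unfold)
  qed
  have "integral\<^sup>L (Pi\<^sub>M (insert i I) M) f = integral\<^sup>L (Pi\<^sub>M ({i} \<union> I) M) f" by simp
  also have "\<dots> = (\<integral>x. (\<integral>y. f (merge {i} I (x, y)) \<partial>Pi\<^sub>M I M) \<partial>Pi\<^sub>M {i} M)"
    using f I by (intro product_integral_fold) auto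
  also have "\<dots> = (\<integral>x. (\<integral>y. f (y(i := x i)) \<partial>Pi\<^sub>M I M) \<partial>Pi\<^sub>M {i} M)"
  proof (intro Bochner_Integration.integral_cong refl arg_cong[where f = f] ext)
    fix x y k assume "x \<in> space (Pi\<^sub>M {i} M)" "y \<in> space (Pi\<^sub>M I M)"
    then show "merge {i} I (x, y) k = (y(i := x i)) k"
      by (auto simp: merge_def space_PiM PiE_def extensional_def)
  qed
  also have "\<dots> = (\<integral>c. (\<integral>x. f (x(i := c)) \<partial>Pi\<^sub>M I M) \<partial>M i)"
    using product_integral_singleton[OF g] by simp
  finally show ?thesis .
qed

context matsubara_graph
begin

lemma extend_of_real: "extend N A (\<lambda>i. of_real (y i) :: complex) j = of_real (extend N A y j)"
  by (simp add: extend_def)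

lemma extend_of_int: "extend N A (\<lambda>i. real_of_int (y i)) j = of_int (extend N A y j)"
  by (simp add: extend_def)

definition weight :: "('v \<Rightarrow> int) \<Rightarrow> 'e set \<Rightarrow> ('e \<Rightarrow> real) \<Rightarrow> ('e \<Rightarrow> real) \<Rightarrow> real" where
  "weight N A q y = (\<Prod>i\<in>arcs G. 1 / ((extend N A y i)\<^sup>2 + (q i)\<^sup>2))"

lemma weight_cong:
  assumes "\<And>l. l \<in> arcs G - A \<Longrightarrow> y l = y' l"
  shows "weight N A q y = weight N A q y'"
  unfolding weight_def
proof (rule prod.cong[OF refl])
  fix i assume "i \<in> arcs G"
  then have "extend N A y i = extend N A y' i" by (intro extend_cong assms)
  then show "1 / ((extend N A y i)\<^sup>2 + (q i)\<^sup>2) = 1 / ((extend N A y' i)\<^sup>2 + (q i)\<^sup>2)" by (simp only:)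
qed

end

definition overwrite :: "('a \<Rightarrow> real) \<Rightarrow> 'e set \<Rightarrow> ('e \<Rightarrow> 'a) \<Rightarrow> ('e \<Rightarrow> real) \<Rightarrow> 'e \<Rightarrow> real" where
  "overwrite emb S y z l = (if l \<in> S then emb (y l) else z l)"

context matsubara_kernel
begin

lemma product_sigma_finite_nu: "product_sigma_finite (\<lambda>_. nu)"
  by (simp add: product_sigma_finite_def sigma_finite_nu)

definition partial_weight :: "'e set \<Rightarrow> ('e \<Rightarrow> real) \<Rightarrow> real" where
  "partial_weight S x = (\<Prod>b\<in>S. 1 / ((x b)\<^sup>2 + (q b)\<^sup>2)) * (\<Prod>j\<in>T. 1 / ((extend N T x j)\<^sup>2 + (q j)\<^sup>2))"

text \<open>The propagators of tree lines are bounded by 1/q^2; what remains is a product of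
  Lorentzians in separate variables.\<close>

lemma integrable_partial_weight:
  assumes q: "\<And>i. i \<in> arcs G \<Longrightarrow> q i \<noteq> 0" and S: "S \<subseteq> arcs G - T"
  shows "integrable (Pi\<^sub>M S (\<lambda>_. nu)) (\<lambda>y. partial_weight S (overwrite emb S y z))"
proof -
  interpret product_sigma_finite "\<lambda>_. nu" by (rule product_sigma_finite_nu)
  have finS: "finite S" by (rule finite_subset[OF S]) simp
  have TG: "T \<subseteq> arcs G" by (rule treeD[OF T])
  define C where "C = (\<Prod>j\<in>T. 1 / (q j)\<^sup>2)"
  have ow: "(\<lambda>y. overwrite emb S y z l) \<in> borel_measurable (Pi\<^sub>M S (\<lambda>_. nu))" for l
    unfolding overwrite_def by (cases "l \<in> S") auto
  have ex: "(\<lambda>y. extend N T (overwrite emb S y z) j) \<in> borel_measurable (Pi\<^sub>M S (\<lambda>_. nu))" for j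
    unfolding extend_def by (intro borel_measurable_if_I borel_measurable_add borel_measurable_sum borel_measurable_times borel_measurable_const ow measurable_If) auto
  have int: "integrable (Pi\<^sub>M S (\<lambda>_. nu)) (\<lambda>y. C * (\<Prod>b\<in>S. 1 / ((emb (y b))\<^sup>2 + (q b)\<^sup>2)))"
    using S q integrable_lorentz[of _ 0] finS
    by (intro integrable_mult_right product_integrable_prod) auto
  show ?thesis
  proof (rule Bochner_Integration.integrable_bound[OF int])
    show "(\<lambda>y. partial_weight S (overwrite emb S y z)) \<in> borel_measurable (Pi\<^sub>M S (\<lambda>_. nu))"
      unfolding partial_weight_def
      by (intro borel_measurable_times borel_measurable_prod borel_measurable_divide borel_measurable_const
          borel_measurable_add borel_measurable_power ow ex)
    show "AE y in Pi\<^sub>M S (\<lambda>_. nu). norm (partial_weight S (overwrite emb S y z))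
      \<le> norm (C * (\<Prod>b\<in>S. 1 / ((emb (y b))\<^sup>2 + (q b)\<^sup>2)))"
    proof (rule AE_I2)
      fix y
      define P where "P = (\<Prod>b\<in>S. 1 / ((emb (y b))\<^sup>2 + (q b)\<^sup>2))"
      have P: "P \<ge> 0" by (auto simp: P_def intro!: prod_nonneg)
      have "(\<Prod>j\<in>T. 1 / ((extend N T (overwrite emb S y z) j)\<^sup>2 + (q j)\<^sup>2)) \<le> C"
        unfolding C_def using q TG by (intro prod_mono) (auto intro!: frac_le)
      then have "P * (\<Prod>j\<in>T. 1 / ((extend N T (overwrite emb S y z) j)\<^sup>2 + (q j)\<^sup>2)) \<le> P * C"
        using P by (rule mult_left_mono)
      moreover have "partial_weight S (overwrite emb S y z) = P * (\<Prod>j\<in>T. 1 / ((extend N T (overwrite emb S y z) j)\<^sup>2 + (q j)\<^sup>2))"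
        unfolding partial_weight_def P_def by (simp add: overwrite_def)
      moreover have "(\<Prod>j\<in>T. 1 / ((extend N T (overwrite emb S y z) j)\<^sup>2 + (q j)\<^sup>2)) \<ge> 0"
        by (intro prod_nonneg) auto
      moreover have "C \<ge> 0" unfolding C_def by (intro prod_nonneg) auto
      ultimately show "norm (partial_weight S (overwrite emb S y z)) \<le> norm (C * (\<Prod>b\<in>S. 1 / ((emb (y b))\<^sup>2 + (q b)\<^sup>2)))"
        using P by (simp add: P_def[symmetric] mult.commute abs_mult)
    qed
  qed
qed

lemma iterated_eq_integral:
  assumes q: "\<And>i. i \<in> arcs G \<Longrightarrow> q i \<noteq> 0" and "distinct bs" "set bs \<subseteq> arcs G - T"
  shows "iterated bs z = of_real (LINT y|Pi\<^sub>M (set bs) (\<lambda>_. nu). partial_weight (set bs) (overwrite emb (set bs) y z))"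
  using assms(2-)
proof (induction bs arbitrary: z)
  case Nil
  have "overwrite emb {} y z = z" for y by (simp add: overwrite_def fun_eq_iff)
  then show ?case
    by (simp add: partial_weight_def extend_of_real PiM_empty lebesgue_integral_count_space_finite)
next
  case (Cons e bs)
  interpret product_sigma_finite "\<lambda>_. nu" by (rule product_sigma_finite_nu)
  have bs: "distinct bs" "set bs \<subseteq> arcs G - T" and e: "e \<notin> set bs" using Cons.prems by auto
  have ow: "overwrite emb (insert e (set bs)) (y(e := c)) z = overwrite emb (set bs) y (z(e := emb c))" for y c
    using e by (auto simp: overwrite_def fun_eq_iff)
  have pw: "partial_weight (insert e (set bs)) (overwrite emb (set bs) y (z(e := emb c)))
    = 1 / ((emb c)\<^sup>2 + (q e)\<^sup>2) * partial_weight (set bs) (overwrite emb (set bs) y (z(e := emb c)))" for y c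
    using e by (simp add: partial_weight_def) (simp add: overwrite_def)
  have "(LINT y|Pi\<^sub>M (insert e (set bs)) (\<lambda>_. nu). partial_weight (insert e (set bs)) (overwrite emb (insert e (set bs)) y z))
    = (LINT c|nu. LINT y|Pi\<^sub>M (set bs) (\<lambda>_. nu). partial_weight (insert e (set bs)) (overwrite emb (insert e (set bs)) (y(e := c)) z))"
    using Cons.prems by (intro product_integral_insert_rev integrable_partial_weight q) auto
  also have "\<dots> = (LINT c|nu. 1 / ((emb c)\<^sup>2 + (q e)\<^sup>2) *
      (LINT y|Pi\<^sub>M (set bs) (\<lambda>_. nu). partial_weight (set bs) (overwrite emb (set bs) y (z(e := emb c)))))"
    unfolding ow pw by (simp only: integral_mult_right_zero)
  finally have "of_real (LINT y|Pi\<^sub>M (insert e (set bs)) (\<lambda>_. nu). partial_weight (insert e (set bs)) (overwrite emb (insert e (set bs)) y z))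
    = (LINT c|nu. complex_of_real (1 / ((emb c)\<^sup>2 + (q e)\<^sup>2) *
      (LINT y|Pi\<^sub>M (set bs) (\<lambda>_. nu). partial_weight (set bs) (overwrite emb (set bs) y (z(e := emb c))))))"
    by (simp only: integral_complex_of_real)
  also have "\<dots> = iterated (e # bs) z"
    unfolding iterated.simps(2) Cons.IH[OF bs]
    by (simp only: of_real_mult of_real_divide of_real_add of_real_power of_real_1)
  finally show ?case by simp
qed

lemma weight_eq_partial_weight: "weight N T q x = partial_weight (arcs G - T) x"
proof -
  have "weight N T q x = (\<Prod>i\<in>arcs G - T. 1 / ((extend N T x i)\<^sup>2 + (q i)\<^sup>2)) * (\<Prod>j\<in>T. 1 / ((extend N T x j)\<^sup>2 + (q j)\<^sup>2))"
    unfolding weight_def by (rule prod.subset_diff[OF treeD(1)[OF T]]) simp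
  also have "(\<Prod>i\<in>arcs G - T. 1 / ((extend N T x i)\<^sup>2 + (q i)\<^sup>2)) = (\<Prod>i\<in>arcs G - T. 1 / ((x i)\<^sup>2 + (q i)\<^sup>2))"
    by (intro prod.cong) (auto simp: extend_cotree)
  finally show ?thesis by (simp add: partial_weight_def)
qed

lemma integrable_weight:
  assumes "\<And>i. i \<in> arcs G \<Longrightarrow> q i \<noteq> 0"
  shows "integrable (Pi\<^sub>M (arcs G - T) (\<lambda>_. nu)) (\<lambda>y. weight N T q (\<lambda>l. emb (y l)))"
proof -
  have "weight N T q (\<lambda>l. emb (y l)) = weight N T q (overwrite emb (arcs G - T) y (\<lambda>_. 0))" for y
    by (rule weight_cong) (simp add: overwrite_def)
  then show ?thesis using integrable_partial_weight[OF assms order.refl] by (simp add: weight_eq_partial_weight)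
qed

lemma iterated_eq_weight_integral:
  assumes "\<And>i. i \<in> arcs G \<Longrightarrow> q i \<noteq> 0" "distinct bs" "set bs = arcs G - T"
  shows "iterated bs z = of_real (LINT y|Pi\<^sub>M (arcs G - T) (\<lambda>_. nu). weight N T q (\<lambda>l. emb (y l)))"
proof -
  have "weight N T q (\<lambda>l. emb (y l)) = partial_weight (arcs G - T) (overwrite emb (arcs G - T) y z)" for y
    unfolding weight_eq_partial_weight[symmetric] by (rule weight_cong) (simp add: overwrite_def)
  then show ?thesis using iterated_eq_integral[OF assms(1,2)] assms(3) by simp
qed

end

section \<open>Tree amplitudes and their reflections\<close>

definition flip :: "'e set \<Rightarrow> ('e \<Rightarrow> real) \<Rightarrow> 'e \<Rightarrow> real" where
  "flip B q i = (if i \<in> B then - q i else q i)"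

context matsubara_graph
begin

text \<open>The contribution of a tree \<open>A\<close> to the integral: all lines outside \<open>A\<close> are put on shell,
  on the side given by the sign vector \<open>sg\<close>.\<close>

definition amplitude :: "('v \<Rightarrow> int) \<Rightarrow> ('e \<Rightarrow> int) \<Rightarrow> 'e set \<Rightarrow> ('e \<Rightarrow> real) \<Rightarrow> complex" where
  "amplitude N sg A q = (\<Prod>l\<in>arcs G - A. of_real (pi / q l)) *
     (\<Prod>j\<in>A. 1 / ((extend N A (\<lambda>l. \<i> * of_int (sg l) * of_real (q l)) j)\<^sup>2 + (of_real (q j))\<^sup>2))"

text \<open>On tree lines \<open>extend\<close> reads only values off the tree, so
  \<open>q i\<close> for \<open>i\<close> in \<open>A\<close> enters through its square
  alone.\<close>

lemma amplitude_even:
  assumes "A \<subseteq> arcs G" "i \<in> A"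
  shows "amplitude N sg A (q(i := - q i)) = amplitude N sg A q"
proof -
  have "(\<Prod>l\<in>arcs G - A. complex_of_real (pi / (q(i := - q i)) l)) = (\<Prod>l\<in>arcs G - A. of_real (pi / q l))"
    using assms(2) by (intro prod.cong) auto
  moreover have "extend N A (\<lambda>l. \<i> * of_int (sg l) * of_real ((q(i := - q i)) l)) j = extend N A (\<lambda>l. \<i> * of_int (sg l) * of_real (q l)) j"
    if "j \<in> A" for j
    using that assms by (intro extend_cong) auto
  ultimately show ?thesis unfolding amplitude_def
    by (simp cong: prod.cong) (intro disjI2 prod.cong refl, auto)
qed

end

context matsubara_kernel
begin

text \<open>A sign vector is recorded by the set \<open>B\<close> of lines where it differs from the
  cone sign. The kernel factor is then 2 sg (1 + n) off \<open>B\<close> and -2 sg n on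
  \<open>B\<close>. Reflecting \<open>q\<close> on \<open>B\<close> gives the on-shell values of the
  sign vector, and the signs from pi/q are compensated by the power of -1.\<close>

lemma gaudin_eq_amplitudes:
  fixes n :: "'e \<Rightarrow> real"
  assumes gen: "generic (arcs G) q" and bs: "set bs = arcs G - T"
    and kap: "\<And>l s. l \<in> arcs G \<Longrightarrow> s \<in> {-1, 1} \<Longrightarrow> kap (\<i> * of_int s * of_real (q l)) = of_int s * of_real (1 + 2 * n l)"
  shows "gaudin bs z = (\<Sum>A\<in>trees_in (arcs G). \<Sum>B\<in>Pow (arcs G - A).
    of_real ((\<Prod>l\<in>B. n l) * (\<Prod>l\<in>arcs G - A - B. 1 + n l)) * ((-1) ^ card B * amplitude N (cone_sign bs A) A (flip B q)))"
proof -
  have L: "lines bs = arcs G" using bs treeD(1)[OF T] by (auto simp: lines_def)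
  have "(\<Sum>s\<in>signs (arcs G - A). prefactor (arcs G - A) s *
      (\<Prod>l\<in>arcs G - A. kap (\<i> * of_int (s l) * of_real (q l)) + of_int (cone_sign bs A l)) *
      propagators A (extend N A (point (arcs G) s z)))
    = (\<Sum>B\<in>Pow (arcs G - A). of_real ((\<Prod>l\<in>B. n l) * (\<Prod>l\<in>arcs G - A - B. 1 + n l)) * ((-1) ^ card B * amplitude N (cone_sign bs A) A (flip B q)))"
    if A: "A \<in> trees_in (arcs G)" for A
  proof -
    define C where "C = arcs G - A"
    define sg where "sg l = cone_sign bs A l" for l
    have finC: "finite C" by (simp add: C_def)
    have q0: "q l \<noteq> 0" if "l \<in> C" for l using generic_nonzero[OF gen] that by (simp add: C_def)
    have sg: "sg l = 1 \<or> sg l = -1" if "l \<in> C" for l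
      using ternary_value_tree_cycle_nonzero[of bs A l] A that bs unfolding L
      by (auto simp: sg_def cone_sign_def C_def sgn_if)
    define sB where "sB B = (\<lambda>l\<in>C. if l \<in> B then - sg l else sg l)" for B
    have "bij_betw sB (Pow C) (signs C)"
    proof (rule bij_betwI[where g = "\<lambda>s. {l \<in> C. s l \<noteq> sg l}"])
      show "sB \<in> Pow C \<rightarrow> signs C" using sg by (fastforce simp: sB_def)
      show "(\<lambda>s. {l \<in> C. s l \<noteq> sg l}) \<in> signs C \<rightarrow> Pow C" by auto
      show "{l \<in> C. sB B l \<noteq> sg l} = B" if "B \<in> Pow C" for B
        using that sg by (force simp: sB_def)
      show "sB {l \<in> C. s l \<noteq> sg l} = s" if s: "s \<in> signs C" for s
      proof
        fix l
        show "sB {l \<in> C. s l \<noteq> sg l} l = s l"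
        proof (cases "l \<in> C")
          case True
          then have "s l = 1 \<or> s l = -1" using s by auto
          then show ?thesis using sg[OF True] True by (auto simp: sB_def)
        next
          case False
          then show ?thesis using s by (auto simp: sB_def PiE_def extensional_def)
        qed
      qed
    qed
    then have "(\<Sum>s\<in>signs C. prefactor C s * (\<Prod>l\<in>C. kap (\<i> * of_int (s l) * of_real (q l)) + of_int (sg l)) *
        propagators A (extend N A (point (arcs G) s z)))
      = (\<Sum>B\<in>Pow C. prefactor C (sB B) * (\<Prod>l\<in>C. kap (\<i> * of_int (sB B l) * of_real (q l)) + of_int (sg l)) *
        propagators A (extend N A (point (arcs G) (sB B) z)))"
      by (rule sum.reindex_bij_betw[symmetric])
    also have "\<dots> = (\<Sum>B\<in>Pow C. of_real ((\<Prod>l\<in>B. n l) * (\<Prod>l\<in>C - B. 1 + n l)) * ((-1) ^ card B * amplitude N sg A (flip B q)))"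
    proof (rule sum.cong[OF refl])
      fix B assume "B \<in> Pow C"
      then have B: "B \<subseteq> C" by simp
      have finB: "finite B" using finite_subset[OF B finC] .
      have "prefactor C (sB B) * (\<Prod>l\<in>C. kap (\<i> * of_int (sB B l) * of_real (q l)) + of_int (sg l))
         = (\<Prod>l\<in>C. of_real ((if l \<in> B then n l else 1 + n l) * (pi / q l)))"
        unfolding prefactor_def prod.distrib[symmetric]
      proof (rule prod.cong[OF refl])
        fix l assume l: "l \<in> C"
        have sBl: "sB B l \<in> {-1, 1}" using sg[OF l] l by (auto simp: sB_def)
        have lG: "l \<in> arcs G" using l by (simp add: C_def)
        have c: "\<i> * x / (2 * (\<i> * y)) = x / (2 * y)" for x y :: complex by simp
        show "of_real pi * \<i> / (2 * \<i> * of_int (sB B l) * of_real (q l)) * (kap (\<i> * of_int (sB B l) * of_real (q l)) + of_int (sg l))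
           = of_real ((if l \<in> B then n l else 1 + n l) * (pi / q l))"
          unfolding kap[OF lG sBl]
          using sg[OF l] q0[OF l] l by (auto simp: sB_def field_simps)
      qed
      also have "\<dots> = of_real (\<Prod>l\<in>C. (if l \<in> B then n l else 1 + n l)) * (\<Prod>l\<in>C. of_real (pi / q l))"
        by (simp only: of_real_mult prod.distrib of_real_prod)
      also have "(\<Prod>l\<in>C. (if l \<in> B then n l else 1 + n l)) = (\<Prod>l\<in>B. n l) * (\<Prod>l\<in>C - B. 1 + n l)"
        by (subst prod.subset_diff[OF B finC]) (simp add: mult.commute)
      also have "(\<Prod>l\<in>C. complex_of_real (pi / q l)) = (-1) ^ card B * (\<Prod>l\<in>C. of_real (pi / flip B q l))"
      proof -
        have "(\<Prod>l\<in>C. complex_of_real (pi / flip B q l)) = (\<Prod>l\<in>C. (if l \<in> B then -1 else 1) * of_real (pi / q l))"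
          by (intro prod.cong refl) (simp add: flip_def)
        also have "\<dots> = (\<Prod>l\<in>C. if l \<in> B then -1 else 1) * (\<Prod>l\<in>C. of_real (pi / q l))" by (rule prod.distrib)
        also have "(\<Prod>l\<in>C. if l \<in> B then -1 else (1::complex)) = (-1) ^ card B"
          by (subst prod.subset_diff[OF B finC]) simp
        finally show ?thesis by (simp add: mult.assoc[symmetric] power_add[symmetric] del: of_real_divide)
      qed
      finally have 1: "prefactor C (sB B) * (\<Prod>l\<in>C. kap (\<i> * of_int (sB B l) * of_real (q l)) + of_int (sg l))
        = of_real ((\<Prod>l\<in>B. n l) * (\<Prod>l\<in>C - B. 1 + n l)) * ((-1) ^ card B * (\<Prod>l\<in>C. of_real (pi / flip B q l)))" .
      have AG: "A \<subseteq> arcs G" using A by (rule trees_inD)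
      have "propagators A (extend N A (point (arcs G) (sB B) z))
        = (\<Prod>j\<in>A. 1 / ((extend N A (\<lambda>l. \<i> * of_int (sg l) * of_real (flip B q l)) j)\<^sup>2 + (of_real (flip B q j))\<^sup>2))"
        unfolding propagators_def
      proof (rule prod.cong[OF refl])
        fix j assume j: "j \<in> A"
        have "extend N A (point (arcs G) (sB B) z) j = extend N A (\<lambda>l. \<i> * of_int (sg l) * of_real (flip B q l)) j"
          using j AG by (intro extend_cong) (auto simp: point_def sB_def C_def flip_def)
        moreover have "flip B q j = q j" using j B by (auto simp: flip_def C_def)
        ultimately show "1 / ((extend N A (point (arcs G) (sB B) z) j)\<^sup>2 + (of_real (q j))\<^sup>2)
          = 1 / ((extend N A (\<lambda>l. \<i> * of_int (sg l) * of_real (flip B q l)) j)\<^sup>2 + (of_real (flip B q j))\<^sup>2)"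
          by (simp only:)
      qed
      then show "prefactor C (sB B) * (\<Prod>l\<in>C. kap (\<i> * of_int (sB B l) * of_real (q l)) + of_int (sg l)) *
        propagators A (extend N A (point (arcs G) (sB B) z))
        = of_real ((\<Prod>l\<in>B. n l) * (\<Prod>l\<in>C - B. 1 + n l)) * ((-1) ^ card B * amplitude N sg A (flip B q))"
        unfolding 1 amplitude_def C_def[symmetric] by (simp only: mult.assoc)
    qed
    finally show ?thesis unfolding C_def sg_def .
  qed
  then show ?thesis unfolding gaudin_def L by (intro sum.cong refl)
qed

end

lemma flip_empty [simp]: "flip {} q = q"
  by (simp add: flip_def fun_eq_iff)

section \<open>The sum and the integral as integrals over the lines off a tree\<close>

context matsubara_graph
begin

lemma restrict_extend_solution:
  fixes y :: "'e \<Rightarrow> 'c::comm_ring_1" and N :: "'v \<Rightarrow> int"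
  assumes T: "tree T" and N: "(\<Sum>v\<in>verts G. N v) = 0" and v: "v \<in> verts G"
  shows "vertex_total G (restrict (extend N T y) (arcs G)) v = of_int (N v)"
proof -
  have TG: "T \<subseteq> arcs G" by (rule treeD[OF T])
  have "\<forall>j\<in>T. restrict (extend N T y) (arcs G) j = of_int (tree_const N T j) +
      (\<Sum>l\<in>arcs G - T. of_int (tree_coeff T j l) * restrict (extend N T y) (arcs G) l)"
    using TG by (auto simp: extend_def intro!: sum.cong)
  then show ?thesis using v unfolding solution_iff[OF T N, symmetric] by blast
qed

lemma solution_eq_extend:
  fixes x :: "'e \<Rightarrow> 'c::comm_ring_1" and N :: "'v \<Rightarrow> int"
  assumes T: "tree T" and N: "(\<Sum>v\<in>verts G. N v) = 0"
    and x: "\<And>v. v \<in> verts G \<Longrightarrow> vertex_total G x v = of_int (N v)"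
  shows "extend N T x i = x i"
proof -
  have "\<forall>j\<in>T. x j = of_int (tree_const N T j) + (\<Sum>l\<in>arcs G - T. of_int (tree_coeff T j l) * x l)"
    using x unfolding solution_iff[OF T N, symmetric] by blast
  then show ?thesis by (simp add: extend_def)
qed

lemma line_values_eq:
  assumes T: "tree T" and N: "(\<Sum>v\<in>verts G. N v) = 0"
  shows "line_values G T N y = restrict (extend N T y) (arcs G)"
  unfolding line_values_def
proof (rule the_equality)
  show "restrict (extend N T y) (arcs G) \<in> arcs G \<rightarrow>\<^sub>E UNIV \<and>
    (\<forall>l\<in>arcs G - T. restrict (extend N T y) (arcs G) l = y l) \<and>
    (\<forall>v\<in>verts G. vertex_total G (restrict (extend N T y) (arcs G)) v = real_of_int (N v))"
    using restrict_extend_solution[OF T N, of _ y] by (auto simp: extend_cotree)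
next
  fix x assume x: "x \<in> arcs G \<rightarrow>\<^sub>E UNIV \<and> (\<forall>l\<in>arcs G - T. x l = y l) \<and>
             (\<forall>v\<in>verts G. vertex_total G x v = real_of_int (N v))"
  show "x = restrict (extend N T y) (arcs G)"
  proof
    fix i
    show "x i = restrict (extend N T y) (arcs G) i"
    proof (cases "i \<in> arcs G")
      case True
      have "x i = extend N T x i" using solution_eq_extend[OF T N, of x i] x by simp
      also have "\<dots> = extend N T y i" using x True by (intro extend_cong) auto
      finally show ?thesis using True by simp
    qed (use x in \<open>auto simp: PiE_def extensional_def\<close>)
  qed
qed

lemma matsubara_integral_eq:
  assumes T: "tree T" and N: "(\<Sum>v\<in>verts G. N v) = 0"
  shows "matsubara_integral G T N q = (LINT y|Pi\<^sub>M (arcs G - T) (\<lambda>_. lborel). weight N T q y)"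
  unfolding matsubara_integral_def weight_def line_values_eq[OF T N]
  by (intro Bochner_Integration.integral_cong refl prod.cong) simp

text \<open>The Kronecker deltas leave the integer solutions. These correspond to arbitrary integers
  off \<open>T\<close>, since the tree coefficients and constants are integers.\<close>

lemma matsubara_sum_eq:
  assumes T: "tree T" and N: "(\<Sum>v\<in>verts G. N v) = 0"
  shows "matsubara_sum G N q = (\<Sum>\<^sub>\<infinity>y\<in>arcs G - T \<rightarrow>\<^sub>E (UNIV :: int set). weight N T q (\<lambda>l. of_int (y l)))"
proof -
  define Sol where "Sol = {n \<in> arcs G \<rightarrow>\<^sub>E (UNIV :: int set). \<forall>v\<in>verts G. vertex_total G n v = N v}"
  define F where "F n = 1 / (\<Prod>i\<in>arcs G. (real_of_int (n i))\<^sup>2 + (q i)\<^sup>2)" for n :: "'e \<Rightarrow> int"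
  define g :: "('e \<Rightarrow> int) \<Rightarrow> 'e \<Rightarrow> int" where "g y = restrict (extend N T y) (arcs G)" for y
  have "matsubara_sum G N q = (\<Sum>\<^sub>\<infinity>n\<in>Sol. F n)"
    unfolding matsubara_sum_def
  proof (rule infsum_cong_neutral)
    fix n assume "n \<in> (arcs G \<rightarrow>\<^sub>E UNIV) - Sol"
    then obtain v where "v \<in> verts G" "vertex_total G n v \<noteq> N v" by (auto simp: Sol_def)
    then have "(\<Prod>v\<in>verts G. if vertex_total G n v = N v then 1 else 0) = (0 :: real)"
      by (intro prod_zero) auto
    then show "(\<Prod>v\<in>verts G. if vertex_total G n v = N v then 1 else 0) /
        (\<Prod>i\<in>arcs G. (real_of_int (n i))\<^sup>2 + (q i)\<^sup>2) = 0" by simp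
  qed (auto simp: Sol_def F_def)
  also have "\<dots> = (\<Sum>\<^sub>\<infinity>y\<in>arcs G - T \<rightarrow>\<^sub>E (UNIV :: int set). F (g y))"
  proof (rule infsum_reindex_bij_betw[symmetric], rule bij_betwI[where g = "\<lambda>n. restrict n (arcs G - T)"])
    show "g \<in> (arcs G - T \<rightarrow>\<^sub>E UNIV) \<rightarrow> Sol"
      using restrict_extend_solution[OF T N, where 'c = int] by (auto simp: g_def Sol_def of_int_eq_id)
    show "(\<lambda>n. restrict n (arcs G - T)) \<in> Sol \<rightarrow> (arcs G - T \<rightarrow>\<^sub>E UNIV)" by auto
    show "restrict (g y) (arcs G - T) = y" if "y \<in> arcs G - T \<rightarrow>\<^sub>E UNIV" for y
      using that by (auto simp: g_def extend_cotree PiE_def extensional_def fun_eq_iff)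
    show "g (restrict n (arcs G - T)) = n" if n: "n \<in> Sol" for n
    proof
      fix i
      show "g (restrict n (arcs G - T)) i = n i"
      proof (cases "i \<in> arcs G")
        case True
        have "extend N T (restrict n (arcs G - T)) i = extend N T n i" using True by (intro extend_cong) auto
        also have "\<dots> = n i" using n by (intro solution_eq_extend[OF T N]) (simp add: Sol_def)
        finally show ?thesis using True by (simp add: g_def)
      qed (use n in \<open>auto simp: g_def Sol_def PiE_def extensional_def\<close>)
    qed
  qed
  also have "\<dots> = (\<Sum>\<^sub>\<infinity>y\<in>arcs G - T \<rightarrow>\<^sub>E (UNIV :: int set). weight N T q (\<lambda>l. of_int (y l)))"
  proof (rule infsum_cong)
    fix y :: "'e \<Rightarrow> int"
    have "F (g y) = (\<Prod>i\<in>arcs G. 1 / ((real_of_int (g y i))\<^sup>2 + (q i)\<^sup>2))"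
      by (simp add: F_def prod_dividef)
    also have "\<dots> = weight N T q (\<lambda>l. of_int (y l))"
      unfolding weight_def by (intro prod.cong refl) (simp add: g_def extend_of_int)
    finally show "F (g y) = weight N T q (\<lambda>l. of_int (y l))" .
  qed
  finally show ?thesis .
qed

lemma matsubara_kernel_int:
  assumes "tree T" "(\<Sum>v\<in>verts G. N v) = 0"
  shows "matsubara_kernel G (count_space (UNIV :: int set)) of_int coth_kernel \<int> N T"
  using assms by (intro matsubara_kernel.intro matsubara_kernel_axioms.intro matsubara_graph_axioms summation_kernel_int)

lemma matsubara_kernel_lborel:
  assumes "tree T" "(\<Sum>v\<in>verts G. N v) = 0"
  shows "matsubara_kernel G lborel (\<lambda>x. x) (\<lambda>a. of_real (sgn (Im a))) UNIV N T"
  using assms by (intro matsubara_kernel.intro matsubara_kernel_axioms.intro matsubara_graph_axioms summation_kernel_lborel)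

lemma PiM_count_space_int:
  "Pi\<^sub>M (arcs G - T) (\<lambda>_. count_space (UNIV :: int set)) = count_space (arcs G - T \<rightarrow>\<^sub>E UNIV)"
  using count_space_PiM_finite[of "arcs G - T" "\<lambda>_. UNIV :: int set"] by simp

lemma abs_summable_weight:
  assumes T: "tree T" and N: "(\<Sum>v\<in>verts G. N v) = 0" and q: "\<And>i. i \<in> arcs G \<Longrightarrow> q i \<noteq> 0"
  shows "Infinite_Set_Sum.abs_summable_on (\<lambda>y. weight N T q (\<lambda>l. of_int (y l))) (arcs G - T \<rightarrow>\<^sub>E (UNIV :: int set))"
proof -
  interpret matsubara_kernel G "count_space (UNIV :: int set)" of_int coth_kernel \<int> N T q
    by (rule matsubara_kernel_int[OF T N])
  show ?thesis using integrable_weight[OF q] by (simp add: PiM_count_space_int abs_summable_on_def)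
qed

text \<open>Both formulas use the same enumeration \<open>bs\<close>, hence the same cone signs and
  the same amplitudes.\<close>

lemma amplitude_sums:
  assumes T: "tree T" and N: "(\<Sum>v\<in>verts G. N v) = 0" and gen: "generic (arcs G) q"
    and bs: "distinct bs" "set bs = arcs G - T" and q: "\<And>i. i \<in> arcs G \<Longrightarrow> q i > 0"
  shows matsubara_sum_amplitudes: "of_real (matsubara_sum G N q) = (\<Sum>A\<in>trees_in (arcs G). \<Sum>B\<in>Pow (arcs G - A).
      of_real ((\<Prod>l\<in>B. n_b (q l)) * (\<Prod>l\<in>arcs G - A - B. 1 + n_b (q l))) *
      ((-1) ^ card B * amplitude N (cone_sign bs A) A (flip B q)))"
    and matsubara_integral_amplitudes: "of_real (matsubara_integral G T N q)
      = (\<Sum>A\<in>trees_in (arcs G). amplitude N (cone_sign bs A) A q)"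
proof -
  have q0: "q i \<noteq> 0" if "i \<in> arcs G" for i using q[OF that] by simp
  have sub: "set bs \<subseteq> arcs G - T" using bs by simp
  {
    interpret matsubara_kernel G "count_space (UNIV :: int set)" of_int coth_kernel \<int> N T q
      by (rule matsubara_kernel_int[OF T N])
    have "matsubara_sum G N q = (LINT y|Pi\<^sub>M (arcs G - T) (\<lambda>_. count_space (UNIV :: int set)). weight N T q (\<lambda>l. of_int (y l)))"
      using infsetsum_infsum[OF abs_summable_weight[OF T N q0]]
      by (simp only: matsubara_sum_eq[OF T N] infsetsum_def PiM_count_space_int)
    then have "of_real (matsubara_sum G N q) = iterated bs (\<lambda>_. 0)"
      using iterated_eq_weight_integral[OF q0 bs] by simp
    also have "\<dots> = gaudin bs (\<lambda>_. 0)" using sub by (intro iterated_eq_gaudin[OF gen bs(1)]) auto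
    also have "\<dots> = (\<Sum>A\<in>trees_in (arcs G). \<Sum>B\<in>Pow (arcs G - A).
      of_real ((\<Prod>l\<in>B. n_b (q l)) * (\<Prod>l\<in>arcs G - A - B. 1 + n_b (q l))) *
      ((-1) ^ card B * amplitude N (cone_sign bs A) A (flip B q)))"
      using kap_minus coth_kernel_n_b q0 by (intro gaudin_eq_amplitudes[OF gen bs(2)]) auto
    finally show "of_real (matsubara_sum G N q) = \<dots>" .
  }
  {
    interpret matsubara_kernel G lborel "\<lambda>x. x" "\<lambda>a. of_real (sgn (Im a))" UNIV N T q
      by (rule matsubara_kernel_lborel[OF T N])
    have "of_real (matsubara_integral G T N q) = iterated bs (\<lambda>_. 0)"
      using iterated_eq_weight_integral[OF q0 bs] by (simp add: matsubara_integral_eq[OF T N])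
    also have "\<dots> = gaudin bs (\<lambda>_. 0)" using sub by (intro iterated_eq_gaudin[OF gen bs(1)]) auto
    also have "\<dots> = (\<Sum>A\<in>trees_in (arcs G). \<Sum>B\<in>Pow (arcs G - A).
      of_real ((\<Prod>l\<in>B. 0) * (\<Prod>l\<in>arcs G - A - B. 1 + 0)) *
      ((-1) ^ card B * amplitude N (cone_sign bs A) A (flip B q)))"
      using q by (intro gaudin_eq_amplitudes[OF gen bs(2)]) (auto simp: sgn_mult)
    \<comment> \<open>For Lebesgue measure the occupation numbers are 0, so only the unreflected
      term \<open>B = {}\<close> is left.\<close>
    also have "\<dots> = (\<Sum>A\<in>trees_in (arcs G). \<Sum>B\<in>{{} :: 'e set}. amplitude N (cone_sign bs A) A q)"
    proof (rule sum.cong[OF refl], rule sum.mono_neutral_cong_right)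
      fix A
      show "\<forall>B\<in>Pow (arcs G - A) - {{}}. of_real ((\<Prod>l\<in>B. 0) * (\<Prod>l\<in>arcs G - A - B. 1 + 0)) *
        ((-1) ^ card B * amplitude N (cone_sign bs A) A (flip B q)) = 0"
      proof
        fix B assume B: "B \<in> Pow (arcs G - A) - {{}}"
        then have "finite B" by (auto intro: finite_subset[of _ "arcs G"])
        then have "card B \<noteq> 0" using B by auto
        then have "(\<Prod>l\<in>B. 0) = (0 :: real)" by (simp add: power_0_left)
        then show "of_real ((\<Prod>l\<in>B. 0) * (\<Prod>l\<in>arcs G - A - B. 1 + 0)) *
          ((-1) ^ card B * amplitude N (cone_sign bs A) A (flip B q)) = 0" by simp
      qed
    qed (auto simp: flip_def)
    finally show "of_real (matsubara_integral G T N q) = (\<Sum>A\<in>trees_in (arcs G). amplitude N (cone_sign bs A) A q)"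
      by simp
  }
qed

text \<open>Weierstrass test on the open set where each \<open>p i\<close> exceeds half of
  \<open>q i\<close>: the terms are dominated by those at \<open>q / 2\<close>, which are
  summable.\<close>

lemma tendsto_matsubara_sum:
  assumes T: "tree T" and N: "(\<Sum>v\<in>verts G. N v) = 0" and q: "\<And>i. i \<in> arcs G \<Longrightarrow> q i > 0"
  shows "(matsubara_sum G N \<longlongrightarrow> matsubara_sum G N q) (at q)"
proof -
  define U where "U = {p :: 'e \<Rightarrow> real. \<forall>i\<in>arcs G. q i / 2 < p i}"
  define X where "X = (arcs G - T \<rightarrow>\<^sub>E (UNIV :: int set))"
  define h where "h y p = weight N T p (\<lambda>l. of_int (y l))" for y :: "'e \<Rightarrow> int" and p
  have "U = (\<Inter>i\<in>arcs G. {p. q i / 2 < p i})" by (auto simp: U_def)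
  moreover have "open {p :: 'e \<Rightarrow> real. q i / 2 < p i}" for i
    by (rule open_Collect_less[OF continuous_on_const continuous_on_product_coordinates])
  ultimately have U: "open U" "q \<in> U" using q by (auto simp: U_def)
  have le: "norm (h y p) \<le> h y (\<lambda>i. q i / 2)" if "p \<in> U" for y p
  proof -
    have "0 \<le> h y p" unfolding h_def weight_def by (intro prod_nonneg) auto
    moreover have "h y p \<le> h y (\<lambda>i. q i / 2)" unfolding h_def weight_def
    proof (intro prod_mono conjI)
      fix i assume i: "i \<in> arcs G"
      have "0 < q i / 2" "q i / 2 < p i" using q[OF i] that i by (auto simp: U_def)
      then have "(q i / 2)\<^sup>2 \<le> (p i)\<^sup>2" "0 < (q i / 2)\<^sup>2" by (auto intro!: power_mono)
      then show "1 / ((extend N T (\<lambda>l. real_of_int (y l)) i)\<^sup>2 + (p i)\<^sup>2)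
        \<le> 1 / ((extend N T (\<lambda>l. real_of_int (y l)) i)\<^sup>2 + (q i / 2)\<^sup>2)"
        by (intro divide_left_mono mult_pos_pos add_nonneg_pos add_mono) auto
    qed auto
    ultimately show ?thesis by simp
  qed
  have "Infinite_Set_Sum.abs_summable_on (\<lambda>y. h y (\<lambda>i. q i / 2)) X"
    unfolding h_def X_def
  proof (rule abs_summable_weight[OF T N])
    show "q i / 2 \<noteq> 0" if "i \<in> arcs G" for i using q[OF that] by simp
  qed
  then have "(\<lambda>y. h y (\<lambda>i. q i / 2)) summable_on X"
    using abs_summable_equivalent abs_summable_summable by blast
  then have ul: "uniform_limit U (\<lambda>F p. \<Sum>y\<in>F. h y p) (\<lambda>p. \<Sum>\<^sub>\<infinity>y\<in>X. h y p) (finite_subsets_at_top X)"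
    using le by (intro Weierstrass_m_test_general) auto
  have ct: "\<forall>\<^sub>F F in finite_subsets_at_top X. continuous_on U (\<lambda>p. \<Sum>y\<in>F. h y p)"
  proof (intro always_eventually allI continuous_on_sum)
    fix y
    have "p i \<noteq> 0" if "p \<in> U" "i \<in> arcs G" for p i using that q[OF that(2)] by (force simp: U_def)
    then have "(extend N T (\<lambda>l. real_of_int (y l)) i)\<^sup>2 + (p i)\<^sup>2 \<noteq> 0" if "p \<in> U" "i \<in> arcs G" for p i
      using that by (simp add: add_nonneg_eq_0_iff)
    then show "continuous_on U (h y)" unfolding h_def weight_def
      by (intro continuous_intros continuous_on_subset[OF continuous_on_product_coordinates]) auto
  qed
  have "continuous_on U (\<lambda>p. \<Sum>\<^sub>\<infinity>y\<in>X. h y p)"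
    by (rule uniform_limit_theorem[OF ct ul]) simp
  then have "continuous_on U (matsubara_sum G N)"
    unfolding h_def X_def matsubara_sum_eq[OF T N, symmetric] by simp
  then have "(matsubara_sum G N \<longlongrightarrow> matsubara_sum G N q) (at q within U)"
    using U(2) by (simp add: continuous_on_def)
  then show ?thesis by (simp only: at_within_open[OF U(2,1)])
qed

end

subsection \<open>Rationality of the integral\<close>

text \<open>Multisets allow coinciding poles, because rationality is needed at all positive
  arguments and not only at generic ones. Two poles ensure integrability, and each further pole is
  bounded by the inverse of its distance from the real line.\<close>

lemma (in lorentz_measure) integrable_pole_mset:
  assumes "\<And>a. a \<in># M \<Longrightarrow> Im a \<noteq> 0" "size M \<ge> 2"
  shows "integrable nu (\<lambda>y. \<Prod>a\<in>#M. 1 / (of_real (emb y) - a))"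
proof -
  obtain a M' where M: "M = add_mset a M'" using assms(2) by (cases M) auto
  obtain b L where M': "M' = add_mset b L" using assms(2) M by (cases M') auto
  have ab: "Im a \<noteq> 0" "Im b \<noteq> 0" using assms(1) M M' by auto
  have L: "\<And>c. c \<in># L \<Longrightarrow> Im c \<noteq> 0" using assms(1) M M' by auto
  have "integrable nu (\<lambda>y. 1 / ((of_real (emb y) - a) * (of_real (emb y) - b)) * (\<Prod>c\<in>#L. 1 / (of_real (emb y) - c)))"
    using L
  proof (induction L)
    case empty
    then show ?case using integrable_two_poles[OF ab] by simp
  next
    case (add c L)
    define g where "g y = 1 / ((of_real (emb y) - a) * (of_real (emb y) - b)) * (\<Prod>c\<in>#L. 1 / (of_real (emb y) - c))" for y
    have g: "integrable nu g" unfolding g_def using add by simp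
    have c: "Im c \<noteq> 0" using add.prems by simp
    have "integrable nu (\<lambda>y. g y * (1 / (of_real (emb y) - c)))"
    proof (rule Bochner_Integration.integrable_bound)
      show "integrable nu (\<lambda>y. norm (g y) * (1 / \<bar>Im c\<bar>))" using g by (intro integrable_mult_left) auto
      have "g \<in> borel_measurable nu" using g by auto
      then show "(\<lambda>y. g y * (1 / (of_real (emb y) - c))) \<in> borel_measurable nu" by measurable
      show "AE y in nu. norm (g y * (1 / (of_real (emb y) - c))) \<le> norm (norm (g y) * (1 / \<bar>Im c\<bar>))"
      proof (rule AE_I2)
        fix y
        have "\<bar>Im c\<bar> \<le> cmod (of_real (emb y) - c)" using abs_Im_le_cmod[of "of_real (emb y) - c"] by simp
        then have "1 / cmod (of_real (emb y) - c) \<le> 1 / \<bar>Im c\<bar>" using c by (intro divide_left_mono mult_pos_pos) auto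
        then have "cmod (g y) * (1 / cmod (of_real (emb y) - c)) \<le> cmod (g y) * (1 / \<bar>Im c\<bar>)"
          by (rule mult_left_mono) simp
        then show "norm (g y * (1 / (of_real (emb y) - c))) \<le> norm (norm (g y) * (1 / \<bar>Im c\<bar>))"
          by (simp add: norm_mult norm_divide)
      qed
    qed
    then show ?case by (simp add: g_def mult_ac)
  qed
  then show ?thesis by (simp add: M M')
qed

text \<open>From order two on, the power of a pole has an antiderivative that vanishes at both
  ends.\<close>

lemma integral_pole_power:
  fixes a :: complex
  assumes a: "Im a \<noteq> 0"
  shows "(LINT y|lborel. (1 / (of_real y - a)) ^ Suc (Suc n)) = 0"
proof -
  interpret lorentz_measure lborel "\<lambda>x. x" by (rule lorentz_measure_lborel)
  define F where "F y = - (1 / of_nat (Suc n)) * (1 / (complex_of_real y - a)) ^ Suc n" for y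
  have int: "integrable lborel (\<lambda>y. (1 / (complex_of_real y - a)) ^ Suc (Suc n))"
  proof -
    have "integrable lborel (\<lambda>y. \<Prod>c\<in>#replicate_mset (Suc (Suc n)) a. 1 / (complex_of_real y - c))"
      using a by (intro integrable_pole_mset) (auto split: if_splits)
    then show ?thesis by (simp add: prod_mset_replicate_mset mult_ac)
  qed
  have le: "norm (1 / (complex_of_real y - a)) \<le> 1 / \<bar>y - Re a\<bar>" if "y \<noteq> Re a" for y
    using abs_Re_le_cmod[of "of_real y - a"] that by (simp add: norm_divide frac_le)
  have inv: "((\<lambda>y. 1 / (complex_of_real y - a)) \<longlongrightarrow> 0) at_top" "((\<lambda>y. 1 / (complex_of_real y - a)) \<longlongrightarrow> 0) at_bot"
  proof -
    have l: "((\<lambda>y. 1 / \<bar>y - Re a\<bar>) \<longlongrightarrow> 0) at_top" "((\<lambda>y. 1 / \<bar>y - Re a\<bar>) \<longlongrightarrow> 0) at_bot" by real_asymp+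
    have e1: "\<forall>\<^sub>F y in at_top. norm (1 / (complex_of_real y - a)) \<le> 1 / \<bar>y - Re a\<bar>"
      using eventually_gt_at_top[of "Re a"] by eventually_elim (rule le, simp)
    have e2: "\<forall>\<^sub>F y in at_bot. norm (1 / (complex_of_real y - a)) \<le> 1 / \<bar>y - Re a\<bar>"
      using eventually_gt_at_bot[of "Re a"] by eventually_elim (rule le, simp)
    show "((\<lambda>y. 1 / (complex_of_real y - a)) \<longlongrightarrow> 0) at_top" by (rule Lim_null_comparison[OF e1 l(1)])
    show "((\<lambda>y. 1 / (complex_of_real y - a)) \<longlongrightarrow> 0) at_bot" by (rule Lim_null_comparison[OF e2 l(2)])
  qed
  have lim: "(F \<longlongrightarrow> - (1 / of_nat (Suc n)) * 0 ^ Suc n) at_top" "(F \<longlongrightarrow> - (1 / of_nat (Suc n)) * 0 ^ Suc n) at_bot"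
    unfolding F_def by (intro tendsto_intros inv)+
  have "(LBINT y=-\<infinity>..\<infinity>. (1 / (complex_of_real y - a)) ^ Suc (Suc n)) = 0 - 0"
  proof (rule interval_integral_FTC_integrable)
    show "(F has_vector_derivative (1 / (complex_of_real y - a)) ^ Suc (Suc n)) (at y)" for y
    proof -
      have "complex_of_real y - a \<noteq> 0" by (rule of_real_neq_nonreal[OF a])
      then have "((\<lambda>w. 1 / (w - a)) has_field_derivative - ((1 / (of_real y - a))\<^sup>2)) (at (of_real y))"
        by (auto intro!: derivative_eq_intros simp: power2_eq_square)
      from DERIV_cmult[OF DERIV_power[OF this, of "Suc n"], of "- (1 / of_nat (Suc n))"]
      have "((\<lambda>w. - (1 / of_nat (Suc n)) * (1 / (w - a)) ^ Suc n) has_field_derivative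
          - (1 / of_nat (Suc n)) * (of_nat (Suc n) * (- ((1 / (of_real y - a))\<^sup>2) * (1 / (of_real y - a)) ^ (Suc n - Suc 0)))) (at (of_real y))" .
      also have "- (1 / of_nat (Suc n)) * (of_nat (Suc n) * (- ((1 / (of_real y - a))\<^sup>2) * (1 / (of_real y - a)) ^ (Suc n - Suc 0)))
        = (1 / (complex_of_real y - a)) ^ Suc (Suc n)"
      proof -
        have "- (1 / of_nat (Suc n)) * (of_nat (Suc n) * (- (g\<^sup>2) * g ^ (Suc n - Suc 0))) = g ^ Suc (Suc n)" for g :: complex
          by (simp add: power2_eq_square del: of_nat_Suc)
        then show ?thesis .
      qed
      finally show ?thesis unfolding F_def by (rule has_vector_derivative_real_field)
    qed
    show "isCont (\<lambda>y. (1 / (complex_of_real y - a)) ^ Suc (Suc n)) y" for y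
      using of_real_neq_nonreal[OF a] by (intro continuous_intros) auto
    show "set_integrable lborel (einterval (- \<infinity>) \<infinity>) (\<lambda>y. (1 / (complex_of_real y - a)) ^ Suc (Suc n))"
      using int by (simp add: set_integrable_def)
    show "((F \<circ> real_of_ereal) \<longlongrightarrow> 0) (at_right (- \<infinity>))" "((F \<circ> real_of_ereal) \<longlongrightarrow> 0) (at_left \<infinity>)"
      using lim by (simp_all add: ereal_tendsto_simps)
  qed simp
  then show ?thesis by (simp add: interval_lebesgue_integral_def set_lebesgue_integral_def)
qed

text \<open>An algebraic substitute for closing the contour on the side without poles: two distinct
  poles are split by partial fractions into shorter products, down to a pair on the same side; if
  all poles coincide, a power is left.\<close>

lemma integral_one_sided_poles:
  assumes "\<And>a. a \<in># M \<Longrightarrow> Im a \<noteq> 0 \<and> sgn (Im a) = s" "size M \<ge> 2"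
  shows "(LINT y|lborel. (\<Prod>a\<in>#M. 1 / (of_real y - a))) = 0"
  using assms
proof (induction "size M" arbitrary: M rule: less_induct)
  case less
  interpret lorentz_measure lborel "\<lambda>x. x" by (rule lorentz_measure_lborel)
  show ?case
  proof (cases "\<exists>a b. a \<in># M \<and> b \<in># M \<and> a \<noteq> b")
    case True
    then obtain a b where ab: "a \<in># M" "b \<in># M" "a \<noteq> b" by blast
    obtain M' where M': "M = add_mset a M'" using multi_member_split[OF ab(1)] by blast
    then have bM': "b \<in># M'" using ab by auto
    obtain L where "M' = add_mset b L" using multi_member_split[OF bM'] by blast
    with M' have M: "M = {#a, b#} + L" by simp
    have Im: "Im a \<noteq> 0" "Im b \<noteq> 0" "sgn (Im a) = sgn (Im b)" using less.prems ab by auto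
    have eq: "(\<Prod>c\<in>#M. 1 / (of_real y - c)) = 1 / (a - b) * ((1 / (of_real y - a) - 1 / (of_real y - b)) * (\<Prod>c\<in>#L. 1 / (of_real y - c)))" for y :: real
    proof -
      define P where "P = (\<Prod>c\<in>#L. 1 / (complex_of_real y - c))"
      define u v where "u = complex_of_real y - a" and "v = complex_of_real y - b"
      have "u \<noteq> 0" "v \<noteq> 0" "a - b = v - u" "v \<noteq> u"
        using of_real_neq_nonreal[OF Im(1), of y] of_real_neq_nonreal[OF Im(2), of y] ab(3) by (auto simp: u_def v_def)
      then have "1 / u * (1 / v * P) = 1 / (a - b) * ((1 / u - 1 / v) * P)"
        by (simp add: divide_simps)
      then show ?thesis unfolding M by (simp add: P_def[symmetric] u_def[symmetric] v_def[symmetric])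
    qed
    show ?thesis
    proof (cases "L = {#}")
      case True
      then show ?thesis
        using integral_pole_pair_lborel[OF Im(1,2)] Im(3) unfolding eq integral_mult_right_zero by simp
    next
      case False
      have pL: "Im c \<noteq> 0 \<and> sgn (Im c) = s" if "c \<in># add_mset a L \<or> c \<in># add_mset b L" for c
        using less.prems(1)[of c] that by (auto simp: M)
      have sz: "size (add_mset a L) \<ge> 2" "size (add_mset b L) \<ge> 2" "size (add_mset a L) < size M" "size (add_mset b L) < size M"
      proof -
        have "size L \<ge> 1" using False by (cases L) auto
        then show "size (add_mset a L) \<ge> 2" "size (add_mset b L) \<ge> 2" "size (add_mset a L) < size M" "size (add_mset b L) < size M"
          by (simp_all add: M)
      qed
      have z: "(LINT y|lborel. (\<Prod>c\<in>#add_mset a L. 1 / (of_real y - c))) = 0" "(LINT y|lborel. (\<Prod>c\<in>#add_mset b L. 1 / (of_real y - c))) = 0"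
        using pL sz by (intro less.hyps; blast)+
      have i: "integrable lborel (\<lambda>y. \<Prod>c\<in>#add_mset a L. 1 / (of_real y - c))" "integrable lborel (\<lambda>y. \<Prod>c\<in>#add_mset b L. 1 / (of_real y - c))"
        using pL sz by (intro integrable_pole_mset; blast)+
      have "(LINT y|lborel. (\<Prod>c\<in>#M. 1 / (of_real y - c))) = 1 / (a - b) * (LINT y|lborel. (\<Prod>c\<in>#add_mset a L. 1 / (of_real y - c)) - (\<Prod>c\<in>#add_mset b L. 1 / (of_real y - c)))"
        unfolding eq integral_mult_right_zero by (simp add: left_diff_distrib)
      also have "\<dots> = 0" unfolding Bochner_Integration.integral_diff[OF i] z by simp
      finally show ?thesis .
    qed
  next
    case False
    obtain a L where M: "M = add_mset a L" using less.prems by (cases M) auto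
    have "set_mset M \<subseteq> {a}" using False M by auto
    then have rep: "M = replicate_mset (size M) a" by (rule set_mset_subset_singletonD)
    obtain n where n: "size M = Suc (Suc n)" using less.prems(2) by (metis add_2_eq_Suc le_Suc_ex)
    have M: "M = replicate_mset (Suc (Suc n)) a" using rep unfolding n by assumption
    have "Im a \<noteq> 0" using less.prems(1) by (simp add: M)
    have "(\<Prod>c\<in>#M. 1 / (complex_of_real y - c)) = (1 / (of_real y - a)) ^ Suc (Suc n)" for y
      unfolding M image_replicate_mset prod_mset_replicate_mset ..
    then show ?thesis using integral_pole_power[OF \<open>Im a \<noteq> 0\<close>, of n] by (simp only:)
  qed
qed

section \<open>Inverses of forms with positive real part, integrated one variable at a time\<close>

type_synonym 'e form = "('e \<Rightarrow> real) \<times> ('e \<Rightarrow> real) \<times> real"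

definition form_value :: "'e set \<Rightarrow> ('e \<Rightarrow> real) \<Rightarrow> ('e \<Rightarrow> real) \<Rightarrow> 'e form \<Rightarrow> complex" where
  "form_value E q z = (\<lambda>(a, b, r). of_real (\<Sum>i\<in>E. a i * q i) + \<i> * of_real (r + (\<Sum>i\<in>E. b i * z i)))"

text \<open>Only \<open>q\<close> enters the real part and only \<open>z\<close> the imaginary part,
  so this condition keeps the form away from 0 at positive \<open>q\<close> for every
  \<open>z\<close>.\<close>

definition positive_form :: "'e set \<Rightarrow> 'e form \<Rightarrow> bool" where
  "positive_form E = (\<lambda>(a, b, r). (\<forall>i\<in>E. a i \<ge> 0) \<and> (\<exists>i\<in>E. a i > 0))"

lemma Re_form_value_pos:
  assumes "finite E" "positive_form E f" "positive_on E q"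
  shows "Re (form_value E q z f) > 0"
proof -
  obtain a b r where f: "f = (a, b, r)" by (cases f)
  obtain i where i: "i \<in> E" "a i > 0" using assms(2) by (auto simp: positive_form_def f)
  have "(\<Sum>i\<in>E. a i * q i) > 0"
    using assms i by (intro sum_pos2[of E i]) (auto simp: positive_form_def positive_on_def f less_imp_le)
  then show ?thesis by (simp add: form_value_def f)
qed

text \<open>Sums of products of inverses of positive forms: the functions arising when the variables are
  integrated out one at a time. They have no poles at positive arguments.\<close>

inductive positive_fraction :: "'e set \<Rightarrow> (('e \<Rightarrow> real) \<Rightarrow> ('e \<Rightarrow> real) \<Rightarrow> complex) \<Rightarrow> bool" for E where
  const: "positive_fraction E (\<lambda>q z. c)"
| add: "positive_fraction E g \<Longrightarrow> positive_fraction E h \<Longrightarrow> positive_fraction E (\<lambda>q z. g q z + h q z)"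
| divide: "positive_fraction E g \<Longrightarrow> positive_form E f \<Longrightarrow> positive_fraction E (\<lambda>q z. 1 / form_value E q z f * g q z)"
| cong: "positive_fraction E g \<Longrightarrow> (\<And>q z. positive_on E q \<Longrightarrow> h q z = g q z) \<Longrightarrow> positive_fraction E h"

lemma positive_fraction_mult_const:
  "positive_fraction E g \<Longrightarrow> positive_fraction E (\<lambda>q z. c * g q z)"
proof (induction rule: positive_fraction.induct)
  case (add g h)
  then show ?case using positive_fraction.add[OF add.IH] by (simp add: distrib_left)
next
  case (divide g f)
  then show ?case using positive_fraction.divide[OF divide.IH, of f] by (simp add: mult_ac)
next
  case (cong g h)
  then show ?case by (intro positive_fraction.cong[OF cong.IH]) simp
qed (rule positive_fraction.const)

lemma positive_fraction_mult:
  assumes "positive_fraction E g" "positive_fraction E h"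
  shows "positive_fraction E (\<lambda>q z. g q z * h q z)"
  using assms(1)
proof (induction rule: positive_fraction.induct)
  case (const c)
  then show ?case by (rule positive_fraction_mult_const[OF assms(2)])
next
  case (add g h)
  then show ?case using positive_fraction.add[OF add.IH] by (simp add: distrib_right)
next
  case (divide g f)
  then show ?case using positive_fraction.divide[OF divide.IH, of f] by (simp add: mult_ac)
next
  case (cong g h)
  then show ?case by (intro positive_fraction.cong[OF cong.IH]) simp
qed

definition add_form :: "'e form \<Rightarrow> 'e form \<Rightarrow> 'e form" where
  "add_form = (\<lambda>(a, b, r) (a', b', r'). (\<lambda>i. a i + a' i, \<lambda>i. b i + b' i, r + r'))"

lemma form_value_add: "form_value E q z (add_form f g) = form_value E q z f + form_value E q z g"
  by (cases f; cases g) (simp add: form_value_def add_form_def distrib_right distrib_left sum.distrib)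

lemma positive_form_add:
  assumes "positive_form E f" "positive_form E g"
  shows "positive_form E (add_form f g)"
proof -
  obtain a b r a' b' r' where fg: "f = (a, b, r)" "g = (a', b', r')" by (cases f, cases g)
  then obtain i where "i \<in> E" "a i > 0" "a' i \<ge> 0" using assms by (auto simp: positive_form_def)
  then show ?thesis using assms fg
    by (auto simp: positive_form_def add_form_def intro!: bexI[of _ i] add_pos_nonneg)
qed

text \<open>As functions of \<open>y\<close> these factors have their poles at i times the values of
  the forms, hence in the upper half-plane when the forms are positive; those of
  \<open>lower\<close> are in the lower one.\<close>

definition upper :: "'e set \<Rightarrow> ('e \<Rightarrow> real) \<Rightarrow> ('e \<Rightarrow> real) \<Rightarrow> 'e form list \<Rightarrow> real \<Rightarrow> complex" where
  "upper E q z fs y = (\<Prod>f\<leftarrow>fs. 1 / (form_value E q z f + \<i> * of_real y))"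

definition lower :: "'e set \<Rightarrow> ('e \<Rightarrow> real) \<Rightarrow> ('e \<Rightarrow> real) \<Rightarrow> 'e form list \<Rightarrow> real \<Rightarrow> complex" where
  "lower E q z fs y = (\<Prod>f\<leftarrow>fs. 1 / (form_value E q z f - \<i> * of_real y))"

lemma upper_poles: "upper E q z fs y = (- \<i>) ^ length fs * (\<Prod>a\<in>#mset (map (\<lambda>f. \<i> * form_value E q z f) fs). 1 / (of_real y - a))"
proof (induction fs)
  case (Cons f fs)
  have "form_value E q z f + \<i> * of_real y = \<i> * (of_real y - \<i> * form_value E q z f)" by (simp add: algebra_simps)
  then have "1 / (form_value E q z f + \<i> * of_real y) = - \<i> * (1 / (of_real y - \<i> * form_value E q z f))"
    by (simp only:) (simp add: divide_simps)
  then show ?case using Cons by (simp add: upper_def mult_ac)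
qed (simp add: upper_def)

lemma lower_poles: "lower E q z fs y = \<i> ^ length fs * (\<Prod>a\<in>#mset (map (\<lambda>f. - \<i> * form_value E q z f) fs). 1 / (of_real y - a))"
proof (induction fs)
  case (Cons f fs)
  have "form_value E q z f - \<i> * of_real y = - \<i> * (of_real y - - \<i> * form_value E q z f)" by (simp add: algebra_simps)
  then have "1 / (form_value E q z f - \<i> * of_real y) = \<i> * (1 / (of_real y - - \<i> * form_value E q z f))"
    by (simp only:) (simp add: divide_simps)
  then show ?case using Cons by (simp add: lower_def mult_ac)
qed (simp add: lower_def)

lemma upper_lower_poles:
  "upper E q z fs y * lower E q z gs y = (- \<i>) ^ length fs * \<i> ^ length gs *
    (\<Prod>a\<in>#mset (map (\<lambda>f. \<i> * form_value E q z f) fs) + mset (map (\<lambda>f. - \<i> * form_value E q z f) gs). 1 / (of_real y - a))"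
  unfolding upper_poles lower_poles by simp

context
  fixes E :: "'e set" and q :: "'e \<Rightarrow> real"
  assumes E: "finite E" and q: "positive_on E q"
begin

lemma integrable_upper_lower:
  assumes "list_all (positive_form E) fs" "list_all (positive_form E) gs" "length fs + length gs \<ge> 2"
  shows "integrable lborel (\<lambda>y. upper E q z fs y * lower E q z gs y)"
proof -
  interpret lorentz_measure lborel "\<lambda>x. x" by (rule lorentz_measure_lborel)
  have "Re (form_value E q z f) \<noteq> 0" if "f \<in> set fs \<union> set gs" for f
    using Re_form_value_pos[OF E _ q, of f z] that assms by (auto simp: list_all_iff)
  then show ?thesis unfolding upper_lower_poles using assms(3)
    by (intro integrable_mult_right integrable_pole_mset) auto
qed

lemma integral_upper:
  assumes "list_all (positive_form E) fs" "length fs \<ge> 2"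
  shows "(LINT y|lborel. upper E q z fs y * lower E q z [] y) = 0"
proof -
  have "Re (form_value E q z f) > 0" if "f \<in> set fs" for f
    using Re_form_value_pos[OF E _ q, of f z] that assms by (auto simp: list_all_iff)
  then have "(LINT y|lborel. (\<Prod>a\<in>#mset (map (\<lambda>f. \<i> * form_value E q z f) fs) + mset (map (\<lambda>f. - \<i> * form_value E q z f) []). 1 / (of_real y - a))) = 0"
    using assms(2) by (intro integral_one_sided_poles[of _ 1]) (auto simp: less_imp_neq[THEN not_sym])
  then show ?thesis unfolding upper_lower_poles integral_mult_right_zero by simp
qed

lemma integral_lower:
  assumes "list_all (positive_form E) fs" "length fs \<ge> 2"
  shows "(LINT y|lborel. upper E q z [] y * lower E q z fs y) = 0"
proof -
  have "Re (form_value E q z f) > 0" if "f \<in> set fs" for f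
    using Re_form_value_pos[OF E _ q, of f z] that assms by (auto simp: list_all_iff)
  then have "(LINT y|lborel. (\<Prod>a\<in>#mset (map (\<lambda>f. \<i> * form_value E q z f) []) + mset (map (\<lambda>f. - \<i> * form_value E q z f) fs). 1 / (of_real y - a))) = 0"
    using assms(2) by (intro integral_one_sided_poles[of _ "-1"]) (auto simp: less_imp_neq[THEN not_sym])
  then show ?thesis unfolding upper_lower_poles integral_mult_right_zero by simp
qed

text \<open>The two poles lie on opposite sides and differ by i times the sum of the forms, so the
  value is again a constant over a positive form.\<close>

lemma integral_upper_lower_pair:
  assumes "positive_form E f" "positive_form E g"
  shows "(LINT y|lborel. upper E q z [f] y * lower E q z [g] y) = 1 / form_value E q z (add_form f g) * (2 * of_real pi)"
proof -
  interpret lorentz_measure lborel "\<lambda>x. x" by (rule lorentz_measure_lborel)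
  define u v where "u = \<i> * form_value E q z f" and "v = - \<i> * form_value E q z g"
  have uv: "Im u > 0" "Im v < 0" using Re_form_value_pos[OF E _ q] assms by (simp_all add: u_def v_def)
  then have ne: "u \<noteq> v" by auto
  have eq: "upper E q z [f] y * lower E q z [g] y = 1 / (u - v) * (1 / (of_real y - u) - 1 / (of_real y - v))" for y
  proof -
    have "upper E q z [f] y * lower E q z [g] y = 1 / (of_real y - u) * (1 / (of_real y - v))"
      unfolding upper_lower_poles by (simp add: u_def v_def)
    then show ?thesis using of_real_neq_nonreal[of u y] of_real_neq_nonreal[of v y] uv ne
      by (simp add: divide_simps)
  qed
  have "u - v = \<i> * form_value E q z (add_form f g)" by (simp add: u_def v_def form_value_add algebra_simps)
  moreover have "(LINT y|lborel. 1 / (complex_of_real y - u) - 1 / (of_real y - v)) = of_real pi * \<i> * 2"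
    using integral_pole_pair_lborel[of u v] uv by simp
  ultimately show ?thesis unfolding eq integral_mult_right_zero by (simp add: divide_simps)
qed

text \<open>Uses 1/(u v) = (1/u + 1/v)/(u + v) for factors from opposite sides: in u + v the
  variable \<open>y\<close> cancels and a positive form remains. Splitting factors from the same
  side would produce differences, which may vanish at positive arguments.\<close>

lemma integral_upper_lower_split:
  assumes "positive_form E f" "positive_form E g" "list_all (positive_form E) fs" "list_all (positive_form E) gs"
    "length fs + length gs \<ge> 1"
  shows "(LINT y|lborel. upper E q z (f # fs) y * lower E q z (g # gs) y) = 1 / form_value E q z (add_form f g) *
    ((LINT y|lborel. upper E q z (f # fs) y * lower E q z gs y) + (LINT y|lborel. upper E q z fs y * lower E q z (g # gs) y))"
proof -
  have pos: "Re (form_value E q z f) > 0" "Re (form_value E q z g) > 0"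
    using Re_form_value_pos[OF E _ q] assms by auto
  have "upper E q z (f # fs) y * lower E q z (g # gs) y = 1 / form_value E q z (add_form f g) *
    (upper E q z (f # fs) y * lower E q z gs y + upper E q z fs y * lower E q z (g # gs) y)" for y
  proof -
    define u v where "u = form_value E q z f + \<i> * of_real y" and "v = form_value E q z g - \<i> * of_real y"
    have "Re u > 0" "Re v > 0" using pos by (simp_all add: u_def v_def)
    then have "u \<noteq> 0" "v \<noteq> 0" "u + v \<noteq> 0" by (auto simp: complex_eq_iff)
    then have "1 / u * x * (1 / v * w) = 1 / (u + v) * (1 / u * x * w + x * (1 / v * w))" for x w
      by (simp add: divide_simps) (simp add: algebra_simps)
    moreover have "form_value E q z (add_form f g) = u + v" by (simp add: u_def v_def form_value_add)
    ultimately show ?thesis by (simp add: upper_def lower_def u_def[symmetric] v_def[symmetric])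
  qed
  moreover have "integrable lborel (\<lambda>y. upper E q z (f # fs) y * lower E q z gs y)"
    "integrable lborel (\<lambda>y. upper E q z fs y * lower E q z (g # gs) y)"
    using assms by (intro integrable_upper_lower; simp)+
  ultimately show ?thesis by (simp only: integral_mult_right_zero Bochner_Integration.integral_add)
qed

end

lemma positive_fraction_upper_lower:
  assumes E: "finite E" and "list_all (positive_form E) fs" "list_all (positive_form E) gs" "length fs + length gs \<ge> 2"
  shows "positive_fraction E (\<lambda>q z. LINT y|lborel. upper E q z fs y * lower E q z gs y)"
  using assms(2-)
proof (induction "length fs + length gs" arbitrary: fs gs rule: less_induct)
  case less
  consider "fs = []" | "gs = []" | f g where "fs = [f]" "gs = [g]"
    | f fs' g gs' where "fs = f # fs'" "gs = g # gs'" "length fs' + length gs' \<ge> 1"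
  proof (cases "fs = [] \<or> gs = []")
    case False
    then obtain f fs' g gs' where "fs = f # fs'" "gs = g # gs'" by (metis list.exhaust)
    then show ?thesis using that(3,4) by (cases "fs' = [] \<and> gs' = []") (auto simp: Suc_le_eq)
  qed (use that in blast)
  then show ?case
  proof cases
    case 1
    then show ?thesis
      using less.prems by (intro positive_fraction.cong[OF positive_fraction.const[of E 0]]) (simp add: integral_lower[OF E])
  next
    case 2
    then show ?thesis
      using less.prems by (intro positive_fraction.cong[OF positive_fraction.const[of E 0]]) (simp add: integral_upper[OF E])
  next
    case 3
    have pf: "positive_form E f" "positive_form E g" using less.prems 3 by simp_all
    show ?thesis unfolding 3
      by (rule positive_fraction.cong[OF positive_fraction.divide[OF positive_fraction.const[of E "2 * of_real pi"] positive_form_add[OF pf]]])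
        (rule integral_upper_lower_pair[OF E _ pf])
  next
    case 4
    have pf: "positive_form E f" "positive_form E g" "list_all (positive_form E) fs'" "list_all (positive_form E) gs'"
      using less.prems 4 by simp_all
    have "positive_fraction E (\<lambda>q z. LINT y|lborel. upper E q z (f # fs') y * lower E q z gs' y)"
      "positive_fraction E (\<lambda>q z. LINT y|lborel. upper E q z fs' y * lower E q z (g # gs') y)"
      using less.prems 4 by (intro less.hyps; simp)+
    note pos = positive_fraction.divide[OF positive_fraction.add[OF this] positive_form_add[OF pf(1,2)]]
    show ?thesis unfolding 4(1,2)
      by (rule positive_fraction.cong[OF pos]) (rule integral_upper_lower_split[OF E _ pf 4(3)])
  qed
qed

lemma form_value_update:
  assumes "finite E"
  shows "form_value E q (z(e := y)) (a, b, r) = form_value E q z (a, b(e := 0), r) + \<i> * of_real (if e \<in> E then b e * y else 0)"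
proof -
  have "(\<Sum>i\<in>E. b i * (z(e := y)) i) = (\<Sum>i\<in>E. (b(e := 0)) i * z i + (if i = e then b e * y else 0))"
    by (intro sum.cong) auto
  also have "\<dots> = (\<Sum>i\<in>E. (b(e := 0)) i * z i) + (if e \<in> E then b e * y else 0)"
    by (simp only: sum.distrib sum.delta[OF assms])
  finally show ?thesis by (simp only: form_value_def case_prod_conv of_real_add) (simp add: algebra_simps)
qed

lemma form_value_scale: "form_value E q z (\<lambda>i. a i / c, \<lambda>i. b i / c, r / c) = form_value E q z (a, b, r) / of_real c"
proof -
  define A B where "A = (\<Sum>i\<in>E. a i * q i)" and "B = (\<Sum>i\<in>E. b i * z i)"
  have "(\<Sum>i\<in>E. a i / c * q i) = A / c" "(\<Sum>i\<in>E. b i / c * z i) = B / c"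
    by (simp_all add: A_def B_def sum_divide_distrib)
  then show ?thesis
    unfolding form_value_def case_prod_conv A_def[symmetric] B_def[symmetric]
    by (simp add: add_divide_distrib distrib_left)
qed

text \<open>The lists \<open>fs\<close> and \<open>gs\<close> accumulate the divisors that depend on
  the integrated variable: in the induction over \<open>g\<close>, a divisor is scaled by the
  modulus of its coefficient of \<open>y\<close> and sorted by the sign, or leaves the integral if
  it does not depend on \<open>y\<close>. Integrability is carried along for the case of
  sums.\<close>

lemma positive_fraction_integrate:
  assumes E: "finite E" and g: "positive_fraction E g"
    and "list_all (positive_form E) fs" "list_all (positive_form E) gs" "length fs + length gs \<ge> 2"
  shows "positive_fraction E (\<lambda>q z. LINT y|lborel. upper E q z fs y * lower E q z gs y * g q (z(e := y))) \<and>
    (\<forall>q z. positive_on E q \<longrightarrow> integrable lborel (\<lambda>y. upper E q z fs y * lower E q z gs y * g q (z(e := y))))"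
  using g assms(3-)
proof (induction arbitrary: fs gs rule: positive_fraction.induct)
  case (const c)
  show ?case
  proof (intro conjI allI impI)
    show "positive_fraction E (\<lambda>q z. LINT y|lborel. upper E q z fs y * lower E q z gs y * c)"
      using positive_fraction_mult_const[OF positive_fraction_upper_lower[OF E const], of c]
      by (simp only: integral_mult_left_zero mult.commute[of c])
    show "integrable lborel (\<lambda>y. upper E q z fs y * lower E q z gs y * c)" if "positive_on E q" for q z
      by (intro integrable_mult_left integrable_upper_lower[OF E that] const)
  qed
next
  case (add g h)
  note IH = add.IH(1)[OF add.prems] add.IH(2)[OF add.prems]
  show ?case
  proof (intro conjI allI impI)
    have int: "integrable lborel (\<lambda>y. upper E q z fs y * lower E q z gs y * g q (z(e := y)))"
      "integrable lborel (\<lambda>y. upper E q z fs y * lower E q z gs y * h q (z(e := y)))" if "positive_on E q" for q z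
      using IH that by blast+
    show "integrable lborel (\<lambda>y. upper E q z fs y * lower E q z gs y * (g q (z(e := y)) + h q (z(e := y))))"
      if "positive_on E q" for q z
      unfolding distrib_left by (rule Bochner_Integration.integrable_add[OF int[OF that]])
    show "positive_fraction E (\<lambda>q z. LINT y|lborel. upper E q z fs y * lower E q z gs y * (g q (z(e := y)) + h q (z(e := y))))"
    proof (rule positive_fraction.cong[OF positive_fraction.add[OF IH(1)[THEN conjunct1] IH(2)[THEN conjunct1]]])
      fix q z assume "positive_on E q"
      from Bochner_Integration.integral_add[OF int[OF this]]
      show "(LINT y|lborel. upper E q z fs y * lower E q z gs y * (g q (z(e := y)) + h q (z(e := y))))
        = (LINT y|lborel. upper E q z fs y * lower E q z gs y * g q (z(e := y))) + (LINT y|lborel. upper E q z fs y * lower E q z gs y * h q (z(e := y)))"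
        by (simp only: distrib_left)
    qed
  qed
next
  case (divide g f)
  obtain a b r where f: "f = (a, b, r)" by (cases f)
  define b0 where "b0 = b(e := 0)"
  have upd: "form_value E q (z(e := y)) f = form_value E q z (a, b0, r) + \<i> * of_real (if e \<in> E then b e * y else 0)" for q z y
    unfolding f b0_def by (rule form_value_update[OF E])
  have alg: "U * L * (1 / (c * w) * x) = (1 / c) * (1 / w * U * L * x)" "U * L * (1 / (c * w) * x) = (1 / c) * (U * (1 / w * L) * x)" for U L c w x :: complex
    by simp_all
  have pos: "positive_form E (a, b', r')" for b' r' using divide.hyps(2) by (auto simp: f positive_form_def)
  have pos': "positive_form E (\<lambda>i. a i / c, b', r')" if "c > 0" for b' r' c
  proof -
    obtain i where "i \<in> E" "a i > 0" using divide.hyps(2) by (auto simp: f positive_form_def)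
    then show ?thesis using divide.hyps(2) that by (auto simp: f positive_form_def intro!: bexI[of _ i])
  qed
  consider "(if e \<in> E then b e else 0) = 0" | "e \<in> E" "b e > 0" | "e \<in> E" "b e < 0"
    by (cases "e \<in> E"; cases "b e" "0 :: real" rule: linorder_cases) auto
  then show ?case
  proof cases
    case 1
    then have eq: "form_value E q (z(e := y)) f = form_value E q z (a, b0, r)" for q z y
      unfolding upd by (auto split: if_splits)
    have eq2: "upper E q z fs y * lower E q z gs y * (1 / form_value E q (z(e := y)) f * g q (z(e := y)))
      = 1 / form_value E q z (a, b0, r) * (upper E q z fs y * lower E q z gs y * g q (z(e := y)))" for q z y
      unfolding eq by simp
    note IH = divide.IH[OF divide.prems]
    show ?thesis unfolding eq2 integral_mult_right_zero
    proof (intro conjI allI impI)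
      show "positive_fraction E (\<lambda>q z. 1 / form_value E q z (a, b0, r) * (LINT y|lborel. upper E q z fs y * lower E q z gs y * g q (z(e := y))))"
        by (rule positive_fraction.divide[OF IH[THEN conjunct1] pos])
      show "integrable lborel (\<lambda>y. 1 / form_value E q z (a, b0, r) * (upper E q z fs y * lower E q z gs y * g q (z(e := y))))"
        if "positive_on E q" for q z
        by (rule integrable_mult_right) (use IH that in blast)
    qed
  next
    case 2
    define f' where "f' = (\<lambda>i. a i / b e, \<lambda>i. b0 i / b e, r / b e)"
    have "form_value E q (z(e := y)) f = of_real (b e) * (form_value E q z f' + \<i> * of_real y)" for q z y
    proof -
      have "x + \<i> * of_real (b e * y) = of_real (b e) * (x / of_real (b e) + \<i> * of_real y)" for x
        using 2(2) by (simp add: field_simps)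
      then show ?thesis unfolding upd f'_def form_value_scale using 2(1) by (simp only: if_True)
    qed
    then have eq2: "upper E q z fs y * lower E q z gs y * (1 / form_value E q (z(e := y)) f * g q (z(e := y)))
      = 1 / of_real (b e) * (upper E q z (f' # fs) y * lower E q z gs y * g q (z(e := y)))" for q z y
      unfolding upper_def lower_def list.map prod_list.Cons by (simp only: alg(1))
    have "positive_form E f'" unfolding f'_def by (rule pos'[OF 2(2)])
    then have "list_all (positive_form E) (f' # fs)" "length (f' # fs) + length gs \<ge> 2" using divide.prems by simp_all
    note IH = divide.IH[OF this(1) divide.prems(2) this(2)]
    show ?thesis unfolding eq2 integral_mult_right_zero
    proof (intro conjI allI impI)
      show "positive_fraction E (\<lambda>q z. 1 / of_real (b e) * (LINT y|lborel. upper E q z (f' # fs) y * lower E q z gs y * g q (z(e := y))))"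
        by (rule positive_fraction_mult_const[OF IH[THEN conjunct1]])
      show "integrable lborel (\<lambda>y. 1 / of_real (b e) * (upper E q z (f' # fs) y * lower E q z gs y * g q (z(e := y))))"
        if "positive_on E q" for q z
        by (rule integrable_mult_right) (use IH that in blast)
    qed
  next
    case 3
    define f' where "f' = (\<lambda>i. a i / (- b e), \<lambda>i. b0 i / (- b e), r / (- b e))"
    have "form_value E q (z(e := y)) f = of_real (- b e) * (form_value E q z f' - \<i> * of_real y)" for q z y
    proof -
      have "x + \<i> * of_real (b e * y) = of_real (- b e) * (x / of_real (- b e) - \<i> * of_real y)" for x
        using 3(2) by (simp add: field_simps)
      then show ?thesis unfolding upd f'_def form_value_scale using 3(1) by (simp only: if_True)
    qed
    then have eq2: "upper E q z fs y * lower E q z gs y * (1 / form_value E q (z(e := y)) f * g q (z(e := y)))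
      = 1 / of_real (- b e) * (upper E q z fs y * lower E q z (f' # gs) y * g q (z(e := y)))" for q z y
      unfolding upper_def lower_def list.map prod_list.Cons by (simp only: alg(2))
    have "positive_form E f'" unfolding f'_def by (rule pos') (use 3 in simp)
    then have "list_all (positive_form E) (f' # gs)" "length fs + length (f' # gs) \<ge> 2" using divide.prems by simp_all
    note IH = divide.IH[OF divide.prems(1) this]
    show ?thesis unfolding eq2 integral_mult_right_zero
    proof (intro conjI allI impI)
      show "positive_fraction E (\<lambda>q z. 1 / of_real (- b e) * (LINT y|lborel. upper E q z fs y * lower E q z (f' # gs) y * g q (z(e := y))))"
        by (rule positive_fraction_mult_const[OF IH[THEN conjunct1]])
      show "integrable lborel (\<lambda>y. 1 / of_real (- b e) * (upper E q z fs y * lower E q z (f' # gs) y * g q (z(e := y))))"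
        if "positive_on E q" for q z
        by (rule integrable_mult_right) (use IH that in blast)
    qed
  qed
next
  case (cong g h)
  note IH = cong.IH[OF cong.prems]
  show ?case
  proof (intro conjI allI impI)
    show "positive_fraction E (\<lambda>q z. LINT y|lborel. upper E q z fs y * lower E q z gs y * h q (z(e := y)))"
      by (rule positive_fraction.cong[OF IH[THEN conjunct1]]) (simp only: cong.hyps(2))
    show "integrable lborel (\<lambda>y. upper E q z fs y * lower E q z gs y * h q (z(e := y)))" if "positive_on E q" for q z
      using IH that by (simp only: cong.hyps(2)[OF that])
  qed
qed

lemma positive_fraction_prod:
  assumes "finite A" "\<And>i. i \<in> A \<Longrightarrow> positive_fraction E (g i)"
  shows "positive_fraction E (\<lambda>q z. \<Prod>i\<in>A. g i q z)"
  using assms by (induction A rule: finite_induct) (auto intro: positive_fraction.const positive_fraction_mult)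

definition rational_on :: "'e set \<Rightarrow> (('e \<Rightarrow> real) \<Rightarrow> real) \<Rightarrow> bool" where
  "rational_on E f \<longleftrightarrow> (\<exists>P Q. rational_expression E f P Q)"

lemma rational_on_const: "rational_on E (\<lambda>q. c)"
  unfolding rational_on_def rational_expression_def
  by (rule exI[of _ "\<lambda>q. c"], rule exI[of _ "\<lambda>q. 1"]) (auto intro: polynomial_in.intros)

lemma rational_on_add:
  assumes "rational_on E f" "rational_on E g"
  shows "rational_on E (\<lambda>q. f q + g q)"
proof -
  obtain P Q P' Q' where "rational_expression E f P Q" "rational_expression E g P' Q'"
    using assms by (auto simp: rational_on_def)
  then show ?thesis unfolding rational_on_def rational_expression_def
    by (intro exI[of _ "\<lambda>q. P q * Q' q + P' q * Q q"] exI[of _ "\<lambda>q. Q q * Q' q"])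
      (auto intro!: polynomial_in.intros simp: add_frac_eq)
qed

lemma rational_on_mult:
  assumes "rational_on E f" "rational_on E g"
  shows "rational_on E (\<lambda>q. f q * g q)"
proof -
  obtain P Q P' Q' where "rational_expression E f P Q" "rational_expression E g P' Q'"
    using assms by (auto simp: rational_on_def)
  then show ?thesis unfolding rational_on_def rational_expression_def
    by (intro exI[of _ "\<lambda>q. P q * P' q"] exI[of _ "\<lambda>q. Q q * Q' q"]) (auto intro!: polynomial_in.intros)
qed

lemma rational_on_cong:
  "rational_on E f \<Longrightarrow> (\<And>q. positive_on E q \<Longrightarrow> g q = f q) \<Longrightarrow> rational_on E g"
  by (auto simp: rational_on_def rational_expression_def)

lemma rational_on_divide:
  assumes "polynomial_in E P" "polynomial_in E Q" "\<And>q. positive_on E q \<Longrightarrow> Q q \<noteq> 0"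
  shows "rational_on E (\<lambda>q. P q / Q q)"
  using assms by (auto simp: rational_on_def rational_expression_def)

lemma polynomial_in_sum:
  "finite A \<Longrightarrow> (\<And>i. i \<in> A \<Longrightarrow> polynomial_in E (f i)) \<Longrightarrow> polynomial_in E (\<lambda>q. \<Sum>i\<in>A. f i q)"
  by (induction A rule: finite_induct) (auto intro: polynomial_in.intros)

text \<open>For fixed \<open>z\<close> the inverse of u + i v has the denominator u^2 + v^2, where u
  is linear in \<open>q\<close> and positive at positive \<open>q\<close>.\<close>

lemma positive_fraction_rational:
  assumes E: "finite E" and g: "positive_fraction E g"
  shows "rational_on E (\<lambda>q. Re (g q z)) \<and> rational_on E (\<lambda>q. Im (g q z))"
  using g
proof (induction rule: positive_fraction.induct)
  case (const c)
  then show ?case by (simp add: rational_on_const)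
next
  case (add g h)
  then show ?case by (simp add: rational_on_add)
next
  case (divide g f)
  obtain a b r where f: "f = (a, b, r)" by (cases f)
  define u where "u q = (\<Sum>i\<in>E. a i * q i)" for q
  define v where "v = r + (\<Sum>i\<in>E. b i * z i)"
  have fv: "form_value E q z f = Complex (u q) v" for q
    by (simp add: f form_value_def u_def v_def Complex_eq)
  have up: "u q > 0" if "positive_on E q" for q using Re_form_value_pos[OF E divide.hyps(2) that, of z] by (simp add: fv)
  have u: "polynomial_in E u" unfolding u_def using E by (intro polynomial_in_sum polynomial_in.intros)
  then have u2: "polynomial_in E (\<lambda>q. (u q)\<^sup>2 + v\<^sup>2)" unfolding power2_eq_square by (intro polynomial_in.intros)
  have nz: "(u q)\<^sup>2 + v\<^sup>2 \<noteq> 0" if "positive_on E q" for q using up[OF that] by (simp add: add_nonneg_eq_0_iff)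
  have re: "rational_on E (\<lambda>q. Re (1 / form_value E q z f))"
    by (rule rational_on_cong[OF rational_on_divide[OF u u2 nz]]) (simp_all add: fv Re_divide)
  have im: "rational_on E (\<lambda>q. Im (1 / form_value E q z f))"
    by (rule rational_on_cong[OF rational_on_divide[OF polynomial_in.const[of E "- v"] u2 nz]]) (simp_all add: fv Im_divide)
  have neg: "rational_on E (\<lambda>q. - h q)" if "rational_on E h" for h
    using rational_on_mult[OF rational_on_const[of E "-1"] that] by simp
  have R: "rational_on E (\<lambda>q. Re (1 / form_value E q z f) * Re (g q z) + - (Im (1 / form_value E q z f) * Im (g q z)))"
    using divide.IH re im by (intro rational_on_add rational_on_mult neg) auto
  have I: "rational_on E (\<lambda>q. Re (1 / form_value E q z f) * Im (g q z) + Im (1 / form_value E q z f) * Re (g q z))"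
    using divide.IH re im by (intro rational_on_add rational_on_mult) auto
  show ?case using R I by (simp only: complex.sel times_complex.sel diff_conv_add_uminus)
next
  case (cong g h)
  then show ?case by (auto intro: rational_on_cong)
qed

subsection \<open>Reflections and analytic continuation\<close>

lemma sum_Pow_insert:
  assumes "finite A" "i \<notin> A"
  shows "(\<Sum>B\<in>Pow (insert i A). g B) = (\<Sum>B\<in>Pow A. g B + g (insert i B))"
proof -
  have "inj_on (insert i) (Pow A)" using assms(2) by (auto simp: inj_on_def)
  then have "(\<Sum>B\<in>insert i ` Pow A. g B) = (\<Sum>B\<in>Pow A. g (insert i B))" by (simp add: sum.reindex)
  moreover have "(\<Sum>B\<in>Pow (insert i A). g B) = (\<Sum>B\<in>Pow A. g B) + (\<Sum>B\<in>insert i ` Pow A. g B)"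
    unfolding Pow_insert using assms by (intro sum.union_disjoint) auto
  ultimately show ?thesis by (simp add: sum.distrib)
qed

text \<open>Write \<open>A\<close> as \<open>B\<close> and a disjoint part \<open>D\<close>; summing
  the products of \<open>n\<close> over all \<open>D\<close> gives the factors 1 + n.\<close>

lemma sum_Pow_Pow:
  fixes n :: "'e \<Rightarrow> 'c::comm_ring_1"
  assumes C: "finite C"
  shows "(\<Sum>A\<in>Pow C. (\<Prod>i\<in>A. n i) * (\<Sum>B\<in>Pow A. g B)) = (\<Sum>B\<in>Pow C. ((\<Prod>i\<in>B. n i) * (\<Prod>i\<in>C - B. 1 + n i)) * g B)"
proof -
  have fin: "finite A" if "A \<in> Pow C" for A by (rule finite_subset[OF _ C]) (use that in simp)
  have "(\<Sum>A\<in>Pow C. (\<Prod>i\<in>A. n i) * (\<Sum>B\<in>Pow A. g B)) = (\<Sum>(A, B)\<in>(SIGMA A:Pow C. Pow A). (\<Prod>i\<in>A. n i) * g B)"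
    unfolding sum_distrib_left using C fin by (intro sum.Sigma) auto
  also have "\<dots> = (\<Sum>(B, D)\<in>(SIGMA B:Pow C. Pow (C - B)). (\<Prod>i\<in>B \<union> D. n i) * g B)"
    by (rule sum.reindex_bij_witness[where i = "\<lambda>(B, D). (B \<union> D, B)" and j = "\<lambda>(A, B). (B, A - B)"])
      (auto simp: Un_absorb1)
  also have "\<dots> = (\<Sum>B\<in>Pow C. \<Sum>D\<in>Pow (C - B). (\<Prod>i\<in>B \<union> D. n i) * g B)"
    using C by (intro sum.Sigma[symmetric]) auto
  also have "\<dots> = (\<Sum>B\<in>Pow C. ((\<Prod>i\<in>B. n i) * (\<Prod>i\<in>C - B. 1 + n i)) * g B)"
  proof (rule sum.cong[OF refl])
    fix B assume B: "B \<in> Pow C"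
    have "(\<Prod>i\<in>C - B. 1 + n i) = (\<Prod>i\<in>C - B. n i + 1)" by (simp add: add.commute)
    also have "\<dots> = (\<Sum>D\<in>Pow (C - B). (\<Prod>i\<in>D. n i))" using C by (subst prod_add) simp_all
    finally have "((\<Prod>i\<in>B. n i) * (\<Prod>i\<in>C - B. 1 + n i)) * g B = (\<Sum>D\<in>Pow (C - B). (\<Prod>i\<in>B. n i) * (\<Prod>i\<in>D. n i) * g B)"
      by (simp add: sum_distrib_left sum_distrib_right)
    also have "\<dots> = (\<Sum>D\<in>Pow (C - B). (\<Prod>i\<in>B \<union> D. n i) * g B)"
    proof (rule sum.cong[OF refl])
      fix D assume "D \<in> Pow (C - B)"
      then have "(\<Prod>i\<in>B \<union> D. n i) = (\<Prod>i\<in>B. n i) * (\<Prod>i\<in>D. n i)"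
        using B fin[of B] fin[of D] by (intro prod.union_disjoint) auto
      then show "(\<Prod>i\<in>B. n i) * (\<Prod>i\<in>D. n i) * g B = (\<Prod>i\<in>B \<union> D. n i) * g B" by simp
    qed
    finally show "(\<Sum>D\<in>Pow (C - B). (\<Prod>i\<in>B \<union> D. n i) * g B) = ((\<Prod>i\<in>B. n i) * (\<Prod>i\<in>C - B. 1 + n i)) * g B" ..
  qed
  finally show ?thesis .
qed

lemma flip_insert: "i \<notin> B \<Longrightarrow> flip (insert i B) q = (flip B q)(i := - flip B q i)"
  by (auto simp: flip_def fun_eq_iff)

lemma flip_update: "i \<notin> B \<Longrightarrow> flip B (q(i := - q i)) = flip (insert i B) q"
  by (auto simp: flip_def fun_eq_iff)

lemma flip_flip: "flip B (flip B q) = q"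
  by (auto simp: flip_def fun_eq_iff)

lemma thermal_prod_expand:
  assumes "finite A"
  shows "thermal_prod A f q = (\<Prod>i\<in>A. n_b (q i)) * (\<Sum>B\<in>Pow A. (-1) ^ card B * f (flip B q))"
  using assms
proof (induction A arbitrary: q rule: finite_induct)
  case empty
  then show ?case by (simp add: thermal_prod_empty)
next
  case (insert i A)
  have n: "(\<Prod>j\<in>A. n_b ((q(i := - q i)) j)) = (\<Prod>j\<in>A. n_b (q j))"
    using insert.hyps by (intro prod.cong) auto
  have "thermal_prod (insert i A) f q = n_b (q i) * (thermal_prod A f q - thermal_prod A f (q(i := - q i)))"
    by (simp add: thermal_prod_insert[OF insert.hyps] thermal_def reflection_def)
  also have "\<dots> = n_b (q i) * ((\<Prod>j\<in>A. n_b (q j)) * ((\<Sum>B\<in>Pow A. (-1) ^ card B * f (flip B q)) - (\<Sum>B\<in>Pow A. (-1) ^ card B * f (flip B (q(i := - q i))))))"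
    unfolding insert.IH n by (simp add: right_diff_distrib)
  also have "(\<Sum>B\<in>Pow A. (-1) ^ card B * f (flip B q)) - (\<Sum>B\<in>Pow A. (-1) ^ card B * f (flip B (q(i := - q i))))
    = (\<Sum>B\<in>Pow A. (-1) ^ card B * f (flip B q) + (-1) ^ card (insert i B) * f (flip (insert i B) q))"
    unfolding sum_subtractf[symmetric]
  proof (rule sum.cong[OF refl])
    fix B assume "B \<in> Pow A"
    then have "i \<notin> B" "finite B" using insert.hyps finite_subset[of B A] by auto
    then show "(-1) ^ card B * f (flip B q) - (-1) ^ card B * f (flip B (q(i := - q i)))
      = (-1) ^ card B * f (flip B q) + (-1) ^ card (insert i B) * f (flip (insert i B) q)"
      by (simp add: flip_update)
  qed
  also have "\<dots> = (\<Sum>B\<in>Pow (insert i A). (-1) ^ card B * f (flip B q))"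
    by (rule sum_Pow_insert[OF insert.hyps, symmetric])
  finally show ?case using insert.hyps by (simp add: mult.assoc)
qed

lemma polynomial_in_prod:
  "finite A \<Longrightarrow> (\<And>i. i \<in> A \<Longrightarrow> polynomial_in E (f i)) \<Longrightarrow> polynomial_in E (\<lambda>q. \<Prod>i\<in>A. f i q)"
  by (induction A rule: finite_induct) (auto intro: polynomial_in.intros)

lemma polynomial_in_flip: "polynomial_in E f \<Longrightarrow> polynomial_in E (\<lambda>q. f (flip B q))"
proof (induction rule: polynomial_in.induct)
  case (var i)
  have "polynomial_in E (\<lambda>q. (if i \<in> B then -1 else 1) * q i)"
    using var by (intro polynomial_in.intros)
  moreover have "(\<lambda>q. flip B q i) = (\<lambda>q. (if i \<in> B then -1 else 1) * q i)"
    by (auto simp: flip_def fun_eq_iff)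
  ultimately show ?case by simp
qed (auto intro: polynomial_in.intros)

text \<open>On the line through \<open>a\<close> and \<open>b\<close> both functions become nonzero
  polynomials in one variable, and these form an integral domain.\<close>

lemma polynomial_in_mult_nonzero:
  assumes f: "polynomial_in E f" "f a \<noteq> 0" and g: "polynomial_in E g" "g b \<noteq> 0"
  shows "\<exists>c. f c * g c \<noteq> 0"
proof -
  define d where "d i = b i - a i" for i
  obtain p where p: "\<And>t. f (\<lambda>i. a i + t * d i) = poly p t" using polynomial_in_on_line[OF f(1), of a d] by auto
  obtain r where r: "\<And>t. g (\<lambda>i. a i + t * d i) = poly r t" using polynomial_in_on_line[OF g(1), of a d] by auto
  have "poly p 0 \<noteq> 0" using p[of 0] f(2) by simp
  moreover have "poly r 1 \<noteq> 0" using r[of 1] g(2) by (simp add: d_def)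
  ultimately have "p * r \<noteq> 0" by auto
  then obtain t where "poly (p * r) t \<noteq> 0" by (metis poly_all_0_iff_0)
  then have "f (\<lambda>i. a i + t * d i) * g (\<lambda>i. a i + t * d i) \<noteq> 0" by (simp add: p r)
  then show ?thesis by blast
qed

lemma polynomial_in_prod_nonzero:
  assumes "finite A" "\<And>i. i \<in> A \<Longrightarrow> polynomial_in E (f i)" "\<And>i. i \<in> A \<Longrightarrow> \<exists>c. f i c \<noteq> 0"
  shows "\<exists>c. (\<Prod>i\<in>A. f i c) \<noteq> 0"
  using assms
proof (induction A rule: finite_induct)
  case (insert i A)
  obtain a where a: "f i a \<noteq> 0" using insert.prems(2)[of i] by auto
  obtain b where b: "(\<Prod>i\<in>A. f i b) \<noteq> 0" using insert by auto
  have "\<exists>c. f i c * (\<Prod>i\<in>A. f i c) \<noteq> 0"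
    using insert.hyps insert.prems(1) a b by (intro polynomial_in_mult_nonzero polynomial_in_prod) auto
  then show ?case using insert.hyps by simp
qed simp

text \<open>Turns genericity into the nonvanishing of one polynomial: the bound on the coefficients
  leaves finitely many linear conditions, and extensional functions list each of them once.\<close>

definition generic_poly :: "'e set \<Rightarrow> ('e \<Rightarrow> real) \<Rightarrow> real" where
  "generic_poly E q = (\<Prod>c\<in>{c \<in> E \<rightarrow>\<^sub>E {-2..2::int}. \<exists>i\<in>E. c i \<noteq> 0}. \<Sum>i\<in>E. of_int (c i) * q i)"

lemma finite_coeffs: "finite E \<Longrightarrow> finite {c \<in> E \<rightarrow>\<^sub>E {-2..2::int}. \<exists>i\<in>E. c i \<noteq> 0}"
  by (rule finite_subset[OF _ finite_PiE[of E "\<lambda>_. {-2..2}"]]) auto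

lemma generic_iff:
  assumes "finite E"
  shows "generic E q \<longleftrightarrow> generic_poly E q \<noteq> 0"
proof -
  define X where "X = {c \<in> E \<rightarrow>\<^sub>E {-2..2::int}. \<exists>i\<in>E. c i \<noteq> 0}"
  have "finite X" unfolding X_def by (rule finite_coeffs[OF assms])
  then have zero: "generic_poly E q = 0 \<longleftrightarrow> (\<exists>c\<in>X. (\<Sum>i\<in>E. of_int (c i) * q i) = 0)"
    unfolding generic_poly_def X_def by (rule prod_zero_iff)
  show ?thesis
  proof
    assume gen: "generic E q"
    have "(\<Sum>i\<in>E. of_int (c i) * q i) \<noteq> 0" if "c \<in> X" for c
    proof -
      have c: "c \<in> E \<rightarrow>\<^sub>E {-2..2}" "\<exists>i\<in>E. c i \<noteq> 0" using that by (simp_all only: X_def mem_Collect_eq)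
      then obtain j where j: "j \<in> E" "c j \<noteq> 0" by blast
      show ?thesis by (rule genericD[where c = c, OF gen _ j]) (rule PiE_mem[OF c(1)])
    qed
    then show "generic_poly E q \<noteq> 0" unfolding zero by blast
  next
    assume "generic_poly E q \<noteq> 0"
    then have nz: "(\<Sum>i\<in>E. of_int (c i) * q i) \<noteq> 0" if "c \<in> X" for c using that unfolding zero by blast
    show "generic E q" unfolding generic_def
    proof (intro allI impI, elim conjE)
      fix c :: "'a \<Rightarrow> int" assume c: "\<forall>i\<in>E. c i \<in> {-2..2}" "\<exists>i\<in>E. c i \<noteq> 0"
      have "restrict c E \<in> E \<rightarrow>\<^sub>E {-2..2}" using c(1) by (simp only: restrict_PiE_iff)
      moreover have "\<exists>i\<in>E. restrict c E i \<noteq> 0" using c(2) by (simp cong: bex_cong)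
      ultimately have "restrict c E \<in> X" by (simp only: X_def mem_Collect_eq simp_thms)
      from nz[OF this] show "(\<Sum>i\<in>E. of_int (c i) * q i) \<noteq> 0" by (simp cong: sum.cong)
    qed
  qed
qed

lemma polynomial_in_generic_poly:
  assumes E: "finite E"
  shows "polynomial_in E (generic_poly E)" "\<exists>c. generic_poly E c \<noteq> 0"
proof -
  have lin: "polynomial_in E (\<lambda>q. \<Sum>i\<in>E. of_int (c i) * q i)" for c :: "'a \<Rightarrow> int"
    using E by (intro polynomial_in_sum polynomial_in.intros)
  show "polynomial_in E (generic_poly E)" unfolding generic_poly_def[abs_def]
    by (intro polynomial_in_prod finite_coeffs E lin)
  show "\<exists>c. generic_poly E c \<noteq> 0" unfolding generic_poly_def
  proof (rule polynomial_in_prod_nonzero[OF finite_coeffs[OF E] lin])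
    fix c assume "c \<in> {c \<in> E \<rightarrow>\<^sub>E {-2..2::int}. \<exists>i\<in>E. c i \<noteq> 0}"
    then obtain i where i: "i \<in> E" "c i \<noteq> 0" by auto
    have "(\<Sum>j\<in>E. of_int (c j) * (if j = i then 1 else 0 :: real)) = of_int (c i)"
      using E i by (simp add: if_distrib[of "\<lambda>t. _ * t"] cong: if_cong)
    then show "\<exists>q. (\<Sum>j\<in>E. of_int (c j) * q j) \<noteq> (0 :: real)"
      using i by (intro exI[of _ "\<lambda>j. if j = i then 1 else 0"]) simp
  qed
qed

lemma generic_flip:
  assumes "generic E q"
  shows "generic E (flip B q)"
  unfolding generic_def
proof (intro allI impI)
  fix c :: "'a \<Rightarrow> int" assume c: "(\<forall>i\<in>E. c i \<in> {-2..2}) \<and> (\<exists>i\<in>E. c i \<noteq> 0)"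
  then obtain j where j: "j \<in> E" "c j \<noteq> 0" by auto
  have "(\<Sum>i\<in>E. of_int (if i \<in> B then - c i else c i) * q i) \<noteq> 0"
    by (rule genericD[OF assms _ j(1)]) (use c j in auto)
  also have "(\<Sum>i\<in>E. of_int (if i \<in> B then - c i else c i) * q i) = (\<Sum>i\<in>E. of_int (c i) * flip B q i)"
    by (intro sum.cong) (auto simp: flip_def)
  finally show "(\<Sum>i\<in>E. of_int (c i) * flip B q i) \<noteq> 0" .
qed

definition complex_polynomial_in :: "'e set \<Rightarrow> (('e \<Rightarrow> real) \<Rightarrow> complex) \<Rightarrow> bool" where
  "complex_polynomial_in E f \<longleftrightarrow> polynomial_in E (\<lambda>q. Re (f q)) \<and> polynomial_in E (\<lambda>q. Im (f q))"

lemma polynomial_in_minus: "polynomial_in E f \<Longrightarrow> polynomial_in E (\<lambda>q. - f q)"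
  using polynomial_in.mult[OF polynomial_in.const[of E "-1"]] by simp

lemma complex_polynomial_in_add:
  "complex_polynomial_in E f \<Longrightarrow> complex_polynomial_in E g \<Longrightarrow> complex_polynomial_in E (\<lambda>q. f q + g q)"
  by (auto simp: complex_polynomial_in_def intro: polynomial_in.intros)

lemma complex_polynomial_in_mult:
  "complex_polynomial_in E f \<Longrightarrow> complex_polynomial_in E g \<Longrightarrow> complex_polynomial_in E (\<lambda>q. f q * g q)"
  by (auto simp: complex_polynomial_in_def diff_conv_add_uminus simp del: add_uminus_conv_diff
      intro!: polynomial_in.intros polynomial_in_minus)

lemma complex_polynomial_in_const: "complex_polynomial_in E (\<lambda>q. c)"
  by (simp add: complex_polynomial_in_def polynomial_in.const)

lemma complex_polynomial_in_of_real: "polynomial_in E f \<Longrightarrow> complex_polynomial_in E (\<lambda>q. of_real (f q))"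
  by (simp add: complex_polynomial_in_def polynomial_in.const)

text \<open>Weaker than \<open>rational_expression\<close> in that the denominator may vanish at
  positive points that are not generic, as happens for single amplitudes, but valid for all signs of
  \<open>q\<close>.\<close>

definition generic_rational :: "'e set \<Rightarrow> (('e \<Rightarrow> real) \<Rightarrow> complex) \<Rightarrow> bool" where
  "generic_rational E f \<longleftrightarrow> (\<exists>P Q. complex_polynomial_in E P \<and> complex_polynomial_in E Q \<and>
     (\<forall>q. generic E q \<longrightarrow> Q q \<noteq> 0 \<and> f q = P q / Q q))"

lemma generic_rational_mult:
  assumes "generic_rational E f" "generic_rational E g"
  shows "generic_rational E (\<lambda>q. f q * g q)"
proof -
  obtain P Q P' Q' where "complex_polynomial_in E P" "complex_polynomial_in E Q" "complex_polynomial_in E P'" "complex_polynomial_in E Q'"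
    "\<And>q. generic E q \<Longrightarrow> Q q \<noteq> 0 \<and> f q = P q / Q q" "\<And>q. generic E q \<Longrightarrow> Q' q \<noteq> 0 \<and> g q = P' q / Q' q"
    using assms unfolding generic_rational_def by metis
  then show ?thesis unfolding generic_rational_def
    by (intro exI[of _ "\<lambda>q. P q * P' q"] exI[of _ "\<lambda>q. Q q * Q' q"]) (simp add: complex_polynomial_in_mult)
qed

lemma generic_rational_add:
  assumes "generic_rational E f" "generic_rational E g"
  shows "generic_rational E (\<lambda>q. f q + g q)"
proof -
  obtain P Q P' Q' where "complex_polynomial_in E P" "complex_polynomial_in E Q" "complex_polynomial_in E P'" "complex_polynomial_in E Q'"
    "\<And>q. generic E q \<Longrightarrow> Q q \<noteq> 0 \<and> f q = P q / Q q" "\<And>q. generic E q \<Longrightarrow> Q' q \<noteq> 0 \<and> g q = P' q / Q' q"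
    using assms unfolding generic_rational_def by metis
  then show ?thesis unfolding generic_rational_def
    by (intro exI[of _ "\<lambda>q. P q * Q' q + P' q * Q q"] exI[of _ "\<lambda>q. Q q * Q' q"])
      (simp add: complex_polynomial_in_mult complex_polynomial_in_add add_frac_eq)
qed

lemma generic_rational_const: "generic_rational E (\<lambda>q. c)"
  unfolding generic_rational_def
  by (intro exI[of _ "\<lambda>q. c"] exI[of _ "\<lambda>q. 1"]) (simp add: complex_polynomial_in_const)

lemma generic_rational_divide:
  assumes "complex_polynomial_in E Q" "\<And>q. generic E q \<Longrightarrow> Q q \<noteq> 0"
  shows "generic_rational E (\<lambda>q. c / Q q)"
  unfolding generic_rational_def using assms
  by (intro exI[of _ "\<lambda>q. c"] exI[of _ Q]) (simp add: complex_polynomial_in_const)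

lemma generic_rational_prod:
  "finite A \<Longrightarrow> (\<And>i. i \<in> A \<Longrightarrow> generic_rational E (f i)) \<Longrightarrow> generic_rational E (\<lambda>q. \<Prod>i\<in>A. f i q)"
  by (induction A rule: finite_induct) (auto intro: generic_rational_const generic_rational_mult)

lemma generic_rational_sum:
  "finite A \<Longrightarrow> (\<And>i. i \<in> A \<Longrightarrow> generic_rational E (f i)) \<Longrightarrow> generic_rational E (\<lambda>q. \<Sum>i\<in>A. f i q)"
  by (induction A rule: finite_induct) (auto intro: generic_rational_const generic_rational_add)

text \<open>The identity, cleared of denominators, is known at generic positive points only.
  Multiplied by \<open>generic_poly\<close> it holds at all positive points, hence everywhere by
  \<open>polynomial_in_zero\<close>, and the extra factor can be cancelled at generic
  \<open>q\<close>.\<close>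

lemma generic_rational_continuation:
  assumes E: "finite E" and f: "rational_expression E f P Q" and F: "generic_rational E F"
    and eq: "\<And>q. positive_on E q \<Longrightarrow> generic E q \<Longrightarrow> of_real (f q) = F q"
    and q: "generic E q" "Q q \<noteq> 0"
  shows "of_real (P q / Q q) = F q"
proof -
  obtain P' Q' where PQ: "complex_polynomial_in E P'" "complex_polynomial_in E Q'"
    "\<And>q. generic E q \<Longrightarrow> Q' q \<noteq> 0 \<and> F q = P' q / Q' q"
    using F unfolding generic_rational_def by metis
  define H where "H q = of_real (P q) * Q' q + (-1) * (of_real (Q q) * P' q)" for q
  have H: "complex_polynomial_in E H"
    using f PQ(1,2) unfolding H_def rational_expression_def
    by (intro complex_polynomial_in_add complex_polynomial_in_mult complex_polynomial_in_const complex_polynomial_in_of_real) auto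
  have H0: "H p = 0" if p: "positive_on E p" "generic E p" for p
  proof -
    have "Q p \<noteq> 0" "f p = P p / Q p" using f p(1) unfolding rational_expression_def by auto
    then have "complex_of_real (P p) / of_real (Q p) = P' p / Q' p" using eq[OF p] PQ(3)[OF p(2)] by simp
    then show ?thesis using \<open>Q p \<noteq> 0\<close> PQ(3)[OF p(2)] by (simp add: H_def field_simps)
  qed
  have gp: "generic_poly E p = 0" if "\<not> generic E p" for p using that generic_iff[OF E] by blast
  have "Re (H q) * generic_poly E q = 0"
  proof (rule polynomial_in_zero[OF _ E, of "\<lambda>q. Re (H q) * generic_poly E q"])
    show "polynomial_in E (\<lambda>q. Re (H q) * generic_poly E q)"
      using H polynomial_in_generic_poly(1)[OF E] unfolding complex_polynomial_in_def by (intro polynomial_in.mult) auto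
    show "Re (H p) * generic_poly E p = 0" if "positive_on E p" for p
      using H0[OF that] gp[of p] by (cases "generic E p") simp_all
  qed
  moreover have "Im (H q) * generic_poly E q = 0"
  proof (rule polynomial_in_zero[OF _ E, of "\<lambda>q. Im (H q) * generic_poly E q"])
    show "polynomial_in E (\<lambda>q. Im (H q) * generic_poly E q)"
      using H polynomial_in_generic_poly(1)[OF E] unfolding complex_polynomial_in_def by (intro polynomial_in.mult) auto
    show "Im (H p) * generic_poly E p = 0" if "positive_on E p" for p
      using H0[OF that] gp[of p] by (cases "generic E p") simp_all
  qed
  moreover have "generic_poly E q \<noteq> 0" using q generic_iff[OF E] by blast
  ultimately have "H q = 0" by (simp add: complex_eq_iff)
  then show ?thesis using q PQ(3)[OF q(1)] by (simp add: H_def field_simps)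
qed

context matsubara_graph
begin

text \<open>The denominator of a tree line \<open>j\<close> factors into x + i q and x - i q. The
  imaginary part of each is a combination of the \<open>q i\<close> in which \<open>q j\<close> has
  coefficient 1 or -1, so it cannot vanish at generic points.\<close>

lemma generic_rational_amplitude:
  assumes A: "tree A" and sg: "\<And>l. l \<in> arcs G - A \<Longrightarrow> sg l = 1 \<or> sg l = -1"
  shows "generic_rational (arcs G) (amplitude N sg A)"
proof -
  have AG: "A \<subseteq> arcs G" by (rule treeD[OF A])
  have finA: "finite A" by (rule finite_subset[OF AG finite_arcs])
  have var: "complex_polynomial_in (arcs G) (\<lambda>q. of_real (q l))" if "l \<in> arcs G" for l
    using that by (intro complex_polynomial_in_of_real polynomial_in.var)
  have 1: "generic_rational (arcs G) (\<lambda>q. of_real (pi / q l))" if l: "l \<in> arcs G - A" for l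
    unfolding of_real_divide
    using l generic_nonzero[OF _ finite_arcs] by (intro generic_rational_divide var) auto
  have 2: "generic_rational (arcs G) (\<lambda>q. 1 / ((extend N A (\<lambda>l. \<i> * of_int (sg l) * of_real (q l)) j)\<^sup>2 + (of_real (q j))\<^sup>2))"
    if j: "j \<in> A" for j
  proof (rule generic_rational_divide)
    have ext: "extend N A (\<lambda>l. \<i> * of_int (sg l) * of_real (q l)) j =
      of_int (tree_const N A j) + (\<Sum>l\<in>arcs G - A. (of_int (tree_coeff A j l) * (\<i> * of_int (sg l))) * of_real (q l))" for q
      using j by (simp add: extend_def mult.assoc)
    have sum: "complex_polynomial_in (arcs G) (\<lambda>q. \<Sum>l\<in>S. (of_int (tree_coeff A j l) * (\<i> * of_int (sg l))) * of_real (q l))"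
      if "finite S" "S \<subseteq> arcs G" for S
      using that by (induction S rule: finite_induct)
        (auto intro!: complex_polynomial_in_const complex_polynomial_in_add complex_polynomial_in_mult var)
    show "complex_polynomial_in (arcs G) (\<lambda>q. (extend N A (\<lambda>l. \<i> * of_int (sg l) * of_real (q l)) j)\<^sup>2 + (of_real (q j))\<^sup>2)"
      unfolding ext power2_eq_square using j AG
      by (intro complex_polynomial_in_add complex_polynomial_in_mult complex_polynomial_in_const sum var) auto
    fix q :: "'e \<Rightarrow> real" assume gen: "generic (arcs G) q"
    define x where "x = extend N A (\<lambda>l. \<i> * of_int (sg l) * complex_of_real (q l)) j"
    have Imx: "Im x = (\<Sum>l\<in>arcs G - A. of_int (tree_coeff A j l * sg l) * q l)"
      unfolding x_def ext by (simp add: Im_sum mult_ac)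
    have ne: "Im x + of_int s * q j \<noteq> 0" if s: "s = 1 \<or> s = -1" for s :: int
    proof -
      have "(\<Sum>i\<in>arcs G. of_int (if i \<in> A then (if i = j then s else 0) else tree_coeff A j i * sg i) * q i) \<noteq> 0"
      proof (rule genericD[OF gen])
        show "(if i \<in> A then (if i = j then s else 0) else tree_coeff A j i * sg i) \<in> {-2..2}" if "i \<in> arcs G" for i
          using tree_coeff_cases[OF A j that] sg[of i] s that by auto
        show "j \<in> arcs G" "(if j \<in> A then (if j = j then s else 0) else tree_coeff A j j * sg j) \<noteq> 0"
          using j AG s by auto
      qed
      also have "(\<Sum>i\<in>arcs G. of_int (if i \<in> A then (if i = j then s else 0) else tree_coeff A j i * sg i) * q i)
        = (\<Sum>i\<in>arcs G - A. of_int (tree_coeff A j i * sg i) * q i) + (\<Sum>i\<in>A. if i = j then of_int s * q i else 0)"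
        by (subst sum.subset_diff[OF AG finite_arcs]) (intro arg_cong2[where f = "(+)"] sum.cong; auto)
      also have "\<dots> = Im x + of_int s * q j" using j finA by (simp add: Imx)
      finally show ?thesis .
    qed
    have "x\<^sup>2 + (of_real (q j))\<^sup>2 = (x + \<i> * of_real (q j)) * (x - \<i> * of_real (q j))"
      by (simp add: power2_eq_square algebra_simps)
    moreover have "x + \<i> * of_real (q j) \<noteq> 0" using ne[of 1] by (auto simp: complex_eq_iff)
    moreover have "x - \<i> * of_real (q j) \<noteq> 0" using ne[of "-1"] by (auto simp: complex_eq_iff)
    ultimately show "(extend N A (\<lambda>l. \<i> * of_int (sg l) * of_real (q l)) j)\<^sup>2 + (complex_of_real (q j))\<^sup>2 \<noteq> 0"
      unfolding x_def by simp
  qed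
  show ?thesis unfolding amplitude_def[abs_def]
    by (intro generic_rational_mult generic_rational_prod 1 2 finA) auto
qed

text \<open>The factorisation 1/(x^2 + q^2) = 1/((q + i x)(q - i x)) writes every propagator with
  positive forms, and integration preserves this shape. Hence no denominator vanishes at positive
  arguments, generic or not.\<close>

lemma rational_on_matsubara_integral:
  assumes T: "tree T" and N: "(\<Sum>v\<in>verts G. N v) = 0"
  shows "rational_on (arcs G) (matsubara_integral G T N)"
proof -
  have TG: "T \<subseteq> arcs G" by (rule treeD[OF T])
  have kern: "matsubara_kernel G lborel (\<lambda>x. x) (\<lambda>a. of_real (sgn (Im a))) UNIV N T"
    by (rule matsubara_kernel_lborel[OF T N])
  \<comment> \<open>Inside its locale \<open>iterated\<close> belongs to one fixed \<open>q\<close>;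
    here it is needed as a function of \<open>q\<close>.\<close>
  define it where "it q bs z = matsubara_kernel.iterated G lborel (\<lambda>x. x) N T q bs z" for q bs z
  define de where "de e = (\<lambda>i. if i = e then 1 else 0 :: real)" for e :: 'e
  have de: "(\<Sum>i\<in>arcs G. de e i * q i) = q e" if "e \<in> arcs G" for e q
    using that by (simp add: de_def if_distrib[of "\<lambda>t. t * _"] cong: if_cong)
  have pos: "positive_form (arcs G) (de e, b, r)" if "e \<in> arcs G" for e b r
    using that by (auto simp: positive_form_def de_def)
  have "positive_fraction (arcs G) (\<lambda>q z. it q bs z)" if "set bs \<subseteq> arcs G - T" for bs
    using that
  proof (induction bs)
    case Nil
    have "positive_fraction (arcs G) (\<lambda>q z. 1 / ((extend N T (\<lambda>i. of_real (z i)) j)\<^sup>2 + (of_real (q j))\<^sup>2))"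
      if j: "j \<in> T" for j
    proof -
      have jG: "j \<in> arcs G" using j TG by auto
      define b where "b i = (if i \<in> arcs G - T then real_of_int (tree_coeff T j i) else 0)" for i
      define r where "r = real_of_int (tree_const N T j)"
      have x: "extend N T (\<lambda>i. of_real (z i)) j = complex_of_real (r + (\<Sum>i\<in>arcs G. b i * z i))" for z
      proof -
        have "(\<Sum>i\<in>arcs G. b i * z i) = (\<Sum>i\<in>arcs G - T. of_int (tree_coeff T j i) * z i)"
          by (intro sum.mono_neutral_cong_right) (auto simp: b_def)
        then show ?thesis unfolding extend_of_real using j by (simp add: extend_def r_def)
      qed
      have fv: "form_value (arcs G) q z (de j, b, r) = of_real (q j) + \<i> * extend N T (\<lambda>i. of_real (z i)) j"
        "form_value (arcs G) q z (de j, \<lambda>i. - b i, - r) = of_real (q j) - \<i> * extend N T (\<lambda>i. of_real (z i)) j" for q z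
        unfolding x form_value_def case_prod_conv de[OF jG] by (simp_all add: sum_negf algebra_simps)
      have "positive_fraction (arcs G) (\<lambda>q z. 1 / form_value (arcs G) q z (de j, b, r) *
         (1 / form_value (arcs G) q z (de j, \<lambda>i. - b i, - r) * 1))"
        by (intro positive_fraction.divide positive_fraction.const pos jG)
      moreover have "1 / (u + \<i> * v) * (1 / (u - \<i> * v) * 1) = 1 / (v\<^sup>2 + u\<^sup>2)" for u v :: complex
        by (simp add: power2_eq_square algebra_simps)
      ultimately show ?thesis unfolding fv by simp
    qed
    then have "positive_fraction (arcs G) (\<lambda>q z. \<Prod>j\<in>T. 1 / ((extend N T (\<lambda>i. of_real (z i)) j)\<^sup>2 + (of_real (q j))\<^sup>2))"
      by (intro positive_fraction_prod finite_subset[OF TG finite_arcs])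
    then show ?case unfolding it_def matsubara_kernel.iterated.simps(1)[OF kern] .
  next
    case (Cons e bs)
    have e: "e \<in> arcs G" and IH: "positive_fraction (arcs G) (\<lambda>q z. it q bs z)" using Cons by auto
    define f where "f = (de e, \<lambda>i :: 'e. 0 :: real, 0 :: real)"
    have fv: "form_value (arcs G) q z f = of_real (q e)" for q z
      unfolding f_def form_value_def case_prod_conv de[OF e] by simp
    have ul: "upper (arcs G) q z [f] y * lower (arcs G) q z [f] y = 1 / ((of_real y)\<^sup>2 + (of_real (q e))\<^sup>2)" for q z y
      unfolding upper_def lower_def by (simp add: fv power2_eq_square algebra_simps)
    have "positive_fraction (arcs G) (\<lambda>q z. LINT y|lborel. upper (arcs G) q z [f] y * lower (arcs G) q z [f] y * it q bs (z(e := y)))"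
      using positive_fraction_integrate[OF finite_arcs IH, of "[f]" "[f]" e] pos[OF e] by (simp add: f_def)
    then show ?case unfolding ul unfolding it_def matsubara_kernel.iterated.simps(2)[OF kern] .
  qed
  moreover obtain bs where bs: "set bs = arcs G - T" "distinct bs"
    using finite_distinct_list[of "arcs G - T"] by auto
  ultimately have pf: "positive_fraction (arcs G) (\<lambda>q z. it q bs z)" by simp
  show ?thesis
  proof (rule rational_on_cong[OF conjunct1[OF positive_fraction_rational[OF finite_arcs pf]]])
    fix q assume q: "positive_on (arcs G) q"
    interpret matsubara_kernel G lborel "\<lambda>x. x" "\<lambda>a. of_real (sgn (Im a))" UNIV N T q by (rule kern)
    have "it q bs (\<lambda>_. 0) = of_real (matsubara_integral G T N q)"
      unfolding it_def matsubara_integral_eq[OF T N]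
      by (rule iterated_eq_weight_integral[OF _ bs(2,1)]) (use q in \<open>force simp: positive_on_def\<close>)
    then show "matsubara_integral G T N q = Re (it q bs (\<lambda>_. 0))" by simp
  qed
qed

end

subsection \<open>Regular points and the operator\<close>

lemma flip_singleton: "flip {i} q = q(i := - q i)"
  by (auto simp: flip_def fun_eq_iff)

lemma thermal_prod_singleton: "thermal_prod {i} f = thermal i f"
  by (simp add: thermal_prod_insert thermal_prod_empty)

text \<open>Aim the line from \<open>q\<close> at a point where \<open>f\<close> is nonzero and some
  coordinate differs from that of \<open>q\<close>. Along it \<open>f\<close> is a nonzero
  polynomial in \<open>t\<close>, whose finitely many roots are avoided for small positive
  \<open>t\<close>.\<close>

lemma polynomial_in_eventually_regular_line:
  assumes E: "finite E" "E \<noteq> {}" and q: "positive_on E q" and f: "polynomial_in E f" "f a \<noteq> 0"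
  shows "\<exists>d. \<forall>\<^sub>F t in at_right (0 :: real).
    positive_on E (\<lambda>i. q i + t * d i) \<and> (\<lambda>i. q i + t * d i) \<noteq> q \<and> f (\<lambda>i. q i + t * d i) \<noteq> 0"
proof -
  obtain k where k: "k \<in> E" using E(2) by blast
  have "polynomial_in E (\<lambda>p. p k + - q k)" using k by (intro polynomial_in.intros)
  moreover have "(q(k := q k + 1)) k + - q k \<noteq> 0" by simp
  ultimately obtain c where c: "f c * (c k + - q k) \<noteq> 0" using polynomial_in_mult_nonzero[OF f] by blast
  define d where "d = (\<lambda>i. c i - q i)"
  obtain p where p: "\<And>t. f (\<lambda>i. q i + t * d i) = poly p t" using polynomial_in_on_line[OF f(1), of q d] by blast
  have "poly p 1 \<noteq> 0" unfolding p[symmetric] using c by (simp add: d_def)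
  then have "finite {t. poly p t = 0}" by (intro poly_roots_finite) auto
  then have "\<forall>\<^sub>F t in at_right 0. \<forall>s\<in>{t. poly p t = 0}. t \<noteq> s"
    by (rule eventually_ball_finite) (simp add: eventually_neq_at_within)
  moreover have "\<forall>\<^sub>F t in at_right (0 :: real). \<forall>i\<in>E. q i + t * d i > 0"
  proof (rule eventually_ball_finite[OF E(1)], rule ballI)
    fix i assume "i \<in> E"
    have "((\<lambda>t. q i + t * d i) \<longlongrightarrow> q i + 0 * d i) (at_right 0)" by (intro tendsto_intros)
    then show "\<forall>\<^sub>F t in at_right (0 :: real). q i + t * d i > 0"
      by (rule order_tendstoD) (use q \<open>i \<in> E\<close> in \<open>simp add: positive_on_def\<close>)
  qed
  moreover have "\<forall>\<^sub>F t in at_right (0 :: real). t > 0" by (rule eventually_at_right_less)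
  ultimately have "\<forall>\<^sub>F t in at_right (0 :: real). positive_on E (\<lambda>i. q i + t * d i) \<and>
    (\<lambda>i. q i + t * d i) \<noteq> q \<and> f (\<lambda>i. q i + t * d i) \<noteq> 0"
  proof eventually_elim
    case (elim t)
    have "q k + t * d k \<noteq> q k" using elim(3) c by (simp add: d_def)
    then have "(\<lambda>i. q i + t * d i) \<noteq> q" by (metis)
    then show ?case using elim(1,2) by (auto simp: positive_on_def p)
  qed
  then show ?thesis by blast
qed

text \<open>On a line the closed form is a quotient of polynomials in one variable whose denominator
  is nonzero at 0.\<close>

lemma tendsto_closed_form_line:
  assumes "finite E" "regular_at E f (flip B q)"
  shows "((\<lambda>t. closed_form E f (flip B (\<lambda>i. q i + t * d i))) \<longlongrightarrow> closed_form E f (flip B q)) (at_right 0)"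
proof -
  obtain P Q where R: "rational_expression E f P Q" and Q: "Q (flip B q) \<noteq> 0"
    using assms(2) unfolding regular_at_def by blast
  then have PQ: "polynomial_in E P" "polynomial_in E Q" unfolding rational_expression_def by blast+
  obtain p where p: "\<And>t. P (flip B (\<lambda>i. q i + t * d i)) = poly p t"
    using polynomial_in_on_line[OF polynomial_in_flip[OF PQ(1)], of B q d] by blast
  obtain r where r: "\<And>t. Q (flip B (\<lambda>i. q i + t * d i)) = poly r t"
    using polynomial_in_on_line[OF polynomial_in_flip[OF PQ(2)], of B q d] by blast
  have 0: "poly p 0 = P (flip B q)" "poly r 0 = Q (flip B q)" using p[of 0] r[of 0] by simp_all
  have lim: "(poly r \<longlongrightarrow> poly r 0) (at_right 0)" "(poly p \<longlongrightarrow> poly p 0) (at_right 0)"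
    by (rule tendsto_poly[OF tendsto_ident_at])+
  have "((\<lambda>t. poly p t / poly r t) \<longlongrightarrow> poly p 0 / poly r 0) (at_right 0)"
    using lim Q 0 by (intro tendsto_divide) auto
  moreover have "\<forall>\<^sub>F t in at_right 0. poly p t / poly r t = closed_form E f (flip B (\<lambda>i. q i + t * d i))"
    using tendsto_imp_eventually_ne[OF lim(1), of 0] Q 0(2)
  proof (simp, elim eventually_mono)
    fix t assume "poly r t \<noteq> 0"
    then show "poly p t / poly r t = closed_form E f (flip B (\<lambda>i. q i + t * d i))"
      using closed_form_eq[OF R _ assms(1), of "flip B (\<lambda>i. q i + t * d i)"] by (simp add: p r)
  qed
  ultimately show ?thesis unfolding closed_form_eq[OF R Q assms(1)] 0 by (rule Lim_transform_eventually)
qed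

lemma filterlim_line:
  fixes q d :: "'e \<Rightarrow> real"
  assumes "\<forall>\<^sub>F t in at_right 0. (\<lambda>i. q i + t * d i) \<in> D \<and> (\<lambda>i. q i + t * d i) \<noteq> q"
  shows "filterlim (\<lambda>t i. q i + t * d i) (at q within D) (at_right 0)"
  unfolding filterlim_at
proof
  have "continuous_on UNIV (\<lambda>t i. q i + t * d i)"
    by (intro continuous_on_coordinatewise_then_product continuous_intros)
  then have "((\<lambda>t i. q i + t * d i) \<longlongrightarrow> (\<lambda>i. q i + 0 * d i)) (at 0)"
    by (simp only: continuous_on_def UNIV_I ball_UNIV)
  from tendsto_mono[OF at_le[OF subset_UNIV] this] show "((\<lambda>t i. q i + t * d i) \<longlongrightarrow> q) (at_right 0)"
    by simp
qed (rule assms)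

context matsubara_graph
begin

lemma cone_sign_cases:
  assumes T: "tree T" and bs: "set bs = arcs G - T" and A: "A \<in> trees_in (arcs G)" and l: "l \<in> arcs G - A"
  shows "cone_sign bs A l = 1 \<or> cone_sign bs A l = -1"
proof -
  interpret matsubara_kernel G lborel "\<lambda>x. x" "\<lambda>a. of_real (sgn (Im a))" UNIV "\<lambda>_. 0" T "\<lambda>_. 0"
    by (rule matsubara_kernel_lborel[OF T]) simp
  have "lines bs = arcs G" using bs treeD(1)[OF T] by (auto simp: lines_def)
  then have "ternary_value bs (tree_cycle A l) \<noteq> 0"
    using ternary_value_tree_cycle_nonzero[of bs A l] bs A l by simp
  then show ?thesis by (simp add: cone_sign_def sgn_if)
qed

text \<open>Carries the amplitude formula from positive arguments over to reflected ones, where the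
  integral itself gives no information.\<close>

lemma rational_expression_amplitudes:
  assumes T: "tree T" and N: "(\<Sum>v\<in>verts G. N v) = 0" and bs: "distinct bs" "set bs = arcs G - T"
    and R: "rational_expression (arcs G) (matsubara_integral G T N) P Q"
    and gen: "generic (arcs G) q" and Q: "Q q \<noteq> 0"
  shows "of_real (P q / Q q) = (\<Sum>A\<in>trees_in (arcs G). amplitude N (cone_sign bs A) A q)"
proof (rule generic_rational_continuation[OF finite_arcs R _ _ gen Q])
  show "generic_rational (arcs G) (\<lambda>q. \<Sum>A\<in>trees_in (arcs G). amplitude N (cone_sign bs A) A q)"
  proof (rule generic_rational_sum[OF finite_trees_in])
    fix A assume A: "A \<in> trees_in (arcs G)"
    show "generic_rational (arcs G) (amplitude N (cone_sign bs A) A)"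
      by (rule generic_rational_amplitude[OF trees_inD(1)[OF A] cone_sign_cases[OF T bs(2) A]])
  qed
  show "of_real (matsubara_integral G T N q) = (\<Sum>A\<in>trees_in (arcs G). amplitude N (cone_sign bs A) A q)"
    if "positive_on (arcs G) q" "generic (arcs G) q" for q
    by (rule matsubara_integral_amplitudes[OF T N that(2) bs]) (use that(1) in \<open>simp add: positive_on_def\<close>)
qed

lemma card_not_cutset:
  assumes "A \<subseteq> arcs G" "\<not> cutset G A"
  shows "card A \<le> num_cycles G"
proof -
  obtain B where B: "tree B" "A \<subseteq> arcs G - B" using assms not_cutset_iff by blast
  have "card A \<le> card (arcs G - B)" by (rule card_mono) (use B in auto)
  also have "\<dots> = card (arcs G) - card B"
    by (rule card_Diff_subset[OF finite_subset[OF treeD(1)[OF B(1)] finite_arcs] treeD(1)[OF B(1)]])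
  finally show ?thesis
    using conn_card[OF treeD[OF B(1)]] card_mono[OF finite_arcs treeD(1)[OF B(1)]] unfolding num_cycles_def by linarith
qed

text \<open>The single sum of the operator also runs over bridges, which are cutsets. Evenness of
  \<open>f\<close> in a bridge makes that term zero, so the empty set and the singletons fit the
  same description as the larger sets.\<close>

lemma matsubara_operator_eq:
  assumes bridge: "\<And>i. i \<in> arcs G \<Longrightarrow> cutset G {i} \<Longrightarrow> f (q(i := - q i)) = f q"
  shows "matsubara_operator G f q = (\<Sum>A | A \<subseteq> arcs G \<and> \<not> cutset G A. thermal_prod A f q)"
proof -
  define S where "S k = {A. A \<subseteq> arcs G \<and> card A = k \<and> \<not> cutset G A}" for k
  have fin: "finite A" if "A \<subseteq> arcs G" for A by (rule finite_subset[OF that finite_arcs])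
  have S: "{A. A \<subseteq> arcs G \<and> \<not> cutset G A} = (\<Union>k\<in>insert 0 (insert 1 {2..num_cycles G}). S k)" (is "_ = ?U")
  proof
    show "{A. A \<subseteq> arcs G \<and> \<not> cutset G A} \<subseteq> ?U"
    proof
      fix A assume A: "A \<in> {A. A \<subseteq> arcs G \<and> \<not> cutset G A}"
      then have "card A \<in> insert 0 (insert 1 {2..num_cycles G})" using card_not_cutset[of A] by auto
      moreover have "A \<in> S (card A)" using A by (simp add: S_def)
      ultimately show "A \<in> ?U" by blast
    qed
  qed (auto simp: S_def)
  have "\<not> cutset G {}" using conn_arcs by (simp add: cutset_def conn_def)
  then have S0: "S 0 = {{}}" using fin by (auto simp: S_def)
  have S1: "S 1 = (\<lambda>i. {i}) ` {i \<in> arcs G. \<not> cutset G {i}}" by (auto simp: S_def card_1_singleton_iff)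
  have "(\<Sum>A\<in>S 1. thermal_prod A f q) = (\<Sum>i | i \<in> arcs G \<and> \<not> cutset G {i}. thermal i f q)"
    unfolding S1 by (subst sum.reindex) (auto simp: inj_on_def thermal_prod_singleton)
  also have "\<dots> = (\<Sum>i\<in>arcs G. thermal i f q)"
    by (rule sum.mono_neutral_left) (auto simp: thermal_def reflection_def bridge)
  finally have 1: "(\<Sum>A\<in>S 1. thermal_prod A f q) = (\<Sum>i\<in>arcs G. thermal i f q)" .
  have "(\<Sum>A | A \<subseteq> arcs G \<and> \<not> cutset G A. thermal_prod A f q)
    = (\<Sum>k\<in>insert 0 (insert 1 {2..num_cycles G}). \<Sum>A\<in>S k. thermal_prod A f q)"
    unfolding S
  proof (rule sum.UNION_disjoint)
    have "finite (S k)" for k by (rule finite_subset[of _ "Pow (arcs G)"]) (auto simp: S_def)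
    then show "\<forall>k\<in>insert 0 (insert 1 {2..num_cycles G}). finite (S k)" by blast
  qed (auto simp: S_def)
  also have "\<dots> = matsubara_operator G f q"
    unfolding matsubara_operator_def S_def[symmetric] by (simp add: S0 1[simplified] thermal_prod_empty)
  finally show ?thesis ..
qed

text \<open>At points where all reflections of the closed form are given by amplitudes, the operator
  is expanded tree by tree and compared with the amplitude formula of the sum.\<close>

lemma matsubara_operator_eq_sum:
  assumes T: "tree T" and N: "(\<Sum>v\<in>verts G. N v) = 0" and q: "\<And>i. i \<in> arcs G \<Longrightarrow> q i > 0"
    and R: "rational_expression (arcs G) (matsubara_integral G T N) P Q"
    and gen: "generic (arcs G) q" and Q: "\<And>B. B \<subseteq> arcs G \<Longrightarrow> Q (flip B q) \<noteq> 0"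
  shows "matsubara_operator G (closed_form (arcs G) (matsubara_integral G T N)) q = matsubara_sum G N q"
proof -
  obtain bs where bs: "distinct bs" "set bs = arcs G - T"
    using finite_distinct_list[of "arcs G - T"] by auto
  define f where "f = closed_form (arcs G) (matsubara_integral G T N)"
  define a where "a A q = amplitude N (cone_sign bs A) A q" for A q
  define w where "w A A' = (\<Prod>i\<in>A. complex_of_real (n_b (q i))) * (\<Sum>B\<in>Pow A. (-1) ^ card B * a A' (flip B q))" for A A'
  have fin: "finite A" if "A \<subseteq> arcs G" for A by (rule finite_subset[OF that finite_arcs])
  have even: "a A (flip (insert i B) q) = a A (flip B q)" if "A \<in> trees_in (arcs G)" "i \<in> A" "i \<notin> B" for A i B
    unfolding a_def flip_insert[OF that(3)] by (rule amplitude_even[OF trees_inD(2)[OF that(1)] that(2)])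
  have f: "of_real (f (flip B q)) = (\<Sum>A\<in>trees_in (arcs G). a A (flip B q))" if "B \<subseteq> arcs G" for B
    unfolding a_def f_def closed_form_eq[OF R Q[OF that] finite_arcs]
    by (rule rational_expression_amplitudes[OF T N bs R generic_flip[OF gen] Q[OF that]])
  \<comment> \<open>A bridge lies in every spanning tree, so all amplitudes are even in it.\<close>
  have bridge: "f (q(i := - q i)) = f q" if i: "i \<in> arcs G" "cutset G {i}" for i
  proof -
    have "i \<in> A" if "A \<in> trees_in (arcs G)" for A
      using not_cutset_iff[of "{i}"] i trees_inD(1)[OF that] by auto
    then have "complex_of_real (f (flip {i} q)) = of_real (f (flip {} q))"
      using f[of "{i}"] f[of "{}"] even[of _ i "{}"] i by simp
    then show ?thesis unfolding flip_singleton by simp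
  qed
  have "complex_of_real (matsubara_operator G f q) = (\<Sum>A | A \<subseteq> arcs G \<and> \<not> cutset G A. of_real (thermal_prod A f q))"
    by (simp only: matsubara_operator_eq[OF bridge] of_real_sum)
  also have "\<dots> = (\<Sum>A | A \<subseteq> arcs G \<and> \<not> cutset G A. \<Sum>A'\<in>trees_in (arcs G). w A A')"
  proof (rule sum.cong[OF refl])
    fix A assume "A \<in> {A. A \<subseteq> arcs G \<and> \<not> cutset G A}"
    then have A: "A \<subseteq> arcs G" by simp
    have "complex_of_real (thermal_prod A f q)
      = (\<Prod>i\<in>A. of_real (n_b (q i))) * (\<Sum>B\<in>Pow A. (-1) ^ card B * of_real (f (flip B q)))"
      by (simp add: thermal_prod_expand[OF fin[OF A]])
    also have "(\<Sum>B\<in>Pow A. (-1) ^ card B * complex_of_real (f (flip B q)))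
      = (\<Sum>B\<in>Pow A. \<Sum>A'\<in>trees_in (arcs G). (-1) ^ card B * a A' (flip B q))"
    proof (rule sum.cong[OF refl])
      fix B assume "B \<in> Pow A"
      then have "B \<subseteq> arcs G" using A by auto
      then show "(-1) ^ card B * complex_of_real (f (flip B q)) = (\<Sum>A'\<in>trees_in (arcs G). (-1) ^ card B * a A' (flip B q))"
        by (simp only: f sum_distrib_left)
    qed
    also have "\<dots> = (\<Sum>A'\<in>trees_in (arcs G). \<Sum>B\<in>Pow A. (-1) ^ card B * a A' (flip B q))" by (rule sum.swap)
    finally show "complex_of_real (thermal_prod A f q) = (\<Sum>A'\<in>trees_in (arcs G). w A A')"
      by (simp only: w_def sum_distrib_left)
  qed
  also have "\<dots> = (\<Sum>A'\<in>trees_in (arcs G). \<Sum>A | A \<subseteq> arcs G \<and> \<not> cutset G A. w A A')" by (rule sum.swap)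
  also have "\<dots> = (\<Sum>A'\<in>trees_in (arcs G). \<Sum>A\<in>Pow (arcs G - A'). w A A')"
  proof (rule sum.cong[OF refl], rule sum.mono_neutral_right)
    fix A' assume A': "A' \<in> trees_in (arcs G)"
    show "finite {A. A \<subseteq> arcs G \<and> \<not> cutset G A}" by (rule finite_subset[of _ "Pow (arcs G)"]) auto
    show "Pow (arcs G - A') \<subseteq> {A. A \<subseteq> arcs G \<and> \<not> cutset G A}"
      using not_cutset_iff trees_inD(1)[OF A'] by blast
    show "\<forall>A\<in>{A. A \<subseteq> arcs G \<and> \<not> cutset G A} - Pow (arcs G - A'). w A A' = 0"
    proof
      fix A assume A: "A \<in> {A. A \<subseteq> arcs G \<and> \<not> cutset G A} - Pow (arcs G - A')"
      then obtain i where i: "i \<in> A" "i \<in> A'" by auto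
      have finA: "finite (A - {i})" using fin[of A] A by simp
      have "(\<Sum>B\<in>Pow A. (-1) ^ card B * a A' (flip B q)) = (\<Sum>B\<in>Pow (insert i (A - {i})). (-1) ^ card B * a A' (flip B q))"
        using i by (simp add: insert_absorb)
      also have "\<dots> = (\<Sum>B\<in>Pow (A - {i}). (-1) ^ card B * a A' (flip B q) + (-1) ^ card (insert i B) * a A' (flip (insert i B) q))"
        by (rule sum_Pow_insert[OF finA]) simp
      \<comment> \<open>Evenness in \<open>i\<close> makes the terms of \<open>B\<close> and
        \<open>insert i B\<close> cancel.\<close>
      also have "\<dots> = 0"
      proof (rule sum.neutral, rule ballI)
        fix B assume B: "B \<in> Pow (A - {i})"
        then have "i \<notin> B" "finite B" using finite_subset[OF _ finA] by auto
        then show "(-1) ^ card B * a A' (flip B q) + (-1) ^ card (insert i B) * a A' (flip (insert i B) q) = 0"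
          using even[OF A' i(2)] by simp
      qed
      finally show "w A A' = 0" by (simp add: w_def)
    qed
  qed
  \<comment> \<open>Summing over all sets off the tree that contain \<open>B\<close> creates the
    factors 1 + n found in the formula for the sum.\<close>
  also have "\<dots> = (\<Sum>A'\<in>trees_in (arcs G). \<Sum>B\<in>Pow (arcs G - A'). ((\<Prod>i\<in>B. of_real (n_b (q i))) *
      (\<Prod>i\<in>arcs G - A' - B. 1 + of_real (n_b (q i)))) * ((-1) ^ card B * a A' (flip B q)))"
    unfolding w_def by (rule sum.cong[OF refl], rule sum_Pow_Pow) simp
  also have "\<dots> = of_real (matsubara_sum G N q)"
    by (subst matsubara_sum_amplitudes[OF T N gen bs]) (simp_all add: q a_def)
  finally show ?thesis unfolding f_def of_real_eq_iff .
qed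

text \<open>Expanded, each term is a finite combination of reflected closed forms, and
  \<open>regular_points\<close> demands regularity at exactly these reflections.\<close>

lemma tendsto_matsubara_operator_line:
  assumes q: "q \<in> regular_points G f"
  shows "((\<lambda>t. matsubara_operator G (closed_form (arcs G) f) (\<lambda>i. q i + t * d i))
    \<longlongrightarrow> matsubara_operator G (closed_form (arcs G) f) q) (at_right 0)"
proof -
  define h where "h = closed_form (arcs G) f"
  have pos: "q i > 0" if "i \<in> arcs G" for i using q that by (simp add: regular_points_def positive_on_def)
  have h: "((\<lambda>t. h (flip B (\<lambda>i. q i + t * d i))) \<longlongrightarrow> h (flip B q)) (at_right 0)"
    if "A \<subseteq> arcs G" "card A \<le> 1 \<or> card A \<le> num_cycles G \<and> \<not> cutset G A" "B \<subseteq> A" for A B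
  proof -
    have "flip B q = (\<lambda>i. if i \<in> B then - q i else q i)" by (simp add: flip_def fun_eq_iff)
    then have "regular_at (arcs G) f (flip B q)" using q that unfolding regular_points_def by auto
    then show ?thesis unfolding h_def by (rule tendsto_closed_form_line[OF finite_arcs])
  qed
  have n: "((\<lambda>t. n_b (q i + t * d i)) \<longlongrightarrow> n_b (q i)) (at_right 0)" if "i \<in> arcs G" for i
  proof -
    have "((\<lambda>t. n_b (q i + t * d i)) \<longlongrightarrow> 1 / (exp (2 * pi * (q i + 0 * d i)) - 1)) (at_right 0)"
      unfolding n_b_def by (intro tendsto_intros) (use pos[OF that] in simp)
    then show ?thesis by (simp add: n_b_def)
  qed
  have th: "((\<lambda>t. thermal_prod A h (\<lambda>i. q i + t * d i)) \<longlongrightarrow> thermal_prod A h q) (at_right 0)"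
    if A: "A \<subseteq> arcs G" "card A \<le> 1 \<or> card A \<le> num_cycles G \<and> \<not> cutset G A" for A
    unfolding thermal_prod_expand[OF finite_subset[OF A(1) finite_arcs]]
    by (intro tendsto_mult tendsto_prod tendsto_sum tendsto_const n h[OF A]) (use A in auto)
  show ?thesis unfolding matsubara_operator_def h_def[symmetric]
    using th[of "{}"] th[of "{_}"]
    by (intro tendsto_add tendsto_sum th) (auto simp: thermal_prod_empty thermal_prod_singleton)
qed

lemma matsubara_integral_rational_expression:
  assumes "tree T" "(\<Sum>v\<in>verts G. N v) = 0"
  shows "\<exists>P Q. rational_expression (arcs G) (matsubara_integral G T N) P Q"
  using rational_on_matsubara_integral[OF assms] by (simp only: rational_on_def)

text \<open>One nonzero polynomial collects all obstacles, namely genericity and the denominators at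
  every reflection, so a single line avoids them all near \<open>q\<close>.\<close>

lemma eventually_regular_line:
  assumes T: "tree T" and N: "(\<Sum>v\<in>verts G. N v) = 0" and q: "\<And>i. i \<in> arcs G \<Longrightarrow> q i > 0"
  shows "\<exists>d. \<forall>\<^sub>F t in at_right 0. (\<lambda>i. q i + t * d i) \<in> regular_points G (matsubara_integral G T N) \<and>
    (\<lambda>i. q i + t * d i) \<noteq> q \<and>
    matsubara_operator G (closed_form (arcs G) (matsubara_integral G T N)) (\<lambda>i. q i + t * d i)
      = matsubara_sum G N (\<lambda>i. q i + t * d i)"
proof -
  obtain P Q where R: "rational_expression (arcs G) (matsubara_integral G T N) P Q"
    using matsubara_integral_rational_expression[OF T N] by blast
  define F where "F p = generic_poly (arcs G) p * (\<Prod>B\<in>Pow (arcs G). Q (flip B p))" for p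
  have Q: "polynomial_in (arcs G) (\<lambda>p. Q (flip B p))" for B
    using R unfolding rational_expression_def by (intro polynomial_in_flip) blast
  have Q1: "\<exists>c. Q (flip B c) \<noteq> 0" for B
  proof
    \<comment> \<open>Reflecting twice leads back to a positive point, where the denominator is
      nonzero.\<close>
    have "positive_on (arcs G) (\<lambda>_. 1)" by (simp add: positive_on_def)
    then show "Q (flip B (flip B (\<lambda>_. 1))) \<noteq> 0" using R unfolding rational_expression_def flip_flip by blast
  qed
  have fP: "finite (Pow (arcs G))" by simp
  obtain b where b: "generic_poly (arcs G) b \<noteq> 0" using polynomial_in_generic_poly(2)[OF finite_arcs] by blast
  obtain c where c: "(\<Prod>B\<in>Pow (arcs G). Q (flip B c)) \<noteq> 0"
    using polynomial_in_prod_nonzero[where f = "\<lambda>B p. Q (flip B p)", OF fP Q Q1] by blast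
  have pP: "polynomial_in (arcs G) (\<lambda>p. \<Prod>B\<in>Pow (arcs G). Q (flip B p))" by (rule polynomial_in_prod[OF fP Q])
  have "\<exists>e. F e \<noteq> 0"
    unfolding F_def
    by (rule polynomial_in_mult_nonzero[where f = "generic_poly (arcs G)" and g = "\<lambda>p. \<Prod>B\<in>Pow (arcs G). Q (flip B p)",
          OF polynomial_in_generic_poly(1)[OF finite_arcs] b pP c])
  then obtain e where e: "F e \<noteq> 0" ..
  have F: "polynomial_in (arcs G) F"
    unfolding F_def[abs_def]
    by (rule polynomial_in.mult[OF polynomial_in_generic_poly(1)[OF finite_arcs] pP])
  obtain v where "v \<in> verts G" using verts_nonempty by blast
  then have "card {i \<in> arcs G. tail G i = v \<or> head G i = v} \<noteq> 0" using two_lines[of v] by linarith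
  then have ne: "arcs G \<noteq> {}" by auto
  have qp: "positive_on (arcs G) q" using q by (simp add: positive_on_def)
  obtain d where d: "\<forall>\<^sub>F t in at_right 0. positive_on (arcs G) (\<lambda>i. q i + t * d i) \<and>
      (\<lambda>i. q i + t * d i) \<noteq> q \<and> F (\<lambda>i. q i + t * d i) \<noteq> 0"
    using polynomial_in_eventually_regular_line[of "arcs G" q F e, OF finite_arcs ne qp F e] by blast
  have good: "p \<in> regular_points G (matsubara_integral G T N) \<and>
    matsubara_operator G (closed_form (arcs G) (matsubara_integral G T N)) p = matsubara_sum G N p"
    if p: "positive_on (arcs G) p" "F p \<noteq> 0" for p
  proof
    have nz: "generic_poly (arcs G) p \<noteq> 0" "(\<Prod>B\<in>Pow (arcs G). Q (flip B p)) \<noteq> 0"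
      using p(2) unfolding F_def mult_eq_0_iff by blast+
    have gen: "generic (arcs G) p" unfolding generic_iff[OF finite_arcs] by (rule nz(1))
    have Qp: "Q (flip B p) \<noteq> 0" if "B \<subseteq> arcs G" for B
      using nz(2) that unfolding prod_zero_iff[OF fP] by blast
    show "matsubara_operator G (closed_form (arcs G) (matsubara_integral G T N)) p = matsubara_sum G N p"
      by (rule matsubara_operator_eq_sum[of T N p P Q, OF T N _ R gen])
        (use p(1) Qp in \<open>auto simp: positive_on_def\<close>)
    have reg: "regular_at (arcs G) (matsubara_integral G T N) (\<lambda>i. if i \<in> B then - p i else p i)" if "B \<subseteq> arcs G" for B
    proof -
      have "flip B p = (\<lambda>i. if i \<in> B then - p i else p i)" by (simp add: flip_def fun_eq_iff)
      moreover have "regular_at (arcs G) (matsubara_integral G T N) (flip B p)"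
        unfolding regular_at_def using R Qp[OF that] by blast
      ultimately show ?thesis by simp
    qed
    show "p \<in> regular_points G (matsubara_integral G T N)"
      unfolding regular_points_def mem_Collect_eq using p(1) by (intro conjI allI impI reg) auto
  qed
  show ?thesis by (rule exI[of _ d], rule eventually_mono[OF d]) (simp add: good)
qed

end

theorem theorem3p4:
  fixes G :: "('v, 'e) pre_digraph"
    and N :: "'v \<Rightarrow> int"
    and q :: "'e \<Rightarrow> real"
    and T :: "'e set"
  assumes "matsubara_graph G"
    and "(\<Sum>v\<in>verts G. N v) = 0"
    and "\<And>i. i \<in> arcs G \<Longrightarrow> q i > 0"
    and "spanning_tree_lines G T"
  shows "let I_G = matsubara_integral G T N;
             RHS = matsubara_operator G (closed_form (arcs G) I_G);
             D = regular_points G I_G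
         in (\<exists>P Q. rational_expression (arcs G) I_G P Q) \<and>
            (q \<in> D \<longrightarrow> matsubara_sum G N q = RHS q) \<and>
            q islimpt D \<and> (RHS \<longlongrightarrow> matsubara_sum G N q) (at q within D)"
proof -
  interpret matsubara_graph G by (rule assms(1))
  define I where "I = matsubara_integral G T N"
  define RHS where "RHS = matsubara_operator G (closed_form (arcs G) I)"
  define D where "D = regular_points G I"
  note TN = assms(4,2)
  have line: "\<exists>d. filterlim (\<lambda>t i. p i + t * d i) (at p within D) (at_right 0) \<and>
      (\<forall>\<^sub>F t in at_right 0. RHS (\<lambda>i. p i + t * d i) = matsubara_sum G N (\<lambda>i. p i + t * d i))"
    if p: "\<And>i. i \<in> arcs G \<Longrightarrow> p i > 0" for p
  proof -
    obtain d where d: "\<forall>\<^sub>F t in at_right 0. (\<lambda>i. p i + t * d i) \<in> D \<and> (\<lambda>i. p i + t * d i) \<noteq> p \<and>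
        RHS (\<lambda>i. p i + t * d i) = matsubara_sum G N (\<lambda>i. p i + t * d i)"
      using eventually_regular_line[of T N p, OF TN] p unfolding D_def RHS_def I_def by blast
    have "filterlim (\<lambda>t i. p i + t * d i) (at p within D) (at_right 0)"
      by (rule filterlim_line, rule eventually_mono[OF d]) simp
    moreover have "\<forall>\<^sub>F t in at_right 0. RHS (\<lambda>i. p i + t * d i) = matsubara_sum G N (\<lambda>i. p i + t * d i)"
      by (rule eventually_mono[OF d]) simp
    ultimately show ?thesis by blast
  qed
  have pos: "p i > 0" if "p \<in> D" "i \<in> arcs G" for p i
    using that by (simp add: D_def regular_points_def positive_on_def)
  have within: "(matsubara_sum G N \<longlongrightarrow> matsubara_sum G N p) (at p within D)"
    if "\<And>i. i \<in> arcs G \<Longrightarrow> p i > 0" for p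
    by (rule tendsto_mono[OF at_le[OF subset_UNIV] tendsto_matsubara_sum[OF TN]]) (rule that)
  \<comment> \<open>A point of \<open>D\<close> need not be generic, so the identity is taken as a
    limit along a line of generic points: the operator is continuous there by regularity, and the
    sum by uniform convergence.\<close>
  have eq: "matsubara_sum G N p = RHS p" if p: "p \<in> D" for p
  proof -
    obtain d where d: "filterlim (\<lambda>t i. p i + t * d i) (at p within D) (at_right 0)"
      "\<forall>\<^sub>F t in at_right 0. RHS (\<lambda>i. p i + t * d i) = matsubara_sum G N (\<lambda>i. p i + t * d i)"
      using line[of p] pos[OF p] by blast
    have "((\<lambda>t. RHS (\<lambda>i. p i + t * d i)) \<longlongrightarrow> RHS p) (at_right 0)"
      unfolding RHS_def by (rule tendsto_matsubara_operator_line) (use p in \<open>simp add: D_def\<close>)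
    then have "((\<lambda>t. matsubara_sum G N (\<lambda>i. p i + t * d i)) \<longlongrightarrow> RHS p) (at_right 0)"
      using d(2) by (rule Lim_transform_eventually)
    moreover have "(matsubara_sum G N \<longlongrightarrow> matsubara_sum G N p) (at p within D)"
      by (rule within) (rule pos[OF p])
    ultimately show ?thesis using filterlim_compose[OF _ d(1)]
      by (intro tendsto_unique[OF trivial_limit_at_right_real])
  qed
  have "q islimpt D"
  \<comment> \<open>The line stays in \<open>D\<close> and off \<open>q\<close> for small positive
    parameters, so it witnesses a limit point.\<close>
  proof -
    obtain d where d: "filterlim (\<lambda>t i. q i + t * d i) (at q within D) (at_right 0)"
      using line[of q] assms(3) by blast
    have "at q within D \<noteq> bot"
    proof
      assume "at q within D = bot"
      then have "at_right (0 :: real) = bot" using d by (simp add: filterlim_def bot_unique filtermap_bot_iff)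
      then show False using trivial_limit_at_right_real[of 0] by simp
    qed
    then show ?thesis by (simp add: trivial_limit_within)
  qed
  moreover have "(RHS \<longlongrightarrow> matsubara_sum G N q) (at q within D)"
    by (rule Lim_transform_eventually[OF within]) (simp_all add: eventually_at_filter eq assms(3))
  moreover have "\<exists>P Q. rational_expression (arcs G) I P Q"
    unfolding I_def by (rule matsubara_integral_rational_expression[OF TN])
  ultimately show ?thesis
    using eq[of q] unfolding Let_def I_def[symmetric] RHS_def[symmetric] D_def[symmetric] by blast
qed

end
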